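(* Let $0<p<1$, $r\in\mathbb{N}$, $\delta,\gamma\ge0$, $\Lambda>0$, and suppose that $w$ is a doubling weight from the class $\mathcal{W}^{\delta,\gamma}_\Lambda$ with $\gamma\le rp$. Then there exists a positive constant $\vartheta$, depending only on $r$, $p$, $\Lambda$, and the doubling constant of $w$, such that for every $f\in L_p[-1,1]$ and every $n\in\mathbb{N}$, $$\omega_\varphi^r(f,\vartheta n^{-1})_{p,w_n}\le\frac{c}{n^{r-\delta/p}}\left(\sum_{k=1}^n k^{rp-\delta-1}E_k(f)_{p,w_k}^p\right)^{1/p},$$ where the constant $c$ depends only on $r$, $p$ and the doubling constant of $w$.
   Context: A doubling weight is a nonnegative $w\in L_1[-1,1]$, extended by $0$ outside $[-1,1]$, for which there is a constant $L$ (the doubling constant of $w$) with $\int_{2I}w\le L\int_I w$ for all intervals $I\subset[-1,1]$, where $2I$ is the interval with the same center as $I$ and twice its length. Let $\varphi(x)=\sqrt{1-x^2}$, $\rho_n(x)=n^{-1}\sqrt{1-x^2}+n^{-2}$, and $w_n(x)=\frac{1}{\rho_n(x)}\int_{x-\rho_n(x)}^{x+\rho_n(x)}w(u)\,du$. Class $\mathcal{W}^{\delta,\gamma}_\Lambda$ ($\delta,\gamma\ge0$, $\Lambda>0$): all doubling weights $w$ such that for all $m,n\in\mathbb{N}$ with $m\le n$ and all $x\in[-1,1]$, $w_n(x)\varphi(x)^\gamma\le\Lambda n^\delta m^{\gamma-\delta}\rho_m(x)^\gamma w_m(x)$ (with $\varphi(x)^0=1$). For a weight $v$ on $[-1,1]$: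 $\|g\|_{p,v}=\left(\int_{-1}^1|g|^p v\right)^{1/p}$. $\Pi_n$ is the set of algebraic polynomials of degree $\le n-1$ and $E_n(f)_{p,v}=\inf_{P\in\Pi_n}\|f-P\|_{p,v}$. Symmetric difference: $\Delta_h^r(f,x)=\sum_{i=0}^r\binom ri(-1)^{r-i}f(x-rh/2+ih)$ if $x\pm rh/2\in[-1,1]$, and $0$ otherwise. Modulus: $\omega_\varphi^r(f,t)_{p,v}=\sup_{0<h\le t}\|\Delta_{h\varphi(\cdot)}^r(f,\cdot)\|_{p,v}$. *)

theory Defs
  imports "HOL-Analysis.Analysis" "HOL-Computational_Algebra.Polynomial"
begin

text \<open>
  All integrals are Lebesgue integrals (completed measure). Quantities such as norms, infima and
  suprema are real-valued: they are only used for functions in \<open>Lp p\<close> and for the bounded weights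
  \<open>avg_weight w n\<close>, where every integral, infimum and supremum involved is finite.
\<close>

definition phi :: "real \<Rightarrow> real" where
  "phi x = sqrt (1 - x\<^sup>2)"

definition rho :: "nat \<Rightarrow> real \<Rightarrow> real" where
  "rho n x = sqrt (1 - x\<^sup>2) / real n + 1 / (real n)\<^sup>2"

text \<open>
  The doubling constant \<open>L\<close> is any constant for which the doubling inequality holds, not necessarily
  the least one. If \<open>I = [a, b]\<close>, then \<open>2I = [a - (b - a)/2, b + (b - a)/2]\<close>, which may leave
  \<open>[-1, 1]\<close>; whether endpoints belong to the interval does not affect the integrals.
\<close>
definition doubling_weight :: "real \<Rightarrow> (real \<Rightarrow> real) \<Rightarrow> bool" where
  "doubling_weight L w \<longleftrightarrow>
     set_integrable lebesgue {-1..1} w \<and>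
     (\<forall>x. 0 \<le> w x) \<and>
     (\<forall>x. x \<notin> {-1..1} \<longrightarrow> w x = 0) \<and>
     (\<forall>a b. -1 \<le> a \<and> a < b \<and> b \<le> 1 \<longrightarrow>
        (LINT u:{a - (b - a) / 2..b + (b - a) / 2}|lebesgue. w u) \<le> L * (LINT u:{a..b}|lebesgue. w u))"

definition avg_weight :: "(real \<Rightarrow> real) \<Rightarrow> nat \<Rightarrow> real \<Rightarrow> real" where
  "avg_weight w n x = (1 / rho n x) * (LINT u:{x - rho n x..x + rho n x}|lebesgue. w u)"

text \<open>The case distinction implements \<open>\<phi>(x)\<^sup>0 = 1\<close> at \<open>x = \<plusminus>1\<close>, since \<open>0 powr 0 = 0\<close>.\<close>
definition phi_pow :: "real \<Rightarrow> real \<Rightarrow> real" where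
  "phi_pow \<gamma> x = (if \<gamma> = 0 then 1 else phi x powr \<gamma>)"

definition weight_class :: "real \<Rightarrow> real \<Rightarrow> real \<Rightarrow> (real \<Rightarrow> real) set" where
  "weight_class \<delta> \<gamma> \<Lambda> =
     {w. (\<exists>L. doubling_weight L w) \<and>
         (\<forall>m n. 1 \<le> m \<and> m \<le> n \<longrightarrow>
            (\<forall>x\<in>{-1..1}. avg_weight w n x * phi_pow \<gamma> x
               \<le> \<Lambda> * real n powr \<delta> * real m powr (\<gamma> - \<delta>) * rho m x powr \<gamma> * avg_weight w m x))}"

definition Lp :: "real \<Rightarrow> (real \<Rightarrow> real) set" where
  "Lp p = {f. set_borel_measurable lebesgue {-1..1} f \<and>
              set_integrable lebesgue {-1..1} (\<lambda>x. \<bar>f x\<bar> powr p)}"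

definition wnorm :: "real \<Rightarrow> (real \<Rightarrow> real) \<Rightarrow> (real \<Rightarrow> real) \<Rightarrow> real" where
  "wnorm p v g = (LINT x:{-1..1}|lebesgue. \<bar>g x\<bar> powr p * v x) powr (1 / p)"

definition best_approx :: "nat \<Rightarrow> (real \<Rightarrow> real) \<Rightarrow> real \<Rightarrow> (real \<Rightarrow> real) \<Rightarrow> real" where
  "best_approx n f p v = (INF P\<in>{P :: real poly. degree P \<le> n - 1}. wnorm p v (\<lambda>x. f x - poly P x))"

definition sym_diff :: "nat \<Rightarrow> real \<Rightarrow> (real \<Rightarrow> real) \<Rightarrow> real \<Rightarrow> real" where
  "sym_diff r h f x =
     (if x - real r * h / 2 \<in> {-1..1} \<and> x + real r * h / 2 \<in> {-1..1}
      then \<Sum>i=0..r. real (r choose i) * (-1) ^ (r - i) * f (x - real r * h / 2 + real i * h)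
      else 0)"

definition modulus_phi :: "nat \<Rightarrow> (real \<Rightarrow> real) \<Rightarrow> real \<Rightarrow> real \<Rightarrow> (real \<Rightarrow> real) \<Rightarrow> real" where
  "modulus_phi r f t p v = (SUP h\<in>{0<..t}. wnorm p v (\<lambda>x. sym_diff r (h * phi x) f x))"

end

theory Submission
  imports Defs "HOL-Complex_Analysis.Complex_Analysis"
begin

text \<open>
  Let \<open>P\<^sub>j\<close> be a nearly best approximant of degree below \<open>2 ^ j\<close>, and telescope \<open>f\<close> as \<open>f - P\<^sub>N\<close> plus
  the differences \<open>P\<^sub>j\<^sub>+\<^sub>1 - P\<^sub>j\<close>, where \<open>2 ^ N \<le> n < 2 ^ (N + 1)\<close>. For the first part, the substitutions
  \<open>x \<mapsto> x + c \<phi>(x)\<close> have derivative at least \<open>1/2\<close> where the difference does not vanish, and \<open>w\<^sub>n\<close>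
  is almost constant at that scale. For a polynomial of degree below \<open>m\<close>, the difference is bounded
  by a local maximum of the \<open>r\<close>-th derivative, the class condition turns \<open>w\<^sub>n \<phi>\<^sup>r\<^sup>p\<close> into
  \<open>\<rho>\<^sub>m\<^sup>r\<^sup>p w\<^sub>m\<close>, and a Bernstein inequality for doubling weights remains to be shown.

  That inequality is localised: multiply \<open>P\<close> by a high power of a Fejer-type kernel peaked at \<open>x\<close>,
  so that the growth of the doubling weight away from \<open>x\<close> is absorbed. The product has degree \<open>O(m)\<close>;
  the Bernstein-Walsh estimate with Cauchy's inequality bounds the derivative by its
  maximum, and a Nikolskii inequality bounds the maximum by its weighted \<open>L\<^sub>p\<close> integral.
\<close>

subsection \<open>The local scale\<close>

text \<open>For p < 1 the norm has no triangle inequality, but its p-th power is subadditive, so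
  estimates are made for p-th powers and the root is taken at the end. Averaging a function against
  a kernel is of no use in L_p for p < 1, which is why derivatives are controlled pointwise, through
  maxima of analytic functions. The doubling constant is enlarged to a power
  \<open>(3 / 2) ^ A\<close>. Iterated doubling then becomes growth of degree A in the ratio of the
  radii, and A is all that the constants retain of the weight. In the theorem \<open>c\<close> is
  fixed before \<open>\<Lambda>\<close>, and \<open>\<theta>\<close> after it but before
  \<open>\<delta>\<close>, \<open>\<gamma>\<close> and \<open>w\<close>. This works because
  \<open>\<Lambda>\<close> enters only as a factor next to a positive power of the step, so a small
  step cancels it. Differences are integrated through integrable majorants \<open>H\<close>. This is
  enough for upper bounds on Lebesgue integrals and spares a separate proof that the differences of
  an L_p function are measurable.\<close>

lemma phi_nonneg: "x \<in> {-1..1} \<Longrightarrow> 0 \<le> phi x"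
  by (auto simp: phi_def abs_square_le_1 abs_le_iff)

lemma phi_sq: "x \<in> {-1..1} \<Longrightarrow> (phi x)\<^sup>2 = 1 - x\<^sup>2"
  by (auto simp: phi_def abs_square_le_1 abs_le_iff)

lemma phi_le_1: "phi x \<le> 1"
  by (simp add: phi_def)

lemma rho_alt: "rho n x = phi x / real n + 1 / (real n)\<^sup>2"
  by (simp add: rho_def phi_def)

lemma rho_scaled: "1 \<le> n \<Longrightarrow> (real n)\<^sup>2 * rho n x = real n * phi x + 1"
  by (simp add: rho_alt field_simps power2_eq_square)

lemma rho_pos: "\<lbrakk>1 \<le> n; x \<in> {-1..1}\<rbrakk> \<Longrightarrow> 0 < rho n x"
  unfolding rho_alt using phi_nonneg[of x] by (intro add_nonneg_pos) auto

lemma rho_le_2: "1 \<le> n \<Longrightarrow> rho n x \<le> 2"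
proof -
  assume n: "1 \<le> n"
  have "phi x / real n \<le> 1 / 1" "1 / (real n)\<^sup>2 \<le> 1 / 1"
    using n phi_le_1[of x] by (simp_all add: field_simps)
  then show ?thesis by (simp add: rho_alt)
qed

lemma phi_div_le_rho: "1 \<le> n \<Longrightarrow> phi x / real n \<le> rho n x"
  by (simp add: rho_alt)

lemma phi_le_rho: "1 \<le> n \<Longrightarrow> phi x \<le> real n * rho n x"
  using phi_div_le_rho[of n x] by (simp add: field_simps)

lemma continuous_on_phi: "continuous_on S phi"
  unfolding phi_def by (intro continuous_intros)

lemma continuous_on_rho: "1 \<le> n \<Longrightarrow> continuous_on S (rho n)"
  unfolding rho_def by (intro continuous_intros) auto

lemma rho_antimono: "\<lbrakk>1 \<le> m; m \<le> n; x \<in> {-1..1}\<rbrakk> \<Longrightarrow> rho n x \<le> rho m x"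
  unfolding rho_alt
  by (intro add_mono divide_left_mono power_mono mult_pos_pos phi_nonneg) auto

lemma rho_le_4_rho:
  assumes "1 \<le> m" "n \<le> 2 * m" "1 \<le> n" "x \<in> {-1..1}"
  shows "rho m x \<le> 4 * rho n x"
proof -
  have "phi x / m \<le> 4 * (phi x / n)"
  proof -
    have "phi x * n \<le> phi x * (4 * m)"
      using assms phi_nonneg[of x] by (intro mult_left_mono) auto
    then show ?thesis using assms by (simp add: field_simps)
  qed
  moreover have "1 / (real m)\<^sup>2 \<le> 4 * (1 / (real n)\<^sup>2)"
  proof -
    have "(real n)\<^sup>2 \<le> (2 * real m)\<^sup>2" using assms by (intro power_mono) auto
    then show ?thesis using assms by (simp add: field_simps)
  qed
  ultimately show ?thesis by (simp add: rho_alt)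
qed

text \<open>Euclidean distance between the points \<open>(x, phi x)\<close> and
  \<open>(y, phi y)\<close> of the unit semicircle. For x = cos t and y = cos s it is 2 |sin ((t -
  s) / 2)|, so it measures the angle without mentioning arccos.\<close>

definition chord :: "real \<Rightarrow> real \<Rightarrow> real" where
  "chord x y = sqrt ((x - y)\<^sup>2 + (phi x - phi y)\<^sup>2)"

text \<open>The angle in units of 1/n; the added 1 makes its powers increase with the
  exponent.\<close>

definition gap :: "nat \<Rightarrow> real \<Rightarrow> real \<Rightarrow> real" where
  "gap n x y = 1 + real n * chord x y"

lemma chord_nonneg: "0 \<le> chord x y"
  by (simp add: chord_def)

lemma gap_ge_1: "1 \<le> gap n x y"
  by (simp add: gap_def chord_nonneg)

lemma gap_commute: "gap n x y = gap n y x"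
  by (simp add: gap_def chord_def power2_commute)

text \<open>Law of cosines: \<open>x * y + phi x * phi y\<close> is the cosine of the angle between
  the two points.\<close>

lemma chord_sq:
  assumes "x \<in> {-1..1}" "y \<in> {-1..1}"
  shows "(chord x y)\<^sup>2 = 2 * (1 - x * y - phi x * phi y)"
proof -
  have "(chord x y)\<^sup>2 = (x - y)\<^sup>2 + (phi x - phi y)\<^sup>2"
    by (simp add: chord_def)
  also have "\<dots> = x\<^sup>2 + (phi x)\<^sup>2 + (y\<^sup>2 + (phi y)\<^sup>2) - 2 * (x * y) - 2 * (phi x * phi y)"
    by (simp add: power2_eq_square algebra_simps)
  also have "\<dots> = 2 * (1 - x * y - phi x * phi y)"
    using phi_sq[OF assms(1)] phi_sq[OF assms(2)] by (simp add: algebra_simps)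
  finally show ?thesis .
qed

lemma phi_le_chord: "phi x \<le> phi y + chord x y"
proof -
  have "\<bar>phi x - phi y\<bar> \<le> chord x y"
    unfolding chord_def by (metis real_sqrt_sum_squares_ge2 real_sqrt_abs real_sqrt_le_iff power2_abs
        le_add_same_cancel2 zero_le_power2)
  then show ?thesis by linarith
qed

text \<open>\<open>phi\<close> is 1-Lipschitz for \<open>chord\<close>, and n^2 times
  \<open>rho\<close> is n times \<open>phi\<close> plus 1, so passing from y to x costs at most one
  factor \<open>gap\<close>.\<close>

lemma rho_le_gap:
  assumes "1 \<le> n" "y \<in> {-1..1}"
  shows "rho n x \<le> gap n x y * rho n y"
proof -
  have "(real n)\<^sup>2 * rho n x \<le> real n * (phi y + chord x y) + 1"
    using phi_le_chord[of x y] rho_scaled[OF assms(1)] by (simp add: mult_left_mono)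
  also have "\<dots> \<le> (1 + real n * chord x y) * (real n * phi y + 1)"
    using phi_nonneg[OF assms(2)] chord_nonneg[of x y] by (simp add: algebra_simps)
  also have "\<dots> = (real n)\<^sup>2 * (gap n x y * rho n y)"
    by (simp add: gap_def rho_scaled[OF assms(1), symmetric])
  finally show ?thesis using assms(1) by simp
qed

text \<open>\<open>c\<close> and \<open>s\<close> are the cosine and sine of the angle between the
  two points. Rotation splits y - x into a first-order part \<open>phi y * s\<close> and a
  second-order part \<open>y * (1 - c)\<close>. The latter dominates near the end points, where
  \<open>phi y\<close> is small, and forces the square of \<open>gap\<close>.\<close>

lemma dist_le_gap:
  assumes n: "1 \<le> n" and x: "x \<in> {-1..1}" and y: "y \<in> {-1..1}"
  shows "\<bar>x - y\<bar> \<le> (gap n x y)\<^sup>2 / 2 * rho n y"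
proof -
  define e where "e = chord x y"
  define c where "c = x * y + phi x * phi y"
  define s where "s = y * phi x - x * phi y"
  have e0: "0 \<le> e" by (simp add: e_def chord_nonneg)
  have ec: "1 - c = e\<^sup>2 / 2" using chord_sq[OF x y] by (simp add: e_def c_def)
  have ec': "\<bar>1 - c\<bar> = e\<^sup>2 / 2" using ec zero_le_power2[of e] by linarith
  have "c\<^sup>2 + s\<^sup>2 = (x\<^sup>2 + (phi x)\<^sup>2) * (y\<^sup>2 + (phi y)\<^sup>2)"
    by (simp add: c_def s_def power2_eq_square algebra_simps)
  then have "s\<^sup>2 = 1 - c\<^sup>2" using phi_sq[OF x] phi_sq[OF y] by simp
  also have "\<dots> \<le> 2 * (1 - c)"
    using zero_le_power2[of "1 - c"] by (simp add: power2_eq_square algebra_simps)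
  also have "\<dots> = e\<^sup>2" using ec by simp
  finally have s: "\<bar>s\<bar> \<le> e" using e0 by (metis abs_le_square_iff abs_of_nonneg)
  \<comment> \<open>rotating \<open>(y, phi y)\<close> onto \<open>(x, phi x)\<close>\<close>
  have "y * (1 - c) + phi y * s = y - x * (y\<^sup>2 + (phi y)\<^sup>2)"
    by (simp add: c_def s_def power2_eq_square algebra_simps)
  then have "\<bar>x - y\<bar> = \<bar>y * (1 - c) + phi y * s\<bar>" using phi_sq[OF y] by simp
  also have "\<dots> \<le> \<bar>y\<bar> * \<bar>1 - c\<bar> + \<bar>phi y\<bar> * \<bar>s\<bar>"
    by (metis abs_mult abs_triangle_ineq)
  also have "\<dots> \<le> 1 * (e\<^sup>2 / 2) + phi y * e"
    unfolding ec' using y s phi_nonneg[OF y] by (intro add_mono mult_mono) auto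
  finally have "(real n)\<^sup>2 * \<bar>x - y\<bar> \<le> (real n)\<^sup>2 * (e\<^sup>2 / 2 + phi y * e)"
    by (intro mult_left_mono) auto
  also have "\<dots> \<le> (real n * phi y + 1) * ((1 + real n * e)\<^sup>2 / 2)"
  proof -
    have "0 \<le> real n * phi y" "0 \<le> real n * e" using phi_nonneg[OF y] e0 by auto
    \<comment> \<open>Twice the difference of the two sides.\<close>
    then have "0 \<le> 1 + 2 * (real n * e) + real n * phi y * (1 + (real n * e)\<^sup>2)" by auto
    then show ?thesis by (simp add: power2_eq_square algebra_simps)
  qed
  also have "\<dots> = (real n)\<^sup>2 * ((gap n x y)\<^sup>2 / 2 * rho n y)"
    by (simp add: gap_def e_def rho_scaled[OF n, symmetric])
  finally show ?thesis using n by simp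
qed

text \<open>\<open>phi\<close> is not Lipschitz near the end points, but its square is; the local
  comparisons of \<open>rho\<close> therefore go through squares.\<close>

lemma phi_sq_le:
  assumes x: "x \<in> {-1..1}" and y: "y \<in> {-1..1}"
  shows "(phi x)\<^sup>2 \<le> (phi y)\<^sup>2 + 2 * \<bar>x - y\<bar>"
proof -
  have "(phi x)\<^sup>2 - (phi y)\<^sup>2 = (y - x) * (x + y)"
    using phi_sq[OF x] phi_sq[OF y] by (simp add: power2_eq_square algebra_simps)
  also have "\<dots> \<le> \<bar>y - x\<bar> * \<bar>x + y\<bar>" by (metis abs_ge_self abs_mult)
  also have "\<dots> \<le> \<bar>x - y\<bar> * 2" using x y by (intro mult_mono) auto
  finally show ?thesis by simp
qed

text \<open>The square of phi y plus \<open>rho n y\<close> is at most the square of phi y + 1/n, so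
  \<open>phi\<close> grows by at most 1/n on this neighbourhood.\<close>

lemma rho_near:
  assumes n: "1 \<le> n" and x: "x \<in> {-1..1}" and y: "y \<in> {-1..1}"
    and d: "\<bar>x - y\<bar> \<le> rho n y / 2"
  shows "rho n x \<le> 2 * rho n y"
proof -
  have "(phi x)\<^sup>2 \<le> (phi y)\<^sup>2 + 2 * \<bar>x - y\<bar>" by (rule phi_sq_le[OF x y])
  also have "\<dots> \<le> (phi y)\<^sup>2 + rho n y" using d by simp
  also have "\<dots> \<le> (phi y + 1 / n)\<^sup>2"
    using phi_nonneg[OF y] n by (simp add: rho_alt power2_eq_square field_simps)
  finally have "phi x \<le> phi y + 1 / n"
    by (rule power2_le_imp_le) (use phi_nonneg[OF y] in auto)
  then have "phi x / n \<le> (phi y + 1 / n) / n" using n by (intro divide_right_mono) auto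
  then have "rho n x \<le> (phi y + 1 / n) / n + 1 / (real n)\<^sup>2" by (simp add: rho_alt)
  also have "\<dots> \<le> 2 * rho n y"
    using divide_nonneg_nonneg[OF phi_nonneg[OF y], of "real n"] n
    by (simp add: rho_alt add_divide_distrib power2_eq_square)
  finally show ?thesis .
qed

text \<open>The radius is now measured at x, so the bound on the square of phi x contains phi x
  again; the mixed term phi x / n is split by 2ab <= a^2 + b^2 and partly absorbed on the
  left.\<close>

lemma rho_near':
  assumes n: "1 \<le> n" and x: "x \<in> {-1..1}" and y: "y \<in> {-1..1}"
    and d: "\<bar>x - y\<bar> \<le> rho n x / 8"
  shows "rho n x \<le> 4 * rho n y"
proof (cases "rho n x \<le> 4 * rho n y")
  case False
  have "(phi x)\<^sup>2 \<le> (phi y)\<^sup>2 + 2 * \<bar>x - y\<bar>" by (rule phi_sq_le[OF x y])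
  also have "\<dots> \<le> (phi y)\<^sup>2 + (phi x / n + 1 / (real n)\<^sup>2) / 4" using d by (simp add: rho_alt)
  finally have 1: "(phi x)\<^sup>2 \<le> (phi y)\<^sup>2 + (phi x * (1 / n) + (1 / n)\<^sup>2) / 4"
    by (simp add: power_one_over)
  have "2 * (phi x * (1 / n)) \<le> (phi x)\<^sup>2 + (1 / n)\<^sup>2"
    using sum_squares_bound[of "phi x" "1 / real n"] by (simp add: mult.assoc)
  with 1 have "(phi x)\<^sup>2 \<le> 2 * (phi y)\<^sup>2 + (1 / n)\<^sup>2"
    using zero_le_power2[of "phi x"] zero_le_power2[of "phi y"] zero_le_power2[of "1 / real n"] by argo
  also have "\<dots> \<le> (2 * (phi y + 1 / n))\<^sup>2"
    using phi_nonneg[OF y] n by (simp add: power2_eq_square field_simps)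
  finally have "phi x \<le> 2 * (phi y + 1 / n)"
    by (rule power2_le_imp_le) (use phi_nonneg[OF y] in auto)
  then have "phi x / n \<le> 2 * (phi y + 1 / n) / n" using n by (intro divide_right_mono) auto
  then have "rho n x \<le> 2 * (phi y + 1 / n) / n + 1 / (real n)\<^sup>2" by (simp add: rho_alt)
  also have "\<dots> \<le> 4 * rho n y"
  proof -
    have *: "2 * (phi y + 1 / n) / n = 2 * (phi y / n) + 2 * (1 / (real n)\<^sup>2)"
      by (simp add: add_divide_distrib power2_eq_square)
    have "0 \<le> phi y / n" "0 \<le> 1 / (real n)\<^sup>2" using phi_nonneg[OF y] by auto
    then show ?thesis unfolding rho_alt by (subst *) argo
  qed
  finally show ?thesis .
qed (use assms in simp)

subsection \<open>Doubling weights and their averages\<close>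

definition mass :: "(real \<Rightarrow> real) \<Rightarrow> real \<Rightarrow> real \<Rightarrow> real" where
  "mass w x R = (LINT u:{x - R..x + R}|lebesgue. w u)"

lemma avg_weight_mass: "avg_weight w n x = mass w x (rho n x) / rho n x"
  by (simp add: avg_weight_def mass_def)

lemma doubling_weight_integrable:
  assumes "doubling_weight L w"
  shows "integrable lebesgue w"
proof -
  have "integrable lebesgue (\<lambda>x. indicator {-1..1} x *\<^sub>R w x)"
    using assms by (simp add: doubling_weight_def set_integrable_def)
  moreover have "(\<lambda>x. indicator {-1..1} x *\<^sub>R w x) = w"
    using assms by (auto simp: doubling_weight_def fun_eq_iff indicator_def)
  ultimately show ?thesis by simp
qed

lemma doubling_weight_set_integrable:
  assumes "doubling_weight L w" "S \<in> sets lebesgue"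
  shows "set_integrable lebesgue S w"
  using integrable_mult_indicator[OF assms(2) doubling_weight_integrable[OF assms(1)]]
  by (simp add: set_integrable_def)

lemma doubling_weight_nonneg: "doubling_weight L w \<Longrightarrow> 0 \<le> w x"
  by (simp add: doubling_weight_def)

lemma doubling_weight_outside: "doubling_weight L w \<Longrightarrow> x \<notin> {-1..1} \<Longrightarrow> w x = 0"
  by (simp add: doubling_weight_def)

text \<open>Since \<open>w\<close> vanishes outside [-1, 1], only the part of \<open>S\<close>
  inside counts; intervals that leave [-1, 1] are handled through this.\<close>

lemma doubling_set_integral_mono:
  assumes w: "doubling_weight L w" and S: "S \<in> sets lebesgue" and T: "T \<in> sets lebesgue"
    and sub: "S \<inter> {-1..1} \<subseteq> T"
  shows "(LINT u:S|lebesgue. w u) \<le> (LINT u:T|lebesgue. w u)"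
  unfolding set_lebesgue_integral_def
proof (rule integral_mono)
  show "integrable lebesgue (\<lambda>x. indicator S x *\<^sub>R w x)"
    "integrable lebesgue (\<lambda>x. indicator T x *\<^sub>R w x)"
    using doubling_weight_set_integrable[OF w] S T by (auto simp: set_integrable_def)
next
  fix x :: real
  show "indicator S x *\<^sub>R w x \<le> indicator T x *\<^sub>R w x"
    using sub doubling_weight_nonneg[OF w, of x] doubling_weight_outside[OF w, of x]
    by (cases "x \<in> {-1..1}") (auto simp: indicator_def)
qed

lemma set_integral_doubling_nonneg:
  assumes "doubling_weight L w"
  shows "0 \<le> (LINT u:S|lebesgue. w u)"
  unfolding set_lebesgue_integral_def
  using doubling_weight_nonneg[OF assms] by (intro Bochner_Integration.integral_nonneg) auto

lemma doubling_weight_mono: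
  assumes "doubling_weight L w" "L \<le> L'"
  shows "doubling_weight L' w"
proof -
  have "(LINT u:{a - (b - a) / 2..b + (b - a) / 2}|lebesgue. w u) \<le> L' * (LINT u:{a..b}|lebesgue. w u)"
    if "-1 \<le> a \<and> a < b \<and> b \<le> 1" for a b
  proof -
    have "(LINT u:{a - (b - a) / 2..b + (b - a) / 2}|lebesgue. w u) \<le> L * (LINT u:{a..b}|lebesgue. w u)"
      using assms(1) that by (simp add: doubling_weight_def)
    also have "\<dots> \<le> L' * (LINT u:{a..b}|lebesgue. w u)"
      by (intro mult_right_mono assms(2) set_integral_doubling_nonneg[OF assms(1)])
    finally show ?thesis .
  qed
  then show ?thesis using assms(1) unfolding doubling_weight_def by blast
qed

lemma mass_nonneg: "doubling_weight L w \<Longrightarrow> 0 \<le> mass w x R"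
  unfolding mass_def by (rule set_integral_doubling_nonneg)

lemma mass_mono:
  assumes w: "doubling_weight L w" and "\<bar>x - y\<bar> + R \<le> R'"
  shows "mass w x R \<le> mass w y R'"
  unfolding mass_def
  by (rule doubling_set_integral_mono[OF w]) (use assms(2) in auto)

lemma avg_weight_nonneg:
  assumes "doubling_weight L w" "1 \<le> n" "x \<in> {-1..1}"
  shows "0 \<le> avg_weight w n x"
  using mass_nonneg[OF assms(1)] rho_pos[OF assms(2,3)] by (simp add: avg_weight_mass)

text \<open>Doubling is available only for intervals inside [-1, 1], so the interval about y is
  first cut to \<open>{a..b}\<close>. If one end is cut, the length is still at least R, and
  doubling moves the free end by at least R / 2; this is the origin of 3/2. If both are cut,
  \<open>{a..b}\<close> is [-1, 1] itself.\<close>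

lemma mass_doubling:
  assumes w: "doubling_weight L w" and y: "y \<in> {-1..1}" and R: "0 < R"
  shows "mass w y (3 / 2 * R) \<le> L * mass w y R"
proof -
  define a where "a = max (-1) (y - R)"
  define b where "b = min 1 (y + R)"
  have ab: "-1 \<le> a" "a < b" "b \<le> 1" using y R by (auto simp: a_def b_def)
  have "mass w y (3 / 2 * R) \<le> (LINT u:{a - (b - a) / 2..b + (b - a) / 2}|lebesgue. w u)"
    unfolding mass_def
  proof (rule doubling_set_integral_mono[OF w])
    have "max (-1) (y - 3 / 2 * R) \<ge> a - (b - a) / 2"
      using y R by (auto simp: a_def b_def max_def min_def field_simps)
    moreover have "min 1 (y + 3 / 2 * R) \<le> b + (b - a) / 2"
      using y R by (auto simp: a_def b_def max_def min_def field_simps)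
    ultimately show "{y - 3 / 2 * R..y + 3 / 2 * R} \<inter> {- 1..1} \<subseteq> {a - (b - a) / 2..b + (b - a) / 2}"
      by auto
  qed auto
  also have "\<dots> \<le> L * (LINT u:{a..b}|lebesgue. w u)"
    using w ab by (simp add: doubling_weight_def)
  also have "(LINT u:{a..b}|lebesgue. w u) = mass w y R"
    unfolding mass_def
    by (intro antisym doubling_set_integral_mono[OF w]) (auto simp: a_def b_def)
  finally show ?thesis .
qed

text \<open>Enlarging the radius k times by 3/2 costs the k-th power of \<open>(3 / 2) ^ A\<close>,
  which is the A-th power of the factor gained by the radius. The least sufficient \<open>k\<close>
  overshoots the ratio \<open>s\<close> by at most 3/2.\<close>

lemma mass_growth:
  assumes w: "doubling_weight ((3 / 2) ^ A) w" and y: "y \<in> {-1..1}" and R: "0 < R"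
    and s: "1 \<le> s" "\<bar>x - y\<bar> + R' \<le> s * R"
  shows "mass w x R' \<le> (3 / 2 * s) ^ A * mass w y R"
proof -
  have iter: "mass w y ((3 / 2) ^ k * R) \<le> ((3 / 2) ^ k) ^ A * mass w y R" for k
  proof (induction k)
    case (Suc k)
    have "mass w y ((3 / 2) ^ Suc k * R) \<le> (3 / 2) ^ A * mass w y ((3 / 2) ^ k * R)"
      using mass_doubling[OF w y, of "(3 / 2) ^ k * R"] R by (simp add: mult.assoc)
    also have "\<dots> \<le> (3 / 2) ^ A * (((3 / 2) ^ k) ^ A * mass w y R)"
      by (intro mult_left_mono Suc) auto
    finally show ?case by (simp only: power_Suc power_mult_distrib mult.assoc)
  qed simp
  obtain k where k: "s \<le> (3 / 2) ^ k" "(3 / 2) ^ k \<le> 3 / 2 * s"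
  proof -
    define k where "k = (LEAST k. s \<le> (3 / 2) ^ k)"
    obtain j where "s < (3 / 2) ^ j" using real_arch_pow[of "3 / 2" s] by auto
    then have 1: "s \<le> (3 / 2) ^ k" unfolding k_def by (intro LeastI) (rule less_imp_le)
    have "(3 / 2) ^ k \<le> 3 / 2 * s"
    proof (cases k)
      case 0
      then show ?thesis using s(1) by simp
    next
      case (Suc i)
      then have "\<not> s \<le> (3 / 2) ^ i"
        unfolding k_def by (metis lessI not_less_Least)
      with Suc show ?thesis by simp
    qed
    with 1 show ?thesis by (rule that)
  qed
  have "s * R \<le> (3 / 2) ^ k * R" using k(1) R by (intro mult_right_mono) auto
  with s have "mass w x R' \<le> mass w y ((3 / 2) ^ k * R)"
    by (intro mass_mono[OF w]) auto
  also have "\<dots> \<le> ((3 / 2) ^ k) ^ A * mass w y R" by (rule iter)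
  also have "\<dots> \<le> (3 / 2 * s) ^ A * mass w y R"
    using k(2) by (intro mult_right_mono power_mono mass_nonneg[OF w]) auto
  finally show ?thesis .
qed

text \<open>The interval about x lies in the one about y enlarged by 3/2 times the square of
  \<open>gap\<close>: one half comes from the distance, the rest from the radius. The A-th power of
  this is the price for the mass, and the normalisation by \<open>rho\<close> costs one more
  \<open>gap\<close>.\<close>

lemma avg_weight_growth:
  assumes w: "doubling_weight ((3 / 2) ^ A) w" and n: "1 \<le> n"
    and x: "x \<in> {-1..1}" and y: "y \<in> {-1..1}"
  shows "avg_weight w n x \<le> (9 / 4) ^ A * gap n x y ^ (2 * A + 1) * avg_weight w n y"
proof -
  let ?E = "gap n x y"
  have E: "1 \<le> ?E" by (rule gap_ge_1)
  have rx: "0 < rho n x" and ry: "0 < rho n y" using rho_pos n x y by auto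
  have "?E \<le> ?E\<^sup>2" using E by (simp add: power2_eq_square)
  then have "rho n x \<le> ?E\<^sup>2 * rho n y"
    using rho_le_gap[OF n y, of x] ry by (meson mult_right_mono order_trans less_imp_le)
  then have "\<bar>x - y\<bar> + rho n x \<le> (3 / 2 * ?E\<^sup>2) * rho n y"
    using dist_le_gap[OF n x y] by simp
  moreover have "1 \<le> 3 / 2 * ?E\<^sup>2" using one_le_power[OF E, of 2] by simp
  ultimately have "mass w x (rho n x) \<le> (3 / 2 * (3 / 2 * ?E\<^sup>2)) ^ A * mass w y (rho n y)"
    by (intro mass_growth[OF w y ry])
  also have "3 / 2 * (3 / 2 * ?E\<^sup>2) = (9 / 4) * ?E\<^sup>2" by simp
  finally have 1: "mass w x (rho n x) \<le> (9 / 4) ^ A * ?E ^ (2 * A) * mass w y (rho n y)"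
    by (simp only: power_mult_distrib power_mult)
  have "rho n y \<le> ?E * rho n x" using rho_le_gap[OF n x, of y] by (simp add: gap_commute)
  then have 2: "1 / rho n x \<le> ?E / rho n y" using rx ry by (simp add: field_simps)
  have "avg_weight w n x = mass w x (rho n x) * (1 / rho n x)" by (simp add: avg_weight_mass)
  also have "\<dots> \<le> ((9 / 4) ^ A * ?E ^ (2 * A) * mass w y (rho n y)) * (?E / rho n y)"
    using rx ry E mass_nonneg[OF w] by (intro mult_mono 1 2) auto
  finally show ?thesis by (simp add: avg_weight_mass mult_ac)
qed

text \<open>At this distance the growth is bounded by a constant: the interval about x lies in six
  times the one about y, and 6 * 3/2 = 9. The factor 2 is the ratio of the radii.\<close>

lemma avg_weight_near:
  assumes w: "doubling_weight ((3 / 2) ^ A) w" and n: "1 \<le> n"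
    and x: "x \<in> {-1..1}" and y: "y \<in> {-1..1}" and d: "\<bar>x - y\<bar> \<le> rho n x / 8"
  shows "avg_weight w n x \<le> 2 * 9 ^ A * avg_weight w n y"
proof -
  have rx: "0 < rho n x" and ry: "0 < rho n y" using rho_pos n x y by auto
  have xy: "rho n x \<le> 4 * rho n y" by (rule rho_near'[OF n x y d])
  have yx: "rho n y \<le> 2 * rho n x" using rho_near[OF n y x] d rx by (simp add: abs_minus_commute)
  have "\<bar>x - y\<bar> + rho n x \<le> 6 * rho n y" using d xy ry by linarith
  then have "mass w x (rho n x) \<le> 9 ^ A * mass w y (rho n y)"
    using mass_growth[OF w y ry, of 6 x "rho n x"] by simp
  moreover have "1 / rho n x \<le> 2 / rho n y" using rx ry yx by (simp add: field_simps)
  ultimately have "mass w x (rho n x) * (1 / rho n x) \<le> (9 ^ A * mass w y (rho n y)) * (2 / rho n y)"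
    using rx ry mass_nonneg[OF w] by (intro mult_mono) auto
  then show ?thesis by (simp add: avg_weight_mass mult_ac)
qed

text \<open>The mass can only shrink when n grows, and \<open>rho\<close> drops by at most a factor
  4 up to n = 2m.\<close>

lemma avg_weight_scale:
  assumes w: "doubling_weight L w" and "1 \<le> m" "m \<le> n" "n \<le> 2 * m" and x: "x \<in> {-1..1}"
  shows "avg_weight w n x \<le> 4 * avg_weight w m x"
proof -
  have rn: "0 < rho n x" and rm: "0 < rho m x" using rho_pos assms by auto
  have "mass w x (rho n x) \<le> mass w x (rho m x)"
    using rho_antimono[of m n x] assms by (intro mass_mono[OF w]) auto
  moreover have "1 / rho n x \<le> 4 / rho m x"
    using rho_le_4_rho[of m n x] assms rn rm by (simp add: field_simps)
  ultimately have "mass w x (rho n x) * (1 / rho n x) \<le> mass w x (rho m x) * (4 / rho m x)"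
    using rn mass_nonneg[OF w] by (intro mult_mono) auto
  then show ?thesis by (simp add: avg_weight_mass mult_ac)
qed

lemma continuous_on_avg_weight:
  assumes w: "doubling_weight L w" and n: "1 \<le> n"
  shows "continuous_on {-1..1} (avg_weight w n)"
proof -
  \<comment> \<open>The primitive starts at -3 because \<open>rho\<close> is at most 2, so averaging
    intervals about points of [-1, 1] stay in [-3, 3].\<close>
  define F where "F = (\<lambda>t. integral {-3..t} w)"
  have int: "w integrable_on {a..b}" for a b
    by (rule set_lebesgue_integral_eq_integral(1)[OF doubling_weight_set_integrable[OF w]]) auto
  have cF: "continuous_on {-3..3} F"
    unfolding F_def by (rule indefinite_integral_continuous_1[OF int])
  have mem: "x - rho n x \<in> {-3..3}" "x + rho n x \<in> {-3..3}" if "x \<in> {-1..1}" for x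
    using rho_le_2[OF n, of x] rho_pos[OF n that] that by auto
  have "mass w x (rho n x) = F (x + rho n x) - F (x - rho n x)" if x: "x \<in> {-1..1}" for x
  proof -
    have "mass w x (rho n x) = integral {x - rho n x..x + rho n x} w"
      unfolding mass_def
      by (rule set_lebesgue_integral_eq_integral(2)[OF doubling_weight_set_integrable[OF w]]) auto
    moreover have "integral {-3..x - rho n x} w + integral {x - rho n x..x + rho n x} w = F (x + rho n x)"
      unfolding F_def using mem[OF x] rho_pos[OF n x] int
      by (intro Henstock_Kurzweil_Integration.integral_combine) auto
    ultimately show ?thesis by (simp add: F_def)
  qed
  then have eq: "(F (x + rho n x) - F (x - rho n x)) / rho n x = avg_weight w n x"
    if "x \<in> {-1..1}" for x using that by (simp add: avg_weight_mass)
  have "continuous_on {-1..1} (\<lambda>x. (F (x + rho n x) - F (x - rho n x)) / rho n x)"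
    using rho_pos[OF n] mem
    by (intro continuous_intros continuous_on_compose2[OF cF] continuous_on_rho[OF n]) fastforce+
  then show ?thesis using eq by (rule continuous_on_eq)
qed

subsection \<open>A Fejer-type kernel in the algebraic variable\<close>

fun chebyshev :: "nat \<Rightarrow> real poly" where
  "chebyshev 0 = 1"
| "chebyshev (Suc 0) = [:0, 1:]"
| "chebyshev (Suc (Suc n)) = [:0, 2:] * chebyshev (Suc n) - chebyshev n"

lemma poly_chebyshev_cos: "poly (chebyshev n) (cos t) = cos (real n * t)"
proof (induction n rule: chebyshev.induct)
  case (3 n)
  have "cos (real (Suc (Suc n)) * t) + cos (real n * t) = 2 * cos t * cos (real (Suc n) * t)"
    using cos_add[of "real (Suc n) * t" t] cos_diff[of "real (Suc n) * t" t]
    by (simp add: algebra_simps)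
  then show ?case using 3 by (simp add: mult.assoc algebra_simps)
qed auto

lemma degree_chebyshev: "degree (chebyshev n) \<le> n"
proof (induction n rule: chebyshev.induct)
  case (3 n)
  have "degree ([:0, 2:] * chebyshev (Suc n)) \<le> 1 + Suc n"
    by (rule order_trans[OF degree_mult_le]) (use 3 in simp)
  then show ?case using 3 by (auto intro!: degree_diff_le)
qed auto

text \<open>The Fejer kernel normalised to the value 1 at 0. The double cosine sum, rather than a
  quotient of sines, is what turns into Chebyshev polynomials in \<open>bump\<close>.\<close>

definition fejer :: "nat \<Rightarrow> real \<Rightarrow> real" where
  "fejer m t = (\<Sum>j<m. \<Sum>k<m. cos ((real j - real k) * t)) / (real m)\<^sup>2"

text \<open>The double sum is the squared modulus of a geometric sum; positivity, the bound 1 and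
  the decay are read off from this form.\<close>

lemma fejer_alt: "fejer m t = (cmod (\<Sum>j<m. cis (real j * t)) / real m)\<^sup>2"
proof -
  have "complex_of_real ((cmod (\<Sum>j<m. cis (real j * t)))\<^sup>2)
      = (\<Sum>j<m. cis (real j * t)) * cnj (\<Sum>j<m. cis (real j * t))"
    by (rule complex_norm_square)
  also have "\<dots> = (\<Sum>j<m. \<Sum>k<m. cis ((real j - real k) * t))"
    by (simp add: sum_product cis_cnj cis_mult algebra_simps)
  finally have "Re (complex_of_real ((cmod (\<Sum>j<m. cis (real j * t)))\<^sup>2))
      = Re (\<Sum>j<m. \<Sum>k<m. cis ((real j - real k) * t))" by simp
  then show ?thesis by (simp add: fejer_def power_divide)
qed

lemma fejer_nonneg: "0 \<le> fejer m t"
  by (simp add: fejer_alt)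

lemma fejer_le_1: "fejer m t \<le> 1"
proof -
  have "cmod (\<Sum>j<m. cis (real j * t)) \<le> (\<Sum>j<m. 1)"
    by (rule order_trans[OF norm_sum]) simp
  then have "cmod (\<Sum>j<m. cis (real j * t)) / real m \<le> 1" by (simp add: divide_le_eq)
  then show ?thesis unfolding fejer_alt by (intro power_le_one) auto
qed

lemma fejer_0: "1 \<le> m \<Longrightarrow> fejer m 0 = 1"
  by (simp add: fejer_def power2_eq_square)

text \<open>Multiplication by \<open>cis t - 1\<close> telescopes the geometric sum to a difference
  of two unit vectors. The product form avoids a division at t = 0.\<close>

lemma fejer_decay: "fejer m t * (1 - cos t) \<le> 2 / (real m)\<^sup>2"
proof -
  let ?S = "\<Sum>j<m. cis (real j * t)"
  have "?S * (cis t - 1) = cis (real m * t) - 1"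
  proof (induction m)
    case (Suc m)
    then show ?case by (simp add: algebra_simps cis_mult)
  qed simp
  then have "cmod ?S * cmod (cis t - 1) \<le> 1 + 1"
    by (metis norm_mult norm_triangle_ineq4 norm_cis norm_one)
  then have "(cmod ?S * cmod (cis t - 1))\<^sup>2 \<le> 2\<^sup>2"
    by (intro power_mono) auto
  moreover have "(cmod (cis t - 1))\<^sup>2 = 2 * (1 - cos t)"
    unfolding cmod_power2 using sin_cos_squared_add[of t]
    by (simp add: power2_eq_square algebra_simps)
  ultimately have "(cmod ?S)\<^sup>2 * (1 - cos t) \<le> 2"
    by (simp add: power_mult_distrib algebra_simps)
  then have "(cmod ?S)\<^sup>2 * (1 - cos t) / (real m)\<^sup>2 \<le> 2 / (real m)\<^sup>2"
    by (intro divide_right_mono) auto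
  then show ?thesis by (simp add: fejer_alt power_divide)
qed

text \<open>With \<open>x = cos t\<close> and \<open>y = cos s\<close>, this is the mean of the Fejer kernel at \<open>s - t\<close> and \<open>s + t\<close>.\<close>
definition bump :: "nat \<Rightarrow> real \<Rightarrow> real poly" where
  "bump m x = smult (1 / (real m)\<^sup>2) (\<Sum>j<m. \<Sum>k<m.
     smult (poly (chebyshev (max j k - min j k)) x) (chebyshev (max j k - min j k)))"

lemma bump_cos: "poly (bump m (cos t)) (cos s) = (fejer m (s - t) + fejer m (s + t)) / 2"
proof -
  have *: "cos ((real j - real k) * (s - t)) + cos ((real j - real k) * (s + t))
      = 2 * (cos (real (max j k - min j k) * t) * cos (real (max j k - min j k) * s))" for j k
  proof -
    \<comment> \<open>\<open>max j k - min j k\<close> is |j - k| as a natural number, the index of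
      a Chebyshev polynomial; evenness of the cosine removes the sign.\<close>
    have "cos ((real j - real k) * u) = cos (real (max j k - min j k) * u)" for u
    proof (cases "j \<le> k")
      case True
      then have "(real j - real k) * u = - (real (max j k - min j k) * u)"
        by (simp add: max_def min_def of_nat_diff algebra_simps)
      then show ?thesis by (simp only: cos_minus)
    qed (simp add: max_def min_def of_nat_diff)
    then show ?thesis
      by (simp add: right_diff_distrib distrib_left cos_add cos_diff)
  qed
  have "fejer m (s - t) + fejer m (s + t)
    = (\<Sum>j<m. \<Sum>k<m. cos ((real j - real k) * (s - t)) + cos ((real j - real k) * (s + t))) / (real m)\<^sup>2"
    by (simp add: fejer_def sum.distrib add_divide_distrib)
  also have "\<dots> = 2 * poly (bump m (cos t)) (cos s)"
    by (simp add: * bump_def poly_sum poly_chebyshev_cos sum_distrib_left sum_divide_distrib)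
  finally show ?thesis by simp
qed

lemma degree_bump: "1 \<le> m \<Longrightarrow> degree (bump m x) \<le> m - 1"
  unfolding bump_def
  by (intro order_trans[OF degree_smult_le] degree_sum_le order_trans[OF degree_chebyshev]) auto

lemma bump_bounds:
  assumes "x \<in> {-1..1}" "y \<in> {-1..1}"
  shows "0 \<le> poly (bump m x) y" "poly (bump m x) y \<le> 1"
proof -
  obtain s t where "x = cos t" "y = cos s" using assms by (metis atLeastAtMost_iff cos_arccos)
  then show "0 \<le> poly (bump m x) y" "poly (bump m x) y \<le> 1"
    using fejer_nonneg[of m "s - t"] fejer_nonneg[of m "s + t"] fejer_le_1[of m "s - t"] fejer_le_1[of m "s + t"]
    by (simp_all add: bump_cos)
qed

text \<open>Only the Fejer kernel at s - t is sure to peak at s = t; the one at s + t is merely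
  nonnegative, hence 1/2 instead of 1.\<close>

lemma bump_self:
  assumes "x \<in> {-1..1}" "1 \<le> m"
  shows "1 / 2 \<le> poly (bump m x) x"
proof -
  obtain t where "x = cos t" using assms by (metis atLeastAtMost_iff cos_arccos)
  then show ?thesis
    using fejer_nonneg[of m "t + t"] fejer_0[OF assms(2)] by (simp add: bump_cos)
qed

text \<open>For nearby points \<open>gap\<close> is at most 2 and the bound 1 suffices. For distant
  ones the kernel at s + t decays at least as well as the one at s - t, since s and t lie in [0, pi]
  and so cos (s + t) <= cos (s - t); there \<open>gap\<close> is at most 2 m
  \<open>chord\<close>.\<close>

lemma bump_decay:
  assumes x: "x \<in> {-1..1}" and y: "y \<in> {-1..1}" and m: "1 \<le> m"
  shows "poly (bump m x) y \<le> 16 / (gap m x y)\<^sup>2"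
proof (cases "real m * chord x y \<le> 1")
  case True
  then have "(gap m x y)\<^sup>2 \<le> 2\<^sup>2" using gap_ge_1[of m x y] by (intro power_mono) (auto simp: gap_def)
  then have "1 \<le> 16 / (gap m x y)\<^sup>2" using gap_ge_1[of m x y] by (simp add: le_divide_eq)
  then show ?thesis using bump_bounds(2)[OF x y, of m] by linarith
next
  case False
  define t where "t = arccos x"
  define s where "s = arccos y"
  have t: "0 \<le> t" "t \<le> pi" "x = cos t" and s: "0 \<le> s" "s \<le> pi" "y = cos s"
    using x y by (auto simp: t_def s_def arccos_lbound arccos_ubound)
  have phi: "phi x = sin t" "phi y = sin s"
    using s t sin_ge_zero[of s] sin_ge_zero[of t] by (auto simp: phi_def sin_squared_eq[symmetric])
  have d: "1 - cos (s - t) = (chord x y)\<^sup>2 / 2"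
    unfolding chord_sq[OF x y] phi using s t by (simp add: cos_diff mult.commute)
  have "cos (s + t) \<le> cos (s - t)"
    using sin_ge_zero[of s] sin_ge_zero[of t] s t by (simp add: cos_add cos_diff)
  then have "fejer m (s + t) * (1 - cos (s - t)) \<le> fejer m (s + t) * (1 - cos (s + t))"
    by (intro mult_left_mono fejer_nonneg) auto
  with fejer_decay[of m "s + t"] fejer_decay[of m "s - t"]
  have "poly (bump m x) y * (1 - cos (s - t)) \<le> 2 / (real m)\<^sup>2"
    unfolding s t bump_cos by (simp add: algebra_simps)
  then have "poly (bump m x) y * (real m * chord x y)\<^sup>2 \<le> 4"
    using m by (simp add: d field_simps)
  moreover have "(gap m x y)\<^sup>2 \<le> (2 * (real m * chord x y))\<^sup>2"
    using False gap_ge_1[of m x y] by (intro power_mono) (auto simp: gap_def)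
  then have "poly (bump m x) y * (gap m x y)\<^sup>2 \<le> poly (bump m x) y * (4 * (real m * chord x y)\<^sup>2)"
    by (intro mult_left_mono bump_bounds(1)[OF x y]) (simp add: power_mult_distrib)
  ultimately have "poly (bump m x) y * (gap m x y)\<^sup>2 \<le> 16" by linarith
  then show ?thesis using gap_ge_1[of m x y] by (simp add: le_divide_eq)
qed

text \<open>Joint continuity in centre and variable, for exchanging the order of
  integration.\<close>

lemma continuous_on_bump:
  "continuous_on S (\<lambda>z. poly (bump m (fst z)) (snd z))"
  unfolding bump_def poly_smult poly_sum
  by (intro continuous_intros)

subsection \<open>Bernstein-Walsh and Nikolskii inequalities\<close>

definition cpoly :: "real poly \<Rightarrow> complex \<Rightarrow> complex" where
  "cpoly P z = poly (map_poly of_real P) z"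

lemma cpoly_0 [simp]: "cpoly 0 z = 0"
  by (simp add: cpoly_def)

lemma cpoly_pCons [simp]: "cpoly (pCons a P) z = of_real a + z * cpoly P z"
  by (simp add: cpoly_def map_poly_pCons)

lemma cpoly_1 [simp]: "cpoly 1 z = 1"
  by (simp add: one_pCons)

lemma cpoly_of_real: "cpoly P (of_real x) = of_real (poly P x)"
  by (induction P) auto

lemma cpoly_smult: "cpoly (smult c P) z = of_real c * cpoly P z"
  by (induction P) (auto simp: algebra_simps)

lemma cpoly_add: "cpoly (P + Q) z = cpoly P z + cpoly Q z"
  by (induction P Q rule: poly_induct2) (auto simp: algebra_simps)

lemma cpoly_mult: "cpoly (P * Q) z = cpoly P z * cpoly Q z"
  by (induction P) (auto simp: cpoly_smult cpoly_add algebra_simps)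

lemma cpoly_power: "cpoly (P ^ n) z = cpoly P z ^ n"
  by (induction n) (auto simp: cpoly_mult)

lemma cpoly_altdef: "cpoly P z = (\<Sum>i\<le>degree P. of_real (coeff P i) * z ^ i)"
  by (simp add: cpoly_def poly_altdef degree_map_poly coeff_map_poly)

lemma has_field_derivative_cpoly: "(cpoly P has_field_derivative cpoly (pderiv P) z) (at z)"
proof (induction P)
  case (pCons a P)
  have "((\<lambda>z. of_real a + z * cpoly P z) has_field_derivative (cpoly P z + z * cpoly (pderiv P) z)) (at z)"
    by (rule derivative_eq_intros pCons refl | simp)+
  moreover have "cpoly (pCons a P) = (\<lambda>z. of_real a + z * cpoly P z)" by (rule ext) simp
  ultimately show ?case by (simp add: pderiv_pCons cpoly_add)
qed (simp add: cpoly_def)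

lemma higher_deriv_cpoly: "(deriv ^^ n) (cpoly P) = cpoly ((pderiv ^^ n) P)"
proof (induction n)
  case (Suc n)
  then show ?case using DERIV_imp_deriv[OF has_field_derivative_cpoly] by auto
qed simp

lemma holomorphic_on_cpoly: "cpoly P holomorphic_on S"
  unfolding holomorphic_on_def field_differentiable_def
  using has_field_derivative_at_within[OF has_field_derivative_cpoly] by blast

lemma cpoly_higher_deriv_bound:
  assumes "0 < R" "\<And>z. cmod (z - \<zeta>) \<le> R \<Longrightarrow> cmod (cpoly P z) \<le> B"
  shows "cmod (cpoly ((pderiv ^^ n) P) \<zeta>) \<le> fact n * B / R ^ n"
  unfolding higher_deriv_cpoly[symmetric] using assms
  by (intro Cauchy_inequality holomorphic_on_imp_continuous_on holomorphic_on_cpoly)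
    (auto simp: norm_minus_commute)

text \<open>\<open>v\<close> is an exterior preimage of \<open>z\<close> under the Joukowski map (v
  + 1/v) / 2, with the denominator cleared. The two roots \<open>z + s\<close> and
  \<open>z - s\<close> have product 1, so one of them lies outside the open unit disc.\<close>

lemma exists_joukowski: "\<exists>v. 1 \<le> cmod v \<and> v\<^sup>2 + 1 = 2 * z * v"
proof -
  define s where "s = csqrt (z\<^sup>2 - 1)"
  have s: "s\<^sup>2 = z\<^sup>2 - 1" by (simp add: s_def)
  have "(z + s) * (z - s) = 1" using s by (simp add: power2_eq_square algebra_simps)
  then have "cmod (z + s) * cmod (z - s) = 1" by (metis norm_mult norm_one)
  then have "1 \<le> cmod (z + s) \<or> 1 \<le> cmod (z - s)"
    by (metis linorder_not_le mult_less_cancel_left2 mult_strict_mono' norm_ge_zero mult_1 less_irrefl)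
  moreover have "(z + s)\<^sup>2 + 1 = 2 * z * (z + s)" "(z - s)\<^sup>2 + 1 = 2 * z * (z - s)"
    using s by (simp_all add: power2_eq_square algebra_simps)
  ultimately show ?thesis by blast
qed

text \<open>\<open>F u\<close> is u^N P((u + 1/u) / 2) with all denominators cleared, hence a
  polynomial in u. On the unit circle the argument of P is a cosine, so \<open>F\<close> is bounded
  by \<open>S\<close> there; the maximum principle is applied at the interior or boundary point
  1/v.\<close>

lemma cpoly_joukowski_bound:
  assumes N: "degree P \<le> N" and S: "\<And>y. y \<in> {-1..1} \<Longrightarrow> \<bar>poly P y\<bar> \<le> S"
    and v: "1 \<le> cmod v" "v\<^sup>2 + 1 = 2 * z * v"
  shows "cmod (cpoly P z) \<le> S * cmod v ^ N"
proof -
  define F where "F = (\<lambda>u::complex. \<Sum>i\<le>degree P. of_real (coeff P i) * (u ^ (N - i) * ((u\<^sup>2 + 1) / 2) ^ i))"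
  have F: "F u = u ^ N * cpoly P y" if "u\<^sup>2 + 1 = 2 * y * u" for u y :: complex
  proof -
    have "u ^ (N - i) * ((u\<^sup>2 + 1) / 2) ^ i = u ^ N * y ^ i" if "i \<le> degree P" for i
    proof -
      have "u ^ (N - i) * ((u\<^sup>2 + 1) / 2) ^ i = (u ^ (N - i) * u ^ i) * y ^ i"
        using \<open>u\<^sup>2 + 1 = 2 * y * u\<close> by (simp add: power_mult_distrib)
      then show ?thesis using that N by (simp flip: power_add)
    qed
    then show ?thesis by (simp add: F_def cpoly_altdef sum_distrib_left mult_ac)
  qed
  have circ: "cmod (F u) \<le> S" if "cmod u = 1" for u
  proof -
    define t where "t = Arg u"
    have "u \<noteq> 0" using that by auto
    then have t: "u = cis t" using cis_Arg[of u] that by (simp add: t_def sgn_eq)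
    have "u\<^sup>2 + 1 = 2 * of_real (cos t) * u"
    proof -
      have "2 * of_real (cos t) = cis t + cis (- t)" by (simp add: complex_eq_iff)
      then show ?thesis by (simp add: t distrib_right cis_mult power2_eq_square)
    qed
    then have "F u = u ^ N * cpoly P (of_real (cos t))" by (rule F)
    then have "cmod (F u) = \<bar>poly P (cos t)\<bar>"
      using that by (simp only: cpoly_of_real norm_mult norm_power norm_of_real) simp
    then show ?thesis using S[of "cos t"] by simp
  qed
  have "cmod (F (1 / v)) \<le> S"
  proof (rule maximum_modulus_frontier[of F "cball 0 1"])
    show "F holomorphic_on interior (cball 0 1)" "continuous_on (closure (cball 0 1)) F"
      unfolding F_def by (auto intro!: holomorphic_intros continuous_intros)
    show "1 / v \<in> cball 0 1" using v(1) by (simp add: norm_divide divide_le_eq)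
  qed (use circ in auto)
  moreover have v0: "v \<noteq> 0" using v(1) by auto
  have "(1 / v)\<^sup>2 + 1 = 2 * z * (1 / v)"
    using v(2) v0 by (simp add: field_simps power2_eq_square)
  then have "F (1 / v) = (1 / v) ^ N * cpoly P z" by (rule F)
  ultimately have "cmod (cpoly P z) / cmod v ^ N \<le> S"
    by (simp add: norm_mult norm_power norm_divide power_one_over)
  then show ?thesis using v0 by (simp add: divide_le_eq)
qed

text \<open>The unit-circle points over x are x + i phi x and its conjugate, and the equation for v
  becomes (v - a)(v - cnj a) = 2 (z - x) v. With \<open>a\<close> the nearer of the two, v lies
  within 1/m of it. This is why \<open>rho\<close> has order phi/m in the interior and 1/m^2 at the
  end points.\<close>

lemma joukowski_near_interval:
  assumes m: "1 \<le> m" and x: "x \<in> {-1..1}" and z: "cmod (z - of_real x) \<le> rho m x / 8"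
    and v: "v\<^sup>2 + 1 = 2 * z * v"
  shows "cmod v \<le> 1 + 1 / m"
proof -
  define f where "f = phi x"
  have f0: "0 \<le> f" using phi_nonneg[OF x] by (simp add: f_def)
  define d where "d = cmod (z - of_real x)"
  have key: "cmod v \<le> 1 + 1 / m"
    if a: "a = Complex x f \<or> a = Complex x (- f)" and near: "cmod (v - a) \<le> cmod (v - cnj a)" for a
  proof -
    define t where "t = cmod (v - a)"
    have t0: "0 \<le> t" by (simp add: t_def)
    have "(cmod a)\<^sup>2 = 1" using a phi_sq[OF x] by (auto simp: cmod_def f_def)
    then have ca: "cmod a = 1" by (metis norm_ge_zero one_power2 power2_eq_imp_eq zero_le_one)
    have vt: "cmod v \<le> 1 + t"
      using norm_triangle_ineq[of a "v - a"] ca by (simp add: t_def)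
    have "a * cnj a = 1" "a + cnj a = 2 * of_real x"
      using ca a by (auto simp: complex_norm_square[symmetric] complex_eq_iff)
    moreover have "(v - a) * (v - cnj a) = v\<^sup>2 - (a + cnj a) * v + a * cnj a"
      by (simp add: power2_eq_square algebra_simps)
    ultimately have "(v - a) * (v - cnj a) = v\<^sup>2 + 1 - 2 * of_real x * v" by simp
    also have "\<dots> = 2 * (z - of_real x) * v"
      unfolding v by (simp add: algebra_simps)
    finally have prod: "t * cmod (v - cnj a) = 2 * d * cmod v"
      by (metis t_def d_def norm_mult norm_numeral)
    have "2 * f = cmod (a - cnj a)" using a f0 by (auto simp: cmod_def real_sqrt_mult)
    also have "\<dots> \<le> cmod (v - a) + cmod (v - cnj a)"
      using norm_triangle_ineq4[of "v - cnj a" "v - a"] by simp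
    finally have far: "f \<le> cmod (v - cnj a)" using near by simp
    have "t \<le> 1 / m"
    proof (rule ccontr)
      assume "\<not> t \<le> 1 / m"
      then have t: "1 / m < t" by simp
      \<comment> \<open>\<open>M\<close> bounds the distance from v to the farther point from below
        and dominates both terms of \<open>f + 1 / m\<close>, so it cancels from the product
        identity.\<close>
      define M where "M = max f t"
      have M: "0 < M" "f \<le> M" "1 / m \<le> M"
        using t m by (auto simp: M_def max_def intro: order_trans less_le_trans[of 0 "1 / m"])
      have "M \<le> cmod (v - cnj a)" using far near by (simp add: M_def t_def)
      then have "t * M \<le> 2 * d * cmod v" using t0 prod by (metis mult_left_mono)
      also have "\<dots> \<le> 2 * (rho m x / 8) * (1 + t)"
        using z vt t0 rho_pos[OF m x] by (intro mult_mono) (auto simp: d_def)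
      also have "\<dots> = ((f + 1 / m) * (1 + t)) / (4 * m)"
        using m by (simp add: rho_alt f_def power2_eq_square field_simps)
      also have "\<dots> \<le> ((2 * M) * (1 + t)) / (4 * m)"
        using M t0 by (intro divide_right_mono mult_right_mono) auto
      also have "\<dots> = ((1 + t) / (2 * m)) * M" by simp
      finally have "t \<le> (1 + t) / (2 * m)" by (simp only: mult_le_cancel_right_pos[OF M(1)])
      then have "t \<le> (1 / m + t * (1 / m)) / 2" by (simp add: add_divide_distrib)
      moreover have "t * (1 / m) \<le> t * 1" using m t0 by (intro mult_left_mono) auto
      ultimately show False using t by argo
    qed
    with vt show ?thesis by linarith
  qed
  show ?thesis
  proof (cases "cmod (v - Complex x f) \<le> cmod (v - Complex x (- f))")
    case True
    then show ?thesis by (intro key[of "Complex x f"]) (auto simp: complex_cnj)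
  next
    case False
    then show ?thesis by (intro key[of "Complex x (- f)"]) (auto simp: complex_cnj)
  qed
qed

text \<open>On this disc the Joukowski modulus is at most 1 + 1/m, and the power
  \<open>\<kappa> * m\<close> of 1 + 1/m is at most \<open>exp \<kappa>\<close>, independently of
  m.\<close>

lemma bernstein_walsh:
  assumes m: "1 \<le> m" and deg: "degree P \<le> \<kappa> * m" and S: "\<And>y. y \<in> {-1..1} \<Longrightarrow> \<bar>poly P y\<bar> \<le> S"
    and x: "x \<in> {-1..1}" and z: "cmod (z - of_real x) \<le> rho m x / 8"
  shows "cmod (cpoly P z) \<le> exp (real \<kappa>) * S"
proof -
  obtain v where v: "1 \<le> cmod v" "v\<^sup>2 + 1 = 2 * z * v" using exists_joukowski by blast
  have S0: "0 \<le> S" using S[OF x] by linarith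
  have "cmod v ^ (\<kappa> * m) \<le> exp (1 / m) ^ (\<kappa> * m)"
    using order_trans[OF joukowski_near_interval[OF m x z v(2)] exp_ge_add_one_self]
    by (intro power_mono) auto
  also have "\<dots> = exp (real \<kappa>)" using m by (subst exp_of_nat_mult[symmetric]) simp
  finally have "cmod v ^ (\<kappa> * m) \<le> exp (real \<kappa>)" .
  then have "S * cmod v ^ (\<kappa> * m) \<le> exp (real \<kappa>) * S"
    using S0 by (simp add: mult_left_mono mult.commute)
  moreover have "cmod (cpoly P z) \<le> S * cmod v ^ (\<kappa> * m)"
    by (rule cpoly_joukowski_bound[OF deg _ v]) (rule S)
  ultimately show ?thesis by linarith
qed

text \<open>Discs of radius \<open>rho m x / 16\<close> about points of the disc with the same
  radius about x stay where \<open>bernstein_walsh\<close> applies, so Cauchy's estimate bounds the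
  derivative.\<close>

lemma cpoly_lipschitz:
  assumes m: "1 \<le> m" and deg: "degree P \<le> \<kappa> * m" and S: "\<And>y. y \<in> {-1..1} \<Longrightarrow> \<bar>poly P y\<bar> \<le> S"
    and x: "x \<in> {-1..1}" and z: "cmod (z - of_real x) \<le> rho m x / 16"
  shows "cmod (cpoly P z - of_real (poly P x)) \<le> 16 * exp (real \<kappa>) * S / rho m x * cmod (z - of_real x)"
  unfolding cpoly_of_real[symmetric]
proof (rule field_differentiable_bound[of "cball (of_real x) (rho m x / 16)" _ "cpoly (pderiv P)"])
  have r: "0 < rho m x" by (rule rho_pos[OF m x])
  fix u :: complex assume u: "u \<in> cball (of_real x) (rho m x / 16)"
  show "(cpoly P has_field_derivative cpoly (pderiv P) u) (at u within cball (of_real x) (rho m x / 16))"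
    by (rule has_field_derivative_at_within[OF has_field_derivative_cpoly])
  have "cmod (cpoly ((pderiv ^^ 1) P) u) \<le> fact 1 * (exp (real \<kappa>) * S) / (rho m x / 16) ^ 1"
  proof (rule cpoly_higher_deriv_bound)
    fix z assume "cmod (z - u) \<le> rho m x / 16"
    then have "cmod (z - of_real x) \<le> rho m x / 8"
      using u norm_triangle_ineq[of "z - u" "u - of_real x"]
      by (simp add: dist_norm norm_minus_commute)
    then show "cmod (cpoly P z) \<le> exp (real \<kappa>) * S"
      by (intro bernstein_walsh[OF m deg _ x]) (rule S)
  qed (use r in auto)
  then show "cmod (cpoly (pderiv P) u) \<le> 16 * exp (real \<kappa>) * S / rho m x" by (simp add: mult_ac)
next
  show "z \<in> cball (of_real x) (rho m x / 16)"
    using z by (simp only: mem_cball dist_norm norm_minus_commute)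
  show "of_real x \<in> cball (of_real x :: complex) (rho m x / 16)"
    using rho_pos[OF m x] by simp
qed (rule convex_cball)

text \<open>At a maximum point of |Q| the Lipschitz bound keeps |Q| above half its maximum on an
  interval whose length is a fixed fraction of \<open>rho\<close>. The measure dy /
  \<open>rho m y\<close> gives such an interval a mass bounded below, which compares the maximum
  with the integral for every p.\<close>

lemma nikolskii:
  fixes p :: real
  assumes m: "1 \<le> m" and deg: "degree Q \<le> \<kappa> * m" and p: "0 < p" "p \<le> 1" and x: "x \<in> {-1..1}"
  shows "\<bar>poly Q x\<bar> powr p \<le> 128 * exp (real \<kappa>) * integral {-1..1} (\<lambda>y. \<bar>poly Q y\<bar> powr p / rho m y)"
proof -
  let ?f = "\<lambda>y. \<bar>poly Q y\<bar> powr p / rho m y"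
  have cf: "continuous_on {-1..1} ?f"
    using p less_imp_neq[OF rho_pos[OF m], symmetric]
    by (intro continuous_on_divide continuous_on_powr' continuous_on_rho[OF m] continuous_intros) auto
  have "\<exists>y0\<in>{-1..1}. \<forall>y\<in>{-1..1}. \<bar>poly Q y\<bar> \<le> \<bar>poly Q y0\<bar>"
    by (rule continuous_attains_sup) (auto intro!: continuous_intros)
  then obtain y0 where y0: "y0 \<in> {-1..1}" and max: "\<And>y. y \<in> {-1..1} \<Longrightarrow> \<bar>poly Q y\<bar> \<le> \<bar>poly Q y0\<bar>"
    by blast
  define S where "S = \<bar>poly Q y0\<bar>"
  \<comment> \<open>Chosen so that the Lipschitz constant times \<open>a * r\<close> is exactly half
    the maximum.\<close>
  define a where "a = 1 / (32 * exp (real \<kappa>))"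
  define r where "r = rho m y0"
  have r: "0 < r" "r \<le> 2" using rho_pos[OF m y0] rho_le_2[OF m] by (auto simp: r_def)
  have a: "0 < a" "a \<le> 1 / 32" by (auto simp: a_def divide_le_eq)
  have ar: "0 < a * r" "a * r \<le> 1" "a * r \<le> r / 32"
    using a r mult_mono[of a "1 / 32" r 2] mult_right_mono[of a "1 / 32" r] by auto
  \<comment> \<open>The interval extends from \<open>y0\<close> towards the origin, so it stays in
    [-1, 1] because its length is at most 1.\<close>
  define c where "c = (if y0 \<le> 0 then y0 else y0 - a * r)"
  have sub: "{c..c + a * r} \<subseteq> {-1..1}" using y0 ar by (auto simp: c_def)
  have low: "(S / 2) powr p / (2 * r) \<le> ?f y" if "y \<in> {c..c + a * r}" for y
  proof -
    have y: "y \<in> {-1..1}" and d: "\<bar>y - y0\<bar> \<le> a * r" using sub that by (auto simp: c_def split: if_splits)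
    have "cmod (of_real y - of_real y0) = \<bar>y - y0\<bar>" by (metis norm_of_real of_real_diff)
    moreover have "cmod (cpoly Q (of_real y) - of_real (poly Q y0)) = \<bar>poly Q y - poly Q y0\<bar>"
      by (metis cpoly_of_real norm_of_real of_real_diff)
    ultimately have "\<bar>poly Q y - poly Q y0\<bar> \<le> 16 * exp (real \<kappa>) * S / r * \<bar>y - y0\<bar>"
      using cpoly_lipschitz[OF m deg _ y0, of S "of_real y"] max d ar r by (simp add: S_def r_def)
    also have "\<dots> \<le> 16 * exp (real \<kappa>) * S / r * (a * r)"
      using d r by (intro mult_left_mono) (auto simp: S_def)
    also have "\<dots> = S / 2" using r by (simp add: a_def)
    finally have "S / 2 \<le> \<bar>poly Q y\<bar>" unfolding S_def by linarith
    then have "(S / 2) powr p \<le> \<bar>poly Q y\<bar> powr p" using p by (intro powr_mono2) (auto simp: S_def)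
    moreover have "rho m y \<le> 2 * r" using rho_near[OF m y y0] d ar r by (simp add: r_def)
    ultimately show ?thesis using rho_pos[OF m y] by (intro frac_le) auto
  qed
  have "a * r * ((S / 2) powr p / (2 * r)) = integral {c..c + a * r} (\<lambda>y. (S / 2) powr p / (2 * r))"
    using ar by simp
  also have "\<dots> \<le> integral {c..c + a * r} ?f"
    using low sub by (intro integral_le integrable_continuous_interval continuous_on_subset[OF cf]) auto
  also have "\<dots> \<le> integral {-1..1} ?f"
    using sub rho_pos[OF m]
    by (intro integral_subset_le integrable_continuous_interval continuous_on_subset[OF cf]) (auto intro!: divide_nonneg_pos)
  finally have 1: "a / 2 * (S / 2) powr p \<le> integral {-1..1} ?f" using r by simp
  have "S powr p = 2 powr p * (S / 2) powr p"
    by (subst powr_mult[symmetric]) (auto simp: S_def)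
  also have "\<dots> \<le> 2 * (S / 2) powr p"
    using powr_mono[of p 1 2] p by (intro mult_right_mono) auto
  also have "\<dots> = 4 / a * (a / 2 * (S / 2) powr p)" using a by simp
  also have "\<dots> \<le> 4 / a * integral {-1..1} ?f" using 1 a by (intro mult_left_mono) auto
  also have "\<dots> = 128 * exp (real \<kappa>) * integral {-1..1} ?f" by (simp add: a_def)
  finally have "S powr p \<le> \<dots>" .
  moreover have "\<bar>poly Q x\<bar> powr p \<le> S powr p" using max[OF x] p by (intro powr_mono2) (auto simp: S_def)
  ultimately show ?thesis by linarith
qed

lemma pderiv_local_bound:
  fixes p :: real
  assumes m: "1 \<le> m" and deg: "degree P \<le> m - 1" and p: "0 < p" "p \<le> 1"
    and x: "x \<in> {-1..1}" and \<xi>: "\<bar>\<xi> - x\<bar> \<le> rho m x / (128 * exp 1)"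
  shows "(rho m x ^ r * \<bar>poly ((pderiv ^^ r) P) \<xi>\<bar>) powr p
    \<le> (fact r * 4 ^ M * exp (real (M + 1)) * (128 * exp 1) ^ r) powr p * (128 * exp (real (M + 1)))
        * integral {-1..1} (\<lambda>y. (\<bar>poly P y\<bar> * poly (bump m x) y ^ M) powr p / rho m y)"
proof -
  define Q where "Q = P * bump m x ^ M"
  define r0 where "r0 = rho m x"
  have r0: "0 < r0" using rho_pos[OF m x] by (simp add: r0_def)
  have "degree Q \<le> degree P + M * degree (bump m x)"
    unfolding Q_def by (intro order_trans[OF degree_mult_le] add_mono degree_power_le order_refl) (metis degree_power_le mult.commute)
  also have "\<dots> \<le> m + M * m"
    using deg degree_bump[OF m, of x] by (intro add_mono mult_le_mono) auto
  finally have degQ: "degree Q \<le> (M + 1) * m" by simp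
  have degB: "degree (bump m x) \<le> 1 * m" using degree_bump[OF m, of x] by simp
  have "\<exists>y0\<in>{-1..1}. \<forall>y\<in>{-1..1}. \<bar>poly Q y\<bar> \<le> \<bar>poly Q y0\<bar>"
    by (rule continuous_attains_sup) (auto intro!: continuous_intros)
  then obtain y0 where y0: "y0 \<in> {-1..1}" and max: "\<And>y. y \<in> {-1..1} \<Longrightarrow> \<bar>poly Q y\<bar> \<le> \<bar>poly Q y0\<bar>"
    by blast
  define S where "S = \<bar>poly Q y0\<bar>"
  \<comment> \<open>The kernel is at least 1/2 at x and has Lipschitz constant 16 e /
    \<open>r0\<close> there; the radius \<open>r0 / (64 * exp 1)\<close> makes its variation at most
    1/4.\<close>
  have bnd: "cmod (cpoly P z) \<le> 4 ^ M * exp (real (M + 1)) * S"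
    if z: "cmod (z - of_real x) \<le> r0 / (64 * exp 1)" for z
  proof -
    have "r0 / (64 * exp 1) \<le> r0 / 16"
      using r0 exp_ge_add_one_self[of "1::real"] by (intro divide_left_mono) auto
    then have z16: "cmod (z - of_real x) \<le> rho m x / 16" using z by (simp add: r0_def)
    have "cmod (cpoly (bump m x) z - of_real (poly (bump m x) x))
        \<le> 16 * exp (real 1) * 1 / rho m x * cmod (z - of_real x)"
      by (rule cpoly_lipschitz[OF m degB _ x z16]) (use bump_bounds[OF x, of _ m] in auto)
    also have "\<dots> \<le> 16 * exp (real 1) * 1 / rho m x * (r0 / (64 * exp 1))"
      using z r0 by (intro mult_left_mono) (auto simp: r0_def)
    also have "\<dots> = 1 / 4" using r0 by (simp add: r0_def)
    finally have "cmod (of_real (poly (bump m x) x) :: complex) - 1 / 4 \<le> cmod (cpoly (bump m x) z)"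
      using norm_triangle_ineq2[of "of_real (poly (bump m x) x)" "cpoly (bump m x) z"]
      by (simp only: norm_minus_commute)
    then have "1 / 4 \<le> cmod (cpoly (bump m x) z)"
      using bump_self[OF x m] by (simp add: norm_of_real)
    then have "(1 / 4) ^ M \<le> cmod (cpoly (bump m x) z) ^ M" by (intro power_mono) auto
    then have "cmod (cpoly P z) * (1 / 4) ^ M \<le> cmod (cpoly P z) * cmod (cpoly (bump m x) z) ^ M"
      by (intro mult_left_mono) auto
    also have "\<dots> = cmod (cpoly Q z)" by (simp add: Q_def cpoly_mult cpoly_power norm_mult norm_power)
    also have "\<dots> \<le> exp (real (M + 1)) * S"
      unfolding S_def using z16 r0 by (intro bernstein_walsh[OF m degQ _ x] max) (auto simp: r0_def)
    finally show ?thesis by (simp add: power_one_over field_simps)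
  qed
  \<comment> \<open>Half the radius in \<open>bnd\<close>, so the disc of radius \<open>R\<close>
    about any admissible \<xi> stays in the disc about x.\<close>
  define R where "R = r0 / (128 * exp 1)"
  have R: "0 < R" using r0 by (simp add: R_def)
  have "cmod (cpoly ((pderiv ^^ r) P) (of_real \<xi>)) \<le> fact r * (4 ^ M * exp (real (M + 1)) * S) / R ^ r"
  proof (rule cpoly_higher_deriv_bound[OF R])
    fix z :: complex assume z: "cmod (z - of_real \<xi>) \<le> R"
    have "cmod (of_real \<xi> - of_real x) \<le> R"
      using \<xi> by (metis norm_of_real of_real_diff R_def r0_def real_norm_def)
    then have "cmod (z - of_real x) \<le> R + R"
      using z norm_triangle_ineq[of "z - of_real \<xi>" "of_real \<xi> - of_real x"] by simp
    also have "\<dots> = r0 / (64 * exp 1)" by (simp add: R_def field_simps)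
    finally show "cmod (cpoly P z) \<le> 4 ^ M * exp (real (M + 1)) * S" by (rule bnd)
  qed
  then have "\<bar>poly ((pderiv ^^ r) P) \<xi>\<bar> \<le> fact r * (4 ^ M * exp (real (M + 1)) * S) / R ^ r"
    by (simp add: cpoly_of_real)
  then have "r0 ^ r * \<bar>poly ((pderiv ^^ r) P) \<xi>\<bar> \<le> r0 ^ r * (fact r * (4 ^ M * exp (real (M + 1)) * S) / R ^ r)"
    using r0 by (intro mult_left_mono) auto
  also have "\<dots> = (fact r * 4 ^ M * exp (real (M + 1)) * (128 * exp 1) ^ r) * S"
    using r0 by (simp add: R_def power_divide)
  finally have "(r0 ^ r * \<bar>poly ((pderiv ^^ r) P) \<xi>\<bar>) powr p
    \<le> ((fact r * 4 ^ M * exp (real (M + 1)) * (128 * exp 1) ^ r) * S) powr p"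
    using p r0 by (intro powr_mono2) auto
  also have "\<dots> = (fact r * 4 ^ M * exp (real (M + 1)) * (128 * exp 1) ^ r) powr p * S powr p"
    by (intro powr_mult)
  also have "\<dots> \<le> (fact r * 4 ^ M * exp (real (M + 1)) * (128 * exp 1) ^ r) powr p *
      (128 * exp (real (M + 1)) * integral {-1..1} (\<lambda>y. \<bar>poly Q y\<bar> powr p / rho m y))"
    unfolding S_def by (intro mult_left_mono nikolskii[OF m degQ p y0]) auto
  also have "integral {-1..1} (\<lambda>y. \<bar>poly Q y\<bar> powr p / rho m y)
      = integral {-1..1} (\<lambda>y. (\<bar>poly P y\<bar> * poly (bump m x) y ^ M) powr p / rho m y)"
    using bump_bounds[OF x, of _ m]
    by (intro Henstock_Kurzweil_Integration.integral_cong) (auto simp: Q_def abs_mult power_abs)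
  finally show ?thesis by (simp add: r0_def mult.assoc)
qed

subsection \<open>Differences of polynomials\<close>

text \<open>Anchored at the left end instead of the centre, which keeps half steps out of the
  recursion on r.\<close>

definition forward_diff :: "nat \<Rightarrow> real \<Rightarrow> (real \<Rightarrow> real) \<Rightarrow> real \<Rightarrow> real" where
  "forward_diff r h f x = (\<Sum>i=0..r. real (r choose i) * (-1) ^ (r - i) * f (x + real i * h))"

lemma forward_diff_Suc:
  "forward_diff (Suc r) h f x = forward_diff r h (\<lambda>u. f (u + h) - f u) x"
proof -
  let ?g = "\<lambda>i. f (x + real i * h)"
  have "forward_diff (Suc r) h f x
    = (-1) ^ Suc r * ?g 0 + (\<Sum>i=0..r. real (Suc r choose Suc i) * (-1) ^ (r - i) * ?g (Suc i))"
    unfolding forward_diff_def by (subst sum.atLeast0_atMost_Suc_shift) simp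
  also have "(\<Sum>i=0..r. real (Suc r choose Suc i) * (-1) ^ (r - i) * ?g (Suc i))
    = (\<Sum>i=0..r. real (r choose i) * (-1) ^ (r - i) * ?g (Suc i))
      + (\<Sum>i=0..r. real (r choose Suc i) * (-1) ^ (r - i) * ?g (Suc i))"
    by (simp add: sum.distrib[symmetric] algebra_simps)
  also have "(\<Sum>i=0..r. real (r choose Suc i) * (-1) ^ (r - i) * ?g (Suc i))
    = (-1) ^ r * ?g 0 - (\<Sum>i=0..r. real (r choose i) * (-1) ^ (r - i) * ?g i)"
  proof -
    \<comment> \<open>A zero top term is added so that the index can be shifted; the
      \<open>if\<close> guards against truncated subtraction, and the binomial coefficient vanishes
      at the extra index.\<close>
    have "(\<Sum>i=0..r. real (r choose i) * (-1) ^ (r - i) * ?g i)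
      = (\<Sum>i=0..Suc r. real (r choose i) * (if i \<le> r then (-1) ^ (r - i) else 0) * ?g i)"
      by (auto intro!: sum.cong)
    also have "\<dots> = (-1) ^ r * ?g 0 + (\<Sum>i=0..r. real (r choose Suc i) * (if Suc i \<le> r then (-1) ^ (r - Suc i) else 0) * ?g (Suc i))"
      by (subst sum.atLeast0_atMost_Suc_shift) simp
    also have "(\<Sum>i=0..r. real (r choose Suc i) * (if Suc i \<le> r then (-1) ^ (r - Suc i) else 0) * ?g (Suc i))
      = - (\<Sum>i=0..r. real (r choose Suc i) * (-1) ^ (r - i) * ?g (Suc i))"
      unfolding sum_negf[symmetric]
    proof (intro sum.cong refl)
      fix i assume "i \<in> {0..r}"
      show "real (r choose Suc i) * (if Suc i \<le> r then (-1) ^ (r - Suc i) else 0) * ?g (Suc i)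
        = - (real (r choose Suc i) * (-1) ^ (r - i) * ?g (Suc i))"
      proof (cases "Suc i \<le> r")
        case True
        then have "r - i = Suc (r - Suc i)" by simp
        then have "(-1::real) ^ (r - i) = - ((-1) ^ (r - Suc i))" by (simp del: Suc_diff_Suc)
        then show ?thesis using True by simp
      qed (simp add: binomial_eq_0)
    qed
    finally show ?thesis by simp
  qed
  finally show ?thesis
    by (simp add: forward_diff_def right_diff_distrib sum_subtractf algebra_simps)
qed

text \<open>Induction on r through the polynomial P(u + h) - P(u): by the mean value inequality its
  r-th derivative is at most \<open>h * B\<close> on the interval shortened by one step.\<close>

lemma forward_diff_poly_bound:
  assumes "0 \<le> h" "\<And>\<xi>. \<xi> \<in> {x..x + real r * h} \<Longrightarrow> \<bar>poly ((pderiv ^^ r) P) \<xi>\<bar> \<le> B"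
  shows "\<bar>forward_diff r h (poly P) x\<bar> \<le> h ^ r * B"
  using assms(2)
proof (induction r arbitrary: P B)
  case 0
  then show ?case by (simp add: forward_diff_def)
next
  case (Suc r)
  define G where "G = pcompose P [:h, 1:] - P"
  have shift: "(pderiv ^^ r) (pcompose P [:h, 1:]) = pcompose ((pderiv ^^ r) P) [:h, 1:]" for r
    by (induction r) (simp_all add: pderiv_pcompose pderiv_pCons)
  have G: "poly G u = poly P (u + h) - poly P u" for u
    by (simp add: G_def poly_pcompose add.commute)
  have "\<bar>poly ((pderiv ^^ r) G) \<xi>\<bar> \<le> h * B" if \<xi>: "\<xi> \<in> {x..x + real r * h}" for \<xi>
  proof -
    have "(pderiv ^^ r) (p - q) = (pderiv ^^ r) p - (pderiv ^^ r) q" for p q :: "real poly"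
      by (induction r) (simp_all add: pderiv_diff)
    then have "poly ((pderiv ^^ r) G) \<xi> = poly ((pderiv ^^ r) P) (\<xi> + h) - poly ((pderiv ^^ r) P) \<xi>"
      by (simp add: G_def shift poly_pcompose add.commute)
    also have "norm \<dots> \<le> B * norm ((\<xi> + h) - \<xi>)"
    proof (rule field_differentiable_bound[of "{x..x + real (Suc r) * h}" _ "poly ((pderiv ^^ Suc r) P)"])
      fix z assume "z \<in> {x..x + real (Suc r) * h}"
      then show "norm (poly ((pderiv ^^ Suc r) P) z) \<le> B" using Suc.prems by simp
      show "(poly ((pderiv ^^ r) P) has_field_derivative poly ((pderiv ^^ Suc r) P) z)
          (at z within {x..x + real (Suc r) * h})"
        using poly_DERIV[of "(pderiv ^^ r) P" z] by (simp add: has_field_derivative_at_within)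
    qed (use \<xi> assms(1) in \<open>auto simp: algebra_simps\<close>)
    finally show ?thesis using assms(1) by (simp add: mult.commute)
  qed
  then have "\<bar>forward_diff r h (poly G) x\<bar> \<le> h ^ r * (h * B)" by (rule Suc.IH)
  moreover have "poly G = (\<lambda>u. poly P (u + h) - poly P u)" using G by (rule ext)
  then have "forward_diff (Suc r) h (poly P) x = forward_diff r h (poly G) x"
    by (simp only: forward_diff_Suc)
  ultimately show ?case by (simp add: mult_ac)
qed

subsection \<open>The weighted Bernstein inequality\<close>

text \<open>The bound is proportional to \<open>r\<close>, used as \<open>rho m y\<close>, and thus
  cancels the factor 1 / \<open>rho m y\<close> left by \<open>nikolskii\<close>.\<close>

lemma integral_inverse_quadratic_le:
  assumes "0 < r"
  shows "integral {-1..1} (\<lambda>x. 1 / (1 + ((x - y) / r)\<^sup>2)) \<le> pi * r"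
proof -
  have "((\<lambda>x. 1 / (1 + ((x - y) / r)\<^sup>2)) has_integral (r * arctan ((1 - y) / r) - r * arctan ((-1 - y) / r))) {-1..1}"
  proof (rule fundamental_theorem_of_calculus)
    fix x :: real
    have "((\<lambda>x. r * arctan ((x - y) / r)) has_real_derivative (r * (inverse (1 + ((x - y) / r)\<^sup>2) * (1 / r)))) (at x within {-1..1})"
      using assms by (auto intro!: derivative_eq_intros)
    moreover have "r * (inverse (1 + ((x - y) / r)\<^sup>2) * (1 / r)) = 1 / (1 + ((x - y) / r)\<^sup>2)"
      using assms by (simp add: divide_inverse)
    ultimately show "((\<lambda>x. r * arctan ((x - y) / r)) has_vector_derivative 1 / (1 + ((x - y) / r)\<^sup>2)) (at x within {-1..1})"
      unfolding has_real_derivative_iff_has_vector_derivative[symmetric] by (simp only:)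
  qed simp
  then have "integral {-1..1} (\<lambda>x. 1 / (1 + ((x - y) / r)\<^sup>2)) = r * (arctan ((1 - y) / r) - arctan ((-1 - y) / r))"
    by (simp add: integral_unique right_diff_distrib)
  also have "\<dots> \<le> r * pi"
    using arctan_ubound[of "(1 - y) / r"] arctan_lbound[of "(-1 - y) / r"] assms
    by (intro mult_left_mono) auto
  finally show ?thesis by (simp add: mult.commute)
qed

text \<open>The weight grows like \<open>E ^ (2 * A + 1)\<close> and the kernel decays with exponent
  2Mp, so the condition on \<open>M\<close> leaves at most E^(-4). Since |q| <= E^2 / 2, this is
  dominated by the inverse quadratic, which is integrable at scale \<open>rho m y\<close>.\<close>

lemma avg_weight_bump_pointwise:
  assumes w: "doubling_weight ((3 / 2) ^ A) w" and m: "1 \<le> m" and p: "0 < p"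
    and M: "2 * real A + 5 \<le> 2 * real M * p" and x: "x \<in> {-1..1}" and y: "y \<in> {-1..1}"
  shows "avg_weight w m x * (poly (bump m x) y ^ M) powr p
    \<le> (9 / 4) ^ A * 16 powr (M * p) * 2 * avg_weight w m y * (1 / (1 + ((x - y) / rho m y)\<^sup>2))"
proof -
  define E where "E = gap m x y"
  have E: "1 \<le> E" by (simp add: E_def gap_ge_1)
  define q where "q = (x - y) / rho m y"
  have ry: "0 < rho m y" by (rule rho_pos[OF m y])
  have "\<bar>q\<bar> \<le> E\<^sup>2 / 2"
    using dist_le_gap[OF m x y] ry by (simp add: q_def E_def abs_divide divide_le_eq)
  then have "\<bar>q\<bar>\<^sup>2 \<le> (E\<^sup>2 / 2)\<^sup>2" by (intro power_mono) auto
  then have "q\<^sup>2 \<le> E ^ 4 / 4" by (simp add: power_divide flip: power_mult)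
  moreover have "1 \<le> E ^ 4" using E by simp
  ultimately have q: "1 + q\<^sup>2 \<le> 2 * E ^ 4" by simp
  have B: "0 \<le> poly (bump m x) y" using bump_bounds(1)[OF x y] .
  \<comment> \<open>Where the kernel vanishes, \<open>0 ^ M\<close> has to be 0 and not 1.\<close>
  have M0: "M \<noteq> 0" using M p by (intro notI) simp
  have "(16 / E\<^sup>2) powr (M * p) = 16 powr (M * p) * E powr (- (2 * (real M * p)))"
  proof -
    have "E\<^sup>2 = E powr 2" using E by simp
    then have "(E\<^sup>2) powr (M * p) = E powr (2 * (real M * p))" by (simp only: powr_powr)
    then have "(16 / E\<^sup>2) powr (M * p) = 16 powr (M * p) / E powr (2 * (real M * p))"
      by (simp add: powr_divide)
    then show ?thesis by (simp add: powr_minus divide_inverse)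
  qed
  moreover have "(poly (bump m x) y ^ M) powr p \<le> (16 / E\<^sup>2) powr (M * p)"
  proof (cases "poly (bump m x) y = 0")
    case True
    then show ?thesis using M0 by (simp add: power_0_left)
  next
    case False
    then have "(poly (bump m x) y ^ M) powr p = poly (bump m x) y powr (M * p)"
      using B by (simp add: powr_powr flip: powr_realpow)
    also have "\<dots> \<le> (16 / E\<^sup>2) powr (M * p)"
      unfolding E_def using B bump_decay[OF x y m] p by (intro powr_mono2) auto
    finally show ?thesis .
  qed
  ultimately have 1: "(poly (bump m x) y ^ M) powr p \<le> 16 powr (M * p) * E powr (- (2 * (real M * p)))"
    by (simp only:)
  have "avg_weight w m x * (poly (bump m x) y ^ M) powr p
    \<le> ((9 / 4) ^ A * E ^ (2 * A + 1) * avg_weight w m y) * (16 powr (M * p) * E powr (- (2 * (real M * p))))"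
    using E avg_weight_growth[OF w m x y, folded E_def]
    by (intro mult_mono 1 mult_nonneg_nonneg avg_weight_nonneg[OF w m y] powr_ge_zero zero_le_power)
      (assumption | simp)+
  also have "\<dots> = (9 / 4) ^ A * 16 powr (M * p) * avg_weight w m y * (E ^ (2 * A + 1) * E powr (- (2 * (real M * p))))"
    by (simp only: mult_ac)
  also have "\<dots> \<le> (9 / 4) ^ A * 16 powr (M * p) * avg_weight w m y * (2 / (1 + q\<^sup>2))"
  proof (intro mult_left_mono)
    have "E ^ (2 * A + 1) * E powr (- (2 * (real M * p))) = E powr (real (2 * A + 1) + - (2 * (real M * p)))"
    proof -
      have "E powr real (2 * A + 1) = E ^ (2 * A + 1)" using E by (intro powr_realpow) simp
      then show ?thesis by (simp only: powr_add)
    qed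
    also have "\<dots> \<le> E powr (- 4)" using E M by (intro powr_mono) auto
    also have "\<dots> = 1 / E ^ 4" using E by (simp add: powr_minus divide_inverse)
    also have "\<dots> \<le> 2 / (1 + q\<^sup>2)" using q E by (simp add: field_simps add_pos_nonneg)
    finally show "E ^ (2 * A + 1) * E powr (- (2 * (real M * p))) \<le> 2 / (1 + q\<^sup>2)" .
  qed (use avg_weight_nonneg[OF w m y] in auto)
  finally show ?thesis by (simp add: q_def mult_ac)
qed

lemma continuous_on_bump_left: "continuous_on S (\<lambda>x. poly (bump m x) y)"
  unfolding bump_def poly_smult poly_sum by (intro continuous_intros)

text \<open>Integration runs over the centre x of the kernel with y fixed: this is the inner
  integral once the order of integration is exchanged.\<close>

lemma avg_weight_bump_integral:
  assumes w: "doubling_weight ((3 / 2) ^ A) w" and m: "1 \<le> m" and p: "0 < p"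
    and M: "2 * real A + 5 \<le> 2 * real M * p" and y: "y \<in> {-1..1}"
  shows "integral {-1..1} (\<lambda>x. avg_weight w m x * (poly (bump m x) y ^ M) powr p)
    \<le> (9 / 4) ^ A * 16 powr (M * p) * 2 * pi * (avg_weight w m y * rho m y)"
proof -
  let ?c = "(9 / 4) ^ A * 16 powr (M * p) * 2 * avg_weight w m y"
  have ry: "0 < rho m y" by (rule rho_pos[OF m y])
  have c: "0 \<le> ?c" by (intro mult_nonneg_nonneg avg_weight_nonneg[OF w m y]) auto
  have nz: "1 + ((x - y) / rho m y)\<^sup>2 \<noteq> 0" for x
    using add_pos_nonneg[OF zero_less_one zero_le_power2[of "(x - y) / rho m y"]] by (simp only: less_le) simp
  have "integral {-1..1} (\<lambda>x. avg_weight w m x * (poly (bump m x) y ^ M) powr p)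
    \<le> integral {-1..1} (\<lambda>x. ?c * (1 / (1 + ((x - y) / rho m y)\<^sup>2)))"
  proof (intro integral_le integrable_continuous_interval)
    show "continuous_on {-1..1} (\<lambda>x. avg_weight w m x * (poly (bump m x) y ^ M) powr p)"
      using p bump_bounds(1)[OF _ y]
      by (intro continuous_on_mult continuous_on_avg_weight[OF w m] continuous_on_powr' continuous_on_power
          continuous_on_const continuous_on_bump_left) auto
    show "continuous_on {-1..1} (\<lambda>x. ?c * (1 / (1 + ((x - y) / rho m y)\<^sup>2)))"
      using nz ry by (intro continuous_intros) auto
  qed (rule avg_weight_bump_pointwise[OF w m p M _ y])
  also have "\<dots> = ?c * integral {-1..1} (\<lambda>x. 1 / (1 + ((x - y) / rho m y)\<^sup>2))"
    by (rule integral_mult_right)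
  also have "\<dots> \<le> ?c * (pi * rho m y)"
    by (intro mult_left_mono integral_inverse_quadratic_le ry c)
  finally show ?thesis by (simp add: mult_ac)
qed

text \<open>\<open>Z x\<close> is a constant times the Nikolskii integral for the kernel centred at
  x. It dominates the derivative at all nearby \<xi> at once and is continuous, so no supremum has
  to be integrated. After exchanging the integrals, the kernel contributes a multiple of
  \<open>avg_weight w m y * rho m y\<close>, and \<open>rho\<close> cancels.\<close>

lemma pderiv_weighted_bound:
  fixes p :: real
  assumes p: "0 < p" "p \<le> 1"
  shows "\<exists>C>0. \<forall>w m P. doubling_weight ((3 / 2) ^ A) w \<and> 1 \<le> m \<and> degree P \<le> m - 1 \<longrightarrow>
    (\<exists>Z. continuous_on {-1..1} Z \<and> (\<forall>x\<in>{-1..1}. 0 \<le> Z x) \<and>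
      (\<forall>x\<in>{-1..1}. \<forall>\<xi>. \<bar>\<xi> - x\<bar> \<le> rho m x / (128 * exp 1) \<longrightarrow>
          (rho m x ^ r * \<bar>poly ((pderiv ^^ r) P) \<xi>\<bar>) powr p \<le> Z x) \<and>
      integral {-1..1} (\<lambda>x. Z x * avg_weight w m x)
        \<le> C * integral {-1..1} (\<lambda>y. \<bar>poly P y\<bar> powr p * avg_weight w m y))"
proof -
  \<comment> \<open>\<open>M\<close> depends on A and p only, so the resulting constant is uniform
    in the weight, the degree and the polynomial.\<close>
  obtain M :: nat where "(2 * real A + 5) / (2 * p) \<le> real M" using real_arch_simple by blast
  then have M: "2 * real A + 5 \<le> 2 * real M * p" using p by (simp add: field_simps)
  define C1 where "C1 = (fact r * 4 ^ M * exp (real (M + 1)) * (128 * exp 1) ^ r) powr p * (128 * exp (real (M + 1)))"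
  define C2 where "C2 = (9 / 4) ^ A * 16 powr (M * p) * 2 * pi"
  have C1: "0 < C1" by (simp add: C1_def)
  have C2: "0 < C2" by (simp add: C2_def)
  show ?thesis
  proof (intro exI[of _ "C1 * C2"] conjI allI impI; (elim conjE)?)
    show "0 < C1 * C2" using C1 C2 by simp
  next
    fix w m and P :: "real poly"
    assume w: "doubling_weight ((3 / 2) ^ A) w" and m: "1 \<le> m" and deg: "degree P \<le> m - 1"
    let ?K = "\<lambda>x y. (\<bar>poly P y\<bar> * poly (bump m x) y ^ M) powr p / rho m y"
    define Z where "Z = (\<lambda>x. C1 * integral {-1..1} (?K x))"
    have cK: "continuous_on ({-1..1} \<times> {-1..1}) (\<lambda>(x, y). ?K x y)"
      unfolding case_prod_unfold
    proof (intro continuous_on_divide continuous_on_powr' continuous_on_mult continuous_on_power continuous_on_const)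
      show "continuous_on ({-1..1} \<times> {-1..1}) (\<lambda>x. rho m (snd x))"
        by (rule continuous_on_compose2[OF continuous_on_rho[OF m, of UNIV] continuous_on_snd]) auto
      show "continuous_on ({-1..1} \<times> {-1..1}) (\<lambda>z. \<bar>poly P (snd z)\<bar>)"
        by (intro continuous_intros)
      show "continuous_on ({-1..1} \<times> {-1..1}) (\<lambda>z. poly (bump m (fst z)) (snd z))"
        by (rule continuous_on_bump)
      show "\<forall>z\<in>{-1..1} \<times> {-1..1}. rho m (snd z) \<noteq> 0"
        using rho_pos[OF m] by fastforce
      show "\<forall>z\<in>{-1..1} \<times> {-1..1}. 0 \<le> \<bar>poly P (snd z)\<bar> * poly (bump m (fst z)) (snd z) ^ M \<and>
          (\<bar>poly P (snd z)\<bar> * poly (bump m (fst z)) (snd z) ^ M = 0 \<longrightarrow> 0 < p)"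
        using bump_bounds(1) p by auto
    qed
    have cZ: "continuous_on {-1..1} Z"
      unfolding Z_def using integral_continuous_on_param[of "{-1..1}" "-1" 1 ?K] cK
      by (intro continuous_on_mult continuous_on_const) simp
    have Z0: "0 \<le> Z x" if x: "x \<in> {-1..1}" for x
    proof -
      have "continuous_on {-1..1} (\<lambda>y. case (x, y) of (x, y) \<Rightarrow> ?K x y)"
        by (rule continuous_on_compose2[OF cK, where f = "\<lambda>y. (x, y)"])
          (use x in \<open>auto intro!: continuous_on_Pair continuous_on_const continuous_on_id\<close>)
      then have "0 \<le> integral {-1..1} (?K x)"
        using less_imp_le[OF rho_pos[OF m]]
        by (intro Henstock_Kurzweil_Integration.integral_nonneg integrable_continuous_interval
            divide_nonneg_nonneg powr_ge_zero) simp_all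
      then show ?thesis using C1 by (simp add: Z_def)
    qed
    have loc: "(rho m x ^ r * \<bar>poly ((pderiv ^^ r) P) \<xi>\<bar>) powr p \<le> Z x"
      if "x \<in> {-1..1}" "\<bar>\<xi> - x\<bar> \<le> rho m x / (128 * exp 1)" for x \<xi>
      unfolding Z_def C1_def by (rule pderiv_local_bound[OF m deg p that])
    have cw: "continuous_on {-1..1} (avg_weight w m)" by (rule continuous_on_avg_weight[OF w m])
    have cB: "continuous_on {-1..1} (\<lambda>x. avg_weight w m x * (poly (bump m x) y ^ M) powr p)" if "y \<in> {-1..1}" for y
      using p bump_bounds(1)[OF _ that]
      by (intro continuous_on_mult cw continuous_on_powr' continuous_on_power continuous_on_const
          continuous_on_bump_left) auto
    have "integral {-1..1} (\<lambda>x. Z x * avg_weight w m x)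
      = C1 * integral {-1..1} (\<lambda>x. integral {-1..1} (\<lambda>y. ?K x y * avg_weight w m x))"
      by (simp only: Z_def mult.assoc integral_mult_left integral_mult_right)
    also have "integral {-1..1} (\<lambda>x. integral {-1..1} (\<lambda>y. ?K x y * avg_weight w m x))
      = integral {-1..1} (\<lambda>y. integral {-1..1} (\<lambda>x. ?K x y * avg_weight w m x))"
    proof -
      have "continuous_on ({-1..1} \<times> {-1..1}) (\<lambda>z. (case z of (x, y) \<Rightarrow> ?K x y) * avg_weight w m (fst z))"
        by (intro continuous_on_mult cK continuous_on_compose2[OF cw continuous_on_fst]) auto
      then have "continuous_on (cbox (-1, -1) (1, 1)) (\<lambda>(x, y). ?K x y * avg_weight w m x)"
        by (simp add: case_prod_unfold cbox_Pair_eq)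
      from integral_swap_continuous[OF this] show ?thesis by simp
    qed
    also have "\<dots> \<le> integral {-1..1} (\<lambda>y. C2 * (\<bar>poly P y\<bar> powr p * avg_weight w m y))"
    proof (rule integral_le)
      have "continuous_on ({-1..1} \<times> {-1..1}) (\<lambda>(y, x). ?K x y * avg_weight w m x)"
      proof -
        have "continuous_on ({-1..1} \<times> {-1..1}) (\<lambda>z. (case prod.swap z of (x, y) \<Rightarrow> ?K x y) * avg_weight w m (snd z))"
          by (intro continuous_on_mult continuous_on_compose2[OF cK] continuous_on_compose2[OF cw continuous_on_snd])
            (auto simp: continuous_on_swap)
        then show ?thesis by (simp add: case_prod_unfold)
      qed
      from integral_continuous_on_param[of "{-1..1}" "-1" 1 "\<lambda>y x. ?K x y * avg_weight w m x"] this
      show "(\<lambda>y. integral {-1..1} (\<lambda>x. ?K x y * avg_weight w m x)) integrable_on {-1..1}"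
        by (intro integrable_continuous_interval) simp
      show "(\<lambda>y. C2 * (\<bar>poly P y\<bar> powr p * avg_weight w m y)) integrable_on {-1..1}"
        using p by (intro integrable_continuous_interval continuous_on_mult cw continuous_on_powr' continuous_intros) auto
    next
      fix y :: real assume y: "y \<in> {-1..1}"
      have ry: "0 < rho m y" by (rule rho_pos[OF m y])
      have "integral {-1..1} (\<lambda>x. ?K x y * avg_weight w m x)
        = integral {-1..1} (\<lambda>x. (\<bar>poly P y\<bar> powr p / rho m y) * (avg_weight w m x * (poly (bump m x) y ^ M) powr p))"
        using bump_bounds(1)[OF _ y]
        by (intro Henstock_Kurzweil_Integration.integral_cong) (auto simp: powr_mult)
      also have "\<dots> = (\<bar>poly P y\<bar> powr p / rho m y) * integral {-1..1} (\<lambda>x. avg_weight w m x * (poly (bump m x) y ^ M) powr p)"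
        by (rule integral_mult_right)
      also have "\<dots> \<le> (\<bar>poly P y\<bar> powr p / rho m y) * (C2 * (avg_weight w m y * rho m y))"
        unfolding C2_def using ry by (intro mult_left_mono avg_weight_bump_integral[OF w m p(1) M y]) auto
      also have "\<dots> = C2 * (\<bar>poly P y\<bar> powr p * avg_weight w m y)" using ry by simp
      finally show "integral {-1..1} (\<lambda>x. ?K x y * avg_weight w m x) \<le> C2 * (\<bar>poly P y\<bar> powr p * avg_weight w m y)" .
    qed
    finally have "integral {-1..1} (\<lambda>x. Z x * avg_weight w m x)
        \<le> C1 * C2 * integral {-1..1} (\<lambda>y. \<bar>poly P y\<bar> powr p * avg_weight w m y)"
      using C1 by (simp add: mult.assoc)
    then show "\<exists>Z. continuous_on {-1..1} Z \<and> (\<forall>x\<in>{-1..1}. 0 \<le> Z x) \<and>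
      (\<forall>x\<in>{-1..1}. \<forall>\<xi>. \<bar>\<xi> - x\<bar> \<le> rho m x / (128 * exp 1) \<longrightarrow>
          (rho m x ^ r * \<bar>poly ((pderiv ^^ r) P) \<xi>\<bar>) powr p \<le> Z x) \<and>
      integral {-1..1} (\<lambda>x. Z x * avg_weight w m x)
        \<le> C1 * C2 * integral {-1..1} (\<lambda>y. \<bar>poly P y\<bar> powr p * avg_weight w m y)"
      using cZ Z0 loc by blast
  qed
qed

subsection \<open>Differences of arbitrary functions\<close>

text \<open>After division by the sum the claim reduces to u <= u^p for u in [0, 1]. This replaces
  the triangle inequality when p < 1.\<close>

lemma powr_add_le:
  fixes a b p :: real
  assumes "0 \<le> a" "0 \<le> b" "0 < p" "p \<le> 1"
  shows "(a + b) powr p \<le> a powr p + b powr p"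
proof (cases "a + b = 0")
  case False
  define s where "s = a + b"
  have s: "0 < s" using False assms by (simp add: s_def)
  have *: "s powr p * (c / s) \<le> c powr p" if "0 \<le> c" "c \<le> s" for c
  proof -
    have "c / s = (c / s) powr 1" using that s by simp
    also have "\<dots> \<le> (c / s) powr p" using that s assms by (intro powr_mono') auto
    finally have "s powr p * (c / s) \<le> s powr p * (c / s) powr p" by (intro mult_left_mono) auto
    also have "\<dots> = c powr p" using that s by (simp add: powr_mult[symmetric])
    finally show ?thesis .
  qed
  have "s powr p = s powr p * (a / s) + s powr p * (b / s)"
    using s by (simp add: s_def flip: distrib_left add_divide_distrib)
  also have "\<dots> \<le> a powr p + b powr p" using assms by (intro add_mono *) (auto simp: s_def)
  finally show ?thesis by (simp add: s_def)
qed (use assms in simp)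

lemma abs_sum_powr_le:
  fixes f :: "'a \<Rightarrow> real"
  assumes p: "0 < p" "p \<le> 1"
  shows "\<bar>sum f S\<bar> powr p \<le> (\<Sum>i\<in>S. \<bar>f i\<bar> powr p)"
proof (induction S rule: infinite_finite_induct)
  case (insert i S)
  have "\<bar>sum f (insert i S)\<bar> powr p \<le> (\<bar>f i\<bar> + \<bar>sum f S\<bar>) powr p"
    using insert p by (intro powr_mono2) auto
  also have "\<dots> \<le> \<bar>f i\<bar> powr p + \<bar>sum f S\<bar> powr p" using p by (intro powr_add_le) auto
  finally show ?case using insert by simp
qed (use p in auto)

text \<open>The points whose extreme nodes stay in [-1, 1] form a symmetric interval, found by
  squaring and cancelling 1 - |x|; the substitution can thus be made on one interval.\<close>

lemma phi_shift_domain: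
  assumes t: "0 \<le> t" "t < 1" and x: "\<bar>x\<bar> < 1"
  shows "t * phi x \<le> 1 - \<bar>x\<bar> \<longleftrightarrow> \<bar>x\<bar> \<le> (1 - t\<^sup>2) / (1 + t\<^sup>2)"
proof -
  have xm: "x \<in> {-1..1}" using x by auto
  have "t * phi x \<le> 1 - \<bar>x\<bar> \<longleftrightarrow> (t * phi x)\<^sup>2 \<le> (1 - \<bar>x\<bar>)\<^sup>2"
    using t x phi_nonneg[OF xm] by (intro power_mono_iff[symmetric]) auto
  also have "(t * phi x)\<^sup>2 = (1 - \<bar>x\<bar>) * (t\<^sup>2 * (1 + \<bar>x\<bar>))"
    by (simp add: power_mult_distrib phi_sq[OF xm] algebra_simps flip: power2_eq_square)
  also have "(1 - \<bar>x\<bar>)\<^sup>2 = (1 - \<bar>x\<bar>) * (1 - \<bar>x\<bar>)" by (simp add: power2_eq_square)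
  also have "(1 - \<bar>x\<bar>) * (t\<^sup>2 * (1 + \<bar>x\<bar>)) \<le> (1 - \<bar>x\<bar>) * (1 - \<bar>x\<bar>) \<longleftrightarrow> t\<^sup>2 * (1 + \<bar>x\<bar>) \<le> 1 - \<bar>x\<bar>"
    using x by (intro mult_le_cancel_left_pos) auto
  also have "\<dots> \<longleftrightarrow> \<bar>x\<bar> * (1 + t\<^sup>2) \<le> 1 - t\<^sup>2" by (auto simp: algebra_simps)
  also have "\<dots> \<longleftrightarrow> \<bar>x\<bar> \<le> (1 - t\<^sup>2) / (1 + t\<^sup>2)"
    by (subst pos_le_divide_eq) (auto intro: add_pos_nonneg)
  finally show ?thesis .
qed

lemma DERIV_phi:
  assumes "\<bar>x\<bar> < 1"
  shows "(phi has_real_derivative - x / phi x) (at x)"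
proof -
  have "0 < 1 - x\<^sup>2" using assms by (simp add: abs_square_less_1)
  moreover have "((\<lambda>x. 1 - x\<^sup>2) has_real_derivative - (2 * x)) (at x)"
    by (auto intro!: derivative_eq_intros)
  ultimately have "((\<lambda>x. sqrt (1 - x\<^sup>2)) has_real_derivative inverse (sqrt (1 - x\<^sup>2)) / 2 * - (2 * x)) (at x)"
    by (intro DERIV_chain2[OF DERIV_real_sqrt])
  moreover have "inverse (sqrt (1 - x\<^sup>2)) / 2 * - (2 * x) = - x / phi x"
    by (simp add: phi_def inverse_eq_divide)
  ultimately show ?thesis
    unfolding phi_def[abs_def] by (simp only:)
qed

text \<open>The derivative of \<open>phi\<close> is unbounded near the end points, but multiplying
  \<open>d\<close> by 1 + |x| gives t (1 + |x|) <= phi x, and 2 |x| <= 1 + |x| turns this into t |x|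
  <= phi x / 2.\<close>

lemma phi_shift_deriv:
  assumes t: "0 \<le> t" "t < 1" and c: "\<bar>c\<bar> \<le> t" and x: "\<bar>x\<bar> < 1" and d: "t * phi x \<le> 1 - \<bar>x\<bar>"
  shows "1 / 2 \<le> 1 - c * x / phi x"
proof -
  have xm: "x \<in> {-1..1}" using x by auto
  have x2: "x\<^sup>2 < 1" using x by (simp add: abs_square_less_1)
  then have ph: "0 < phi x" by (simp add: phi_def)
  have "phi x * (t * (1 + \<bar>x\<bar>)) \<le> (1 - \<bar>x\<bar>) * (1 + \<bar>x\<bar>)"
    using d mult_right_mono[OF d, of "1 + \<bar>x\<bar>"] by (simp add: mult_ac)
  also have "\<dots> = phi x * phi x" using phi_sq[OF xm] by (simp add: power2_eq_square algebra_simps flip: abs_mult)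
  finally have "t * (1 + \<bar>x\<bar>) \<le> phi x" using ph by (simp only: mult_le_cancel_left_pos)
  moreover have "t * \<bar>x\<bar> \<le> t * 1" using t x by (intro mult_left_mono) auto
  ultimately have 1: "t * \<bar>x\<bar> \<le> phi x / 2" by (simp add: algebra_simps)
  have "c * x \<le> \<bar>c\<bar> * \<bar>x\<bar>" by (metis abs_ge_self abs_mult)
  also have "\<dots> \<le> t * \<bar>x\<bar>" using c by (intro mult_right_mono) auto
  finally have "c * x / phi x \<le> (phi x / 2) / phi x" using 1 ph by (intro divide_right_mono) auto
  then show ?thesis using ph by simp
qed

text \<open>The Jacobian is at least 1/2 on \<open>D\<close>, hence the factor 2. The majorant
  \<open>H\<close> takes its integrability from the change of variables, so later integrals are
  compared with an integrable function.\<close>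

lemma set_integral_phi_shift:
  fixes G :: "real \<Rightarrow> real"
  assumes G: "set_integrable lebesgue {-1..1} G" and G0: "\<And>y. y \<in> {-1..1} \<Longrightarrow> 0 \<le> G y"
    and t: "0 \<le> t" "t < 1" and c: "\<bar>c\<bar> \<le> t"
    and D: "D = {x. \<bar>x\<bar> \<le> (1 - t\<^sup>2) / (1 + t\<^sup>2) \<and> \<bar>x\<bar> < 1}"
  shows "\<exists>H. integrable lebesgue H \<and> (\<forall>x. 0 \<le> H x) \<and> (\<forall>x\<in>D. G (x + c * phi x) \<le> H x) \<and>
    (LINT x|lebesgue. H x) \<le> 2 * (LINT x:{-1..1}|lebesgue. G x)"
proof (cases "t = 0")
  case True
  then have c0: "c = 0" using c by simp
  show ?thesis
  proof (intro exI[of _ "\<lambda>x. indicator {-1..1} x * G x"] conjI allI ballI)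
    show "integrable lebesgue (\<lambda>x. indicator {-1..1} x * G x)" using G by (simp add: set_integrable_def)
    show "0 \<le> indicator {-1..1} x * G x" for x using G0[of x] by (auto simp: indicator_def)
    show "G (x + c * phi x) \<le> indicator {-1..1} x * G x" if "x \<in> D" for x
      using that by (auto simp: c0 D indicator_def)
    have "0 \<le> (LINT x:{-1..1}|lebesgue. G x)"
      unfolding set_lebesgue_integral_def
      by (intro Bochner_Integration.integral_nonneg) (use G0 in \<open>auto simp: indicator_def\<close>)
    then show "(LINT x|lebesgue. indicator {-1..1} x * G x) \<le> 2 * (LINT x:{-1..1}|lebesgue. G x)"
      by (simp add: set_lebesgue_integral_def)
  qed
next
  case False
  \<comment> \<open>For t > 0 the set \<open>D\<close> is a compact interval away from the end
    points, where \<open>phi\<close> is not differentiable; this is why t = 0 is split off.\<close>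
  define a where "a = (1 - t\<^sup>2) / (1 + t\<^sup>2)"
  have tp: "0 < t\<^sup>2" using False by simp
  have a1: "a < 1" using tp by (simp add: a_def divide_less_eq add_pos_pos)
  have Da: "D = {-a..a}" using a1 by (auto simp: D a_def)
  define g where "g = (\<lambda>x. x + c * phi x)"
  define g' where "g' = (\<lambda>x. 1 - c * x / phi x)"
  have x1: "\<bar>x\<bar> < 1" "t * phi x \<le> 1 - \<bar>x\<bar>" if "x \<in> D" for x
    using that phi_shift_domain[OF t, of x] by (auto simp: D)
  have der: "(g has_real_derivative g' x) (at x)" if "x \<in> D" for x
    unfolding g_def g'_def using x1[OF that]
    by (auto intro!: derivative_eq_intros DERIV_phi)
  have g'2: "1 / 2 \<le> g' x" if "x \<in> D" for x
    unfolding g'_def using x1[OF that] by (intro phi_shift_deriv[OF t c])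
  have img: "g ` D \<subseteq> {-1..1}"
  proof
    fix y assume "y \<in> g ` D"
    then obtain x where x: "x \<in> D" "y = x + c * phi x" by (auto simp: g_def)
    have "x \<in> {-1..1}" using x1(1)[OF x(1)] by auto
    then have "0 \<le> phi x" by (rule phi_nonneg)
    then have "\<bar>c * phi x\<bar> \<le> t * phi x"
      using c by (simp add: abs_mult mult_right_mono)
    then show "y \<in> {-1..1}" using x x1[OF x(1)] by auto
  qed
  have inj: "inj_on g D"
  proof (rule linorder_inj_onI)
    fix x y assume xy: "x < y" "x \<in> D" "y \<in> D"
    have "g x < g y"
    proof (rule DERIV_pos_imp_increasing[OF xy(1)])
      fix z assume "x \<le> z" "z \<le> y"
      then have "z \<in> D" using xy by (auto simp: Da)
      then show "\<exists>d. (g has_real_derivative d) (at z) \<and> 0 < d" using der g'2 by (intro exI[of _ "g' z"]) fastforce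
    qed
    then show "g x \<noteq> g y" by simp
  qed (auto simp: Da)
  have "compact (g ` D)"
    unfolding Da g_def by (intro compact_continuous_image continuous_intros continuous_on_phi compact_Icc)
  then have gD: "g ` D \<in> sets lebesgue" by (simp add: borel_compact sets_completionI_sets)
  have GgD: "G absolutely_integrable_on (g ` D)" by (rule set_integrable_subset[OF G gD img])
  have cov: "(\<lambda>x. \<bar>g' x\<bar> * G (g x)) absolutely_integrable_on D \<and>
      integral D (\<lambda>x. \<bar>g' x\<bar> * G (g x)) = integral (g ` D) G"
    using has_absolute_integral_change_of_variables_1'[of D g g' G "integral (g ` D) G"] GgD inj
      DERIV_subset[OF der] by (auto simp: Da)
  have le: "integral (g ` D) G \<le> integral {-1..1} G"
    using img G0 set_lebesgue_integral_eq_integral(1)[OF GgD] set_lebesgue_integral_eq_integral(1)[OF G]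
    by (intro integral_subset_le) auto
  define H where "H = (\<lambda>x. 2 * (indicator D x * (\<bar>g' x\<bar> * G (g x))))"
  have int: "integrable lebesgue (\<lambda>x. indicator D x * (\<bar>g' x\<bar> * G (g x)))"
    using cov by (simp add: set_integrable_def)
  show ?thesis
  proof (intro exI[of _ H] conjI allI ballI)
    show "integrable lebesgue H" unfolding H_def using int by (rule integrable_mult_right)
    show "0 \<le> H x" for x
      using img G0 by (auto simp: H_def indicator_def)
    show "G (x + c * phi x) \<le> H x" if x: "x \<in> D" for x
    proof -
      have "g x \<in> {-1..1}" using img x by blast
      then have "0 \<le> G (g x)" by (rule G0)
      then have "1 * G (g x) \<le> (2 * \<bar>g' x\<bar>) * G (g x)" using g'2[OF x] by (intro mult_right_mono) auto
      then show ?thesis using x by (simp add: H_def g_def)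
    qed
    have "(LINT x|lebesgue. H x) = 2 * (LINT x|lebesgue. indicator D x * (\<bar>g' x\<bar> * G (g x)))"
      unfolding H_def by (rule integral_mult_right_zero)
    also have "\<dots> = 2 * (LINT x:D|lebesgue. \<bar>g' x\<bar> * G (g x))" by (simp add: set_lebesgue_integral_def)
    also have "\<dots> = 2 * integral (g ` D) G" using cov by (simp add: set_lebesgue_integral_eq_integral(2))
    also have "\<dots> \<le> 2 * (LINT x:{-1..1}|lebesgue. G x)" using le set_lebesgue_integral_eq_integral(2)[OF G] by simp
    finally show "(LINT x|lebesgue. H x) \<le> 2 * (LINT x:{-1..1}|lebesgue. G x)" .
  qed
qed

lemma sym_diff_forward:
  "sym_diff r h f x = (if x - real r * h / 2 \<in> {-1..1} \<and> x + real r * h / 2 \<in> {-1..1}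
      then forward_diff r h f (x - real r * h / 2) else 0)"
  by (simp add: sym_diff_def forward_diff_def)

text \<open>The alternating sum of the binomial coefficients is (1 - 1)^r. This settles the end
  points, where the step \<open>h * phi x\<close> is 0, and also constant functions.\<close>

lemma sym_diff_0: "1 \<le> r \<Longrightarrow> sym_diff r 0 f x = 0"
proof -
  assume r: "1 \<le> r"
  have "(\<Sum>i\<le>r. real (r choose i) * (-1) ^ (r - i)) = (1 + (-1)) ^ r"
    by (subst binomial_ring) simp
  then have "(\<Sum>i=0..r. real (r choose i) * (-1) ^ (r - i)) * f x = 0"
    using r by (simp add: atLeast0AtMost)
  then show ?thesis by (simp add: sym_diff_def sum_distrib_right)
qed

text \<open>Subadditivity leaves r + 1 shifted copies of g, with \<open>2 ^ r\<close> bounding the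
  binomial coefficients. Each shift is at most phi x / (8n), so \<open>avg_weight_near\<close> moves
  the weight to the shifted point at the cost \<open>2 * 9 ^ A\<close>; the substitution costs
  another 2.\<close>

lemma sym_diff_weighted_bound:
  assumes w: "doubling_weight ((3 / 2) ^ A) w" and n: "1 \<le> n" and p: "0 < p" "p \<le> 1" and r: "1 \<le> r"
    and h: "0 < h" "real r * h \<le> 1 / (4 * real n)"
    and g: "set_integrable lebesgue {-1..1} (\<lambda>x. \<bar>g x\<bar> powr p * avg_weight w n x)"
  shows "\<exists>H. integrable lebesgue H \<and> (\<forall>x. 0 \<le> H x) \<and>
    (\<forall>x\<in>{-1..1}. \<bar>sym_diff r (h * phi x) g x\<bar> powr p * avg_weight w n x \<le> H x) \<and>
    (LINT x|lebesgue. H x) \<le> real (r + 1) * 2 ^ r * (4 * 9 ^ A) * (LINT x:{-1..1}|lebesgue. \<bar>g x\<bar> powr p * avg_weight w n x)"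
proof -
  define t where "t = real r * h / 2"
  define G where "G = (\<lambda>x. \<bar>g x\<bar> powr p * avg_weight w n x)"
  define D where "D = {x. \<bar>x\<bar> \<le> (1 - t\<^sup>2) / (1 + t\<^sup>2) \<and> \<bar>x\<bar> < 1}"
  \<comment> \<open>The i-th node of the difference is \<open>x + c i * phi x\<close>.\<close>
  define c where "c = (\<lambda>i. (real i - real r / 2) * h)"
  have n1: "1 / (4 * real n) \<le> 1 / 4" using n by simp
  have t: "0 \<le> t" "t < 1" "t \<le> 1 / (8 * real n)" using h n1 by (auto simp: t_def)
  have ci: "\<bar>c i\<bar> \<le> t" if "i \<in> {0..r}" for i
  proof -
    have "real i \<le> real r" using that by simp
    then have "\<bar>real i - real r / 2\<bar> \<le> real r / 2" by linarith
    then have "\<bar>real i - real r / 2\<bar> * h \<le> real r / 2 * h" using h by (intro mult_right_mono) auto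
    then show ?thesis using h by (simp add: c_def t_def abs_mult)
  qed
  have G0: "0 \<le> G y" if "y \<in> {-1..1}" for y
    using avg_weight_nonneg[OF w n that] by (simp add: G_def)
  have "\<exists>H. integrable lebesgue H \<and> (\<forall>x. 0 \<le> H x) \<and> (\<forall>x\<in>D. G (x + c i * phi x) \<le> H x) \<and>
    (LINT x|lebesgue. H x) \<le> 2 * (LINT x:{-1..1}|lebesgue. G x)" if "i \<in> {0..r}" for i
    using g by (intro set_integral_phi_shift[OF _ G0 t(1,2) ci[OF that] D_def]) (simp_all add: G_def)
  then obtain H where H: "\<And>i. i \<in> {0..r} \<Longrightarrow> integrable lebesgue (H i)"
    "\<And>i x. i \<in> {0..r} \<Longrightarrow> 0 \<le> H i x" "\<And>i x. i \<in> {0..r} \<Longrightarrow> x \<in> D \<Longrightarrow> G (x + c i * phi x) \<le> H i x"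
    "\<And>i. i \<in> {0..r} \<Longrightarrow> (LINT x|lebesgue. H i x) \<le> 2 * (LINT x:{-1..1}|lebesgue. G x)"
    by metis
  define F where "F = (\<lambda>x. \<Sum>i=0..r. 2 ^ r * (2 * 9 ^ A) * H i x)"
  show ?thesis
  proof (intro exI[of _ F] conjI allI ballI)
    show "integrable lebesgue F" unfolding F_def using H(1) by auto
    show F0: "0 \<le> F x" for x unfolding F_def using H(2) by (intro sum_nonneg mult_nonneg_nonneg) auto
    fix x :: real assume x: "x \<in> {-1..1}"
    show "\<bar>sym_diff r (h * phi x) g x\<bar> powr p * avg_weight w n x \<le> F x"
    proof (cases "\<bar>x\<bar> < 1 \<and> x - t * phi x \<in> {-1..1} \<and> x + t * phi x \<in> {-1..1}")
      case False
      have "sym_diff r (h * phi x) g x = 0"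
      proof (cases "\<bar>x\<bar> < 1")
        case True
        then show ?thesis using False by (auto simp: sym_diff_def t_def mult.assoc)
      next
        case False
        then have "x = 1 \<or> x = -1" using x by auto
        then have "phi x = 0" by (auto simp: phi_def)
        then show ?thesis using sym_diff_0[OF r] by simp
      qed
      then show ?thesis using F0 p by simp
    next
      case True
      then have tx: "t * phi x \<le> 1 - \<bar>x\<bar>" by auto
      then have xD: "x \<in> D" using phi_shift_domain[OF t(1,2), of x] True by (simp add: D_def)
      have ph: "0 \<le> phi x" using phi_nonneg[OF x] .
      have pos: "x - real r * (h * phi x) / 2 + real i * (h * phi x) = x + c i * phi x" for i
        by (simp add: c_def algebra_simps)
      have near: "x + c i * phi x \<in> {-1..1}" "avg_weight w n x \<le> 2 * 9 ^ A * avg_weight w n (x + c i * phi x)"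
        if i: "i \<in> {0..r}" for i
      proof -
        have cp: "\<bar>c i * phi x\<bar> \<le> t * phi x" using ci[OF i] ph by (simp add: abs_mult mult_right_mono)
        then show y: "x + c i * phi x \<in> {-1..1}" using tx by auto
        have "t * phi x \<le> 1 / (8 * real n) * phi x" using t ph by (intro mult_right_mono)
        also have "\<dots> = phi x / real n / 8" by simp
        also have "\<dots> \<le> rho n x / 8" by (intro divide_right_mono phi_div_le_rho[OF n]) simp
        finally show "avg_weight w n x \<le> 2 * 9 ^ A * avg_weight w n (x + c i * phi x)"
          using cp by (intro avg_weight_near[OF w n x y]) simp
      qed
      have "\<bar>sym_diff r (h * phi x) g x\<bar> powr p \<le> \<bar>\<Sum>i=0..r. real (r choose i) * (-1) ^ (r - i) * g (x + c i * phi x)\<bar> powr p"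
        unfolding sym_diff_def pos using p by (intro powr_mono2) auto
      also have "\<dots> \<le> (\<Sum>i=0..r. \<bar>real (r choose i) * (-1) ^ (r - i) * g (x + c i * phi x)\<bar> powr p)"
        by (rule abs_sum_powr_le[OF p])
      also have "\<dots> \<le> (\<Sum>i=0..r. 2 ^ r * \<bar>g (x + c i * phi x)\<bar> powr p)"
      proof (rule sum_mono)
        fix i assume i: "i \<in> {0..r}"
        then have c1: "1 \<le> real (r choose i)" by (simp add: Suc_leI)
        have "real (r choose i) powr p \<le> real (r choose i) powr 1" using c1 p by (intro powr_mono) auto
        also have "\<dots> \<le> real (2 ^ r)" using binomial_le_pow2[of r i] c1 by (simp only: powr_one of_nat_le_iff)
        finally have "real (r choose i) powr p \<le> 2 ^ r" by simp
        then show "\<bar>real (r choose i) * (-1) ^ (r - i) * g (x + c i * phi x)\<bar> powr p \<le> 2 ^ r * \<bar>g (x + c i * phi x)\<bar> powr p"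
          by (simp add: abs_mult powr_mult mult_right_mono)
      qed
      finally have "\<bar>sym_diff r (h * phi x) g x\<bar> powr p * avg_weight w n x
        \<le> (\<Sum>i=0..r. 2 ^ r * \<bar>g (x + c i * phi x)\<bar> powr p) * avg_weight w n x"
        by (intro mult_right_mono avg_weight_nonneg[OF w n x])
      also have "\<dots> = (\<Sum>i=0..r. 2 ^ r * (\<bar>g (x + c i * phi x)\<bar> powr p * avg_weight w n x))"
        by (simp add: sum_distrib_right mult.assoc)
      also have "\<dots> \<le> F x"
        unfolding F_def
      proof (rule sum_mono)
        fix i assume i: "i \<in> {0..r}"
        have "\<bar>g (x + c i * phi x)\<bar> powr p * avg_weight w n x
          \<le> \<bar>g (x + c i * phi x)\<bar> powr p * (2 * 9 ^ A * avg_weight w n (x + c i * phi x))"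
          using near(2)[OF i] by (intro mult_left_mono) auto
        also have "\<dots> = 2 * 9 ^ A * G (x + c i * phi x)" by (simp add: G_def)
        also have "\<dots> \<le> 2 * 9 ^ A * H i x" using H(3)[OF i xD] by (intro mult_left_mono) auto
        finally show "2 ^ r * (\<bar>g (x + c i * phi x)\<bar> powr p * avg_weight w n x) \<le> 2 ^ r * (2 * 9 ^ A) * H i x"
          by (simp add: mult.assoc)
      qed
      finally show ?thesis .
    qed
  next
    have "(LINT x|lebesgue. F x) = (\<Sum>i=0..r. 2 ^ r * (2 * 9 ^ A) * (LINT x|lebesgue. H i x))"
      unfolding F_def using H(1) by (subst Bochner_Integration.integral_sum) auto
    also have "\<dots> \<le> (\<Sum>i=0..r. 2 ^ r * (2 * 9 ^ A) * (2 * (LINT x:{-1..1}|lebesgue. G x)))"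
      using H(4) by (intro sum_mono mult_left_mono) auto
    also have "\<dots> = real (r + 1) * 2 ^ r * (4 * 9 ^ A) * (LINT x:{-1..1}|lebesgue. G x)"
      by (simp add: algebra_simps)
    finally show "(LINT x|lebesgue. F x) \<le> real (r + 1) * 2 ^ r * (4 * 9 ^ A) * (LINT x:{-1..1}|lebesgue. \<bar>g x\<bar> powr p * avg_weight w n x)"
      by (simp add: G_def)
  qed
qed

subsection \<open>Best approximation and the weight class\<close>

text \<open>The p-th power of \<open>wnorm\<close>, which is the subadditive quantity for p <=
  1.\<close>

definition wpow :: "real \<Rightarrow> (real \<Rightarrow> real) \<Rightarrow> (real \<Rightarrow> real) \<Rightarrow> real" where
  "wpow p v g = (LINT x:{-1..1}|lebesgue. \<bar>g x\<bar> powr p * v x)"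

lemma wnorm_wpow: "wnorm p v g = wpow p v g powr (1 / p)"
  by (simp add: wnorm_def wpow_def)

lemma wpow_nonneg:
  assumes "\<And>x. x \<in> {-1..1} \<Longrightarrow> 0 \<le> v x"
  shows "0 \<le> wpow p v g"
  unfolding wpow_def set_lebesgue_integral_def
  by (intro Bochner_Integration.integral_nonneg) (use assms in \<open>auto simp: indicator_def\<close>)

lemma wnorm_powr:
  assumes "\<And>x. x \<in> {-1..1} \<Longrightarrow> 0 \<le> v x" "0 < p"
  shows "wnorm p v g powr p = wpow p v g"
  using wpow_nonneg[of v p g] assms by (simp add: wnorm_wpow powr_powr)

text \<open>For t = 0 and r = 0 the two sides would be \<open>1 powr p\<close> and
  \<open>0 powr 0 = 0\<close>.\<close>

lemma power_powr:
  fixes t :: real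
  assumes "0 \<le> t" "1 \<le> r"
  shows "(t ^ r) powr p = t powr (real r * p)"
  using assms by (cases "t = 0") (auto simp: powr_powr power_0_left simp flip: powr_realpow)

lemma poly_weight_integrable:
  assumes w: "doubling_weight L w" and n: "1 \<le> n" and p: "0 < p"
  shows "set_integrable lebesgue {-1..1} (\<lambda>x. \<bar>poly P x\<bar> powr p * avg_weight w n x)"
  using p
  by (intro absolutely_integrable_continuous_real continuous_on_mult continuous_on_avg_weight[OF w n]
      continuous_on_powr' continuous_intros) auto

lemma Lp_diff_poly_integrable:
  assumes w: "doubling_weight L w" and n: "1 \<le> n" and p: "0 < p" "p \<le> 1" and f: "f \<in> Lp p"
  shows "set_integrable lebesgue {-1..1} (\<lambda>x. \<bar>f x - poly P x\<bar> powr p * avg_weight w n x)"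
proof -
  let ?v = "avg_weight w n"
  have cv: "continuous_on {-1..1} ?v" by (rule continuous_on_avg_weight[OF w n])
  have "\<exists>y0\<in>{-1..1}. \<forall>y\<in>{-1..1}. ?v y \<le> ?v y0"
    by (rule continuous_attains_sup[OF _ _ cv]) auto
  then obtain B where B: "\<And>y. y \<in> {-1..1} \<Longrightarrow> ?v y \<le> B" by blast
  have v0: "0 \<le> ?v y" if "y \<in> {-1..1}" for y using avg_weight_nonneg[OF w n that] .
  have mf: "(\<lambda>x. indicator {-1..1} x *\<^sub>R f x) \<in> borel_measurable lebesgue"
    and intf: "set_integrable lebesgue {-1..1} (\<lambda>x. \<bar>f x\<bar> powr p)"
    using f by (auto simp: Lp_def set_borel_measurable_def)
  have mP: "poly P \<in> borel_measurable lebesgue"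
    using borel_measurable_continuous_onI[of "poly P"] continuous_on_poly[OF continuous_on_id, of UNIV P]
    by (intro measurable_completion) simp
  have mv: "(\<lambda>x. indicator {-1..1} x *\<^sub>R ?v x) \<in> borel_measurable lebesgue"
    using borel_measurable_continuous_on_indicator[OF _ cv] by (intro measurable_completion) simp
  have intP: "set_integrable lebesgue {-1..1} (\<lambda>x. \<bar>poly P x\<bar> powr p)"
    using p by (intro absolutely_integrable_continuous_real continuous_on_powr' continuous_intros) auto
  have dom: "set_integrable lebesgue {-1..1} (\<lambda>x. B * (\<bar>f x\<bar> powr p + \<bar>poly P x\<bar> powr p))"
    using intf intP by (intro set_integrable_mult_right set_integral_add(1)) auto
  show ?thesis
    unfolding set_integrable_def
  proof (rule Bochner_Integration.integrable_bound[OF dom[unfolded set_integrable_def]])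
    \<comment> \<open>Measurability is known on [-1, 1] only, so the indicator is put into
      \<open>f\<close> and the weight before they are combined.\<close>
    have "(\<lambda>x. \<bar>indicator {-1..1} x *\<^sub>R f x - poly P x\<bar> powr p * (indicator {-1..1} x *\<^sub>R ?v x)) \<in> borel_measurable lebesgue"
      using mf mP mv by measurable
    also have "(\<lambda>x. \<bar>indicator {-1..1} x *\<^sub>R f x - poly P x\<bar> powr p * (indicator {-1..1} x *\<^sub>R ?v x))
      = (\<lambda>x. indicator {-1..1} x *\<^sub>R (\<bar>f x - poly P x\<bar> powr p * ?v x))"
      by (auto simp: indicator_def fun_eq_iff)
    finally show "(\<lambda>x. indicator {-1..1} x *\<^sub>R (\<bar>f x - poly P x\<bar> powr p * ?v x)) \<in> borel_measurable lebesgue" .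
  next
    show "AE x in lebesgue. norm (indicator {-1..1} x *\<^sub>R (\<bar>f x - poly P x\<bar> powr p * ?v x))
        \<le> norm (indicator {-1..1} x *\<^sub>R (B * (\<bar>f x\<bar> powr p + \<bar>poly P x\<bar> powr p)))"
    proof (rule AE_I2)
      fix x :: real
      show "norm (indicator {-1..1} x *\<^sub>R (\<bar>f x - poly P x\<bar> powr p * ?v x))
        \<le> norm (indicator {-1..1} x *\<^sub>R (B * (\<bar>f x\<bar> powr p + \<bar>poly P x\<bar> powr p)))"
      proof (cases "x \<in> {-1..1}")
        case True
        have "\<bar>f x - poly P x\<bar> powr p \<le> (\<bar>f x\<bar> + \<bar>poly P x\<bar>) powr p" using p by (intro powr_mono2) auto
        also have "\<dots> \<le> \<bar>f x\<bar> powr p + \<bar>poly P x\<bar> powr p" using p by (intro powr_add_le) auto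
        finally have "\<bar>f x - poly P x\<bar> powr p * ?v x \<le> (\<bar>f x\<bar> powr p + \<bar>poly P x\<bar> powr p) * B"
          using B[OF True] v0[OF True] by (intro mult_mono) auto
        moreover have "0 \<le> \<bar>f x - poly P x\<bar> powr p * ?v x" using v0[OF True] by simp
        ultimately show ?thesis using True by (simp add: mult.commute)
      qed simp
    qed
  qed
qed

lemma wpow_mono_weight:
  assumes "set_integrable lebesgue {-1..1} (\<lambda>x. \<bar>g x\<bar> powr p * u x)"
    and "set_integrable lebesgue {-1..1} (\<lambda>x. \<bar>g x\<bar> powr p * v x)"
    and "\<And>x. x \<in> {-1..1} \<Longrightarrow> u x \<le> c * v x"
  shows "wpow p u g \<le> c * wpow p v g"
proof -
  have "wpow p u g \<le> (LINT x:{-1..1}|lebesgue. c * (\<bar>g x\<bar> powr p * v x))"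
    unfolding wpow_def
  proof (rule set_integral_mono)
    fix x :: real assume "x \<in> {-1..1}"
    then have "\<bar>g x\<bar> powr p * u x \<le> \<bar>g x\<bar> powr p * (c * v x)" using assms(3) by (intro mult_left_mono) auto
    then show "\<bar>g x\<bar> powr p * u x \<le> c * (\<bar>g x\<bar> powr p * v x)" by (simp add: mult_ac)
  qed (use assms in auto)
  then show ?thesis by (simp add: wpow_def)
qed

lemma wpow_diff_le:
  assumes p: "0 < p" "p \<le> 1" and v: "\<And>x. x \<in> {-1..1} \<Longrightarrow> 0 \<le> v x"
    and "set_integrable lebesgue {-1..1} (\<lambda>x. \<bar>f x\<bar> powr p * v x)"
    and "set_integrable lebesgue {-1..1} (\<lambda>x. \<bar>g x\<bar> powr p * v x)"
  shows "wpow p v (\<lambda>x. f x - g x) \<le> wpow p v f + wpow p v g"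
proof -
  have "wpow p v (\<lambda>x. f x - g x) \<le> (LINT x:{-1..1}|lebesgue. \<bar>f x\<bar> powr p * v x + \<bar>g x\<bar> powr p * v x)"
    unfolding wpow_def set_lebesgue_integral_def
  \<comment> \<open>\<open>integral_mono'\<close> asks for integrability of the larger function
    only.\<close>
  proof (rule integral_mono')
    show "integrable lebesgue (\<lambda>x. indicator {-1..1} x *\<^sub>R (\<bar>f x\<bar> powr p * v x + \<bar>g x\<bar> powr p * v x))"
      using set_integral_add(1)[OF assms(4,5)] by (simp add: set_integrable_def)
  next
    fix x :: real
    show "indicator {-1..1} x *\<^sub>R (\<bar>f x - g x\<bar> powr p * v x)
      \<le> indicator {-1..1} x *\<^sub>R (\<bar>f x\<bar> powr p * v x + \<bar>g x\<bar> powr p * v x)"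
    proof (cases "x \<in> {-1..1}")
      case True
      have "\<bar>f x - g x\<bar> powr p \<le> (\<bar>f x\<bar> + \<bar>g x\<bar>) powr p" using p by (intro powr_mono2) auto
      also have "\<dots> \<le> \<bar>f x\<bar> powr p + \<bar>g x\<bar> powr p" using p by (intro powr_add_le) auto
      finally show ?thesis using v[OF True] True by (simp add: mult_right_mono flip: distrib_right)
    qed simp
    show "0 \<le> indicator {-1..1} x *\<^sub>R (\<bar>f x\<bar> powr p * v x + \<bar>g x\<bar> powr p * v x)"
      using v[of x] by (auto simp: indicator_def)
  qed
  also have "\<dots> = wpow p v f + wpow p v g" unfolding wpow_def by (rule set_integral_add(2)[OF assms(4,5)])
  finally show ?thesis .
qed

lemma best_approx_le:
  assumes "degree P \<le> n - 1"
  shows "best_approx n f p v \<le> wnorm p v (\<lambda>x. f x - poly P x)"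
  unfolding best_approx_def
  by (rule cINF_lower) (use assms in \<open>auto intro!: bdd_belowI[of _ 0] simp: wnorm_def\<close>)

lemma best_approx_nonneg: "0 \<le> best_approx n f p v"
  unfolding best_approx_def
proof (rule cINF_greatest)
  have "degree (0 :: real poly) \<le> n - 1" by simp
  then show "{P :: real poly. degree P \<le> n - 1} \<noteq> {}" by blast
qed (simp add: wnorm_def)

text \<open>A slack stands in for attainment of the infimum; it is additive because the best error
  may be 0.\<close>

lemma near_best:
  assumes v: "\<And>x. x \<in> {-1..1} \<Longrightarrow> 0 \<le> v x" and p: "0 < p" and e: "0 < e"
  shows "\<exists>P :: real poly. degree P \<le> n - 1 \<and> wpow p v (\<lambda>x. f x - poly P x) \<le> best_approx n f p v powr p + e"
proof -
  let ?E = "best_approx n f p v"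
  have E: "0 \<le> ?E" by (rule best_approx_nonneg)
  have "?E = (?E powr p) powr (1 / p)" using E p by (simp add: powr_powr)
  also have "\<dots> < (?E powr p + e) powr (1 / p)" using p e by (intro powr_less_mono2) auto
  finally have less: "?E < (?E powr p + e) powr (1 / p)" .
  have "{P :: real poly. degree P \<le> n - 1} \<noteq> {}"
    by (metis (mono_tags, lifting) degree_0 empty_iff le0 mem_Collect_eq)
  then obtain P :: "real poly" where P: "degree P \<le> n - 1" "wnorm p v (\<lambda>x. f x - poly P x) < (?E powr p + e) powr (1 / p)"
    using cInf_lessD[of "(\<lambda>P. wnorm p v (\<lambda>x. f x - poly P x)) ` {P :: real poly. degree P \<le> n - 1}"] less
    unfolding best_approx_def[of n f p v] by blast
  have "wpow p v (\<lambda>x. f x - poly P x) = wnorm p v (\<lambda>x. f x - poly P x) powr p"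
    by (rule wnorm_powr[OF v p, symmetric])
  also have "\<dots> \<le> ((?E powr p + e) powr (1 / p)) powr p"
    using P(2) p by (intro powr_mono2) (auto simp: wnorm_def)
  also have "\<dots> = ?E powr p + e" using p e by (simp add: powr_powr add_nonneg_nonneg)
  finally show ?thesis using P(1) by blast
qed

text \<open>A competitor for \<open>k\<close> is one for \<open>K\<close>, and changing the scale of
  the weight costs a factor 4. The error at the top of a dyadic block is thereby controlled by every
  error in the block.\<close>

lemma best_approx_scale:
  assumes w: "doubling_weight L w" and k: "1 \<le> k" "k \<le> K" "K \<le> 2 * k" and p: "0 < p" "p \<le> 1" and f: "f \<in> Lp p"
  shows "best_approx K f p (avg_weight w K) powr p \<le> 4 * best_approx k f p (avg_weight w k) powr p"
proof (rule field_le_epsilon)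
  fix e :: real assume e: "0 < e"
  have K: "1 \<le> K" using k by simp
  obtain P :: "real poly" where P: "degree P \<le> k - 1"
    "wpow p (avg_weight w k) (\<lambda>x. f x - poly P x) \<le> best_approx k f p (avg_weight w k) powr p + e / 4"
    using near_best[of "avg_weight w k" p "e / 4" k f] avg_weight_nonneg[OF w k(1)] p e by auto
  have "best_approx K f p (avg_weight w K) powr p \<le> wnorm p (avg_weight w K) (\<lambda>x. f x - poly P x) powr p"
    using P(1) k p by (intro powr_mono2 best_approx_le best_approx_nonneg) auto
  also have "\<dots> = wpow p (avg_weight w K) (\<lambda>x. f x - poly P x)"
    by (rule wnorm_powr[OF avg_weight_nonneg[OF w K] p(1)])
  also have "\<dots> \<le> 4 * wpow p (avg_weight w k) (\<lambda>x. f x - poly P x)"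
    by (intro wpow_mono_weight Lp_diff_poly_integrable[OF w _ p f] avg_weight_scale[OF w] k K)
  finally show "best_approx K f p (avg_weight w K) powr p \<le> 4 * best_approx k f p (avg_weight w k) powr p + e"
    using P(2) by linarith
qed

text \<open>Raises the exponent of the class condition from \<gamma> to q, later r p: the surplus
  power of \<open>phi\<close> is at most the same power of m times \<open>rho m x\<close>, and the
  powers of m combine to q - \<delta>. Away from phi x = 0 the convention in \<open>phi_pow\<close>
  agrees with \<open>powr\<close>.\<close>

lemma weight_class_phi:
  assumes w: "doubling_weight L w" and cl: "w \<in> weight_class \<delta> \<gamma> \<Lambda>" and \<gamma>: "0 \<le> \<gamma>" "\<gamma> \<le> q" and \<Lambda>: "0 < \<Lambda>"
    and mn: "1 \<le> m" "m \<le> n" and x: "x \<in> {-1..1}"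
  shows "avg_weight w n x * phi x powr q
    \<le> \<Lambda> * real n powr \<delta> * real m powr (q - \<delta>) * rho m x powr q * avg_weight w m x"
proof (cases "phi x = 0")
  case True
  then show ?thesis using \<Lambda> avg_weight_nonneg[OF w mn(1) x] by simp
next
  case False
  then have ph: "0 < phi x" using phi_nonneg[OF x] by simp
  have rm: "0 < rho m x" by (rule rho_pos[OF mn(1) x])
  have pp: "phi_pow \<gamma> x = phi x powr \<gamma>" using ph by (simp add: phi_pow_def)
  have "avg_weight w n x * phi x powr q = (avg_weight w n x * phi x powr \<gamma>) * phi x powr (q - \<gamma>)"
    by (simp add: mult.assoc flip: powr_add)
  also have "\<dots> \<le> (\<Lambda> * real n powr \<delta> * real m powr (\<gamma> - \<delta>) * rho m x powr \<gamma> * avg_weight w m x) * (real m * rho m x) powr (q - \<gamma>)"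
  proof (rule mult_mono)
    show "avg_weight w n x * phi x powr \<gamma>
      \<le> \<Lambda> * real n powr \<delta> * real m powr (\<gamma> - \<delta>) * rho m x powr \<gamma> * avg_weight w m x"
      using cl mn x unfolding weight_class_def pp[symmetric] by auto
    show "phi x powr (q - \<gamma>) \<le> (real m * rho m x) powr (q - \<gamma>)"
      using ph \<gamma> phi_le_rho[OF mn(1)] by (intro powr_mono2) auto
  qed (use \<Lambda> avg_weight_nonneg[OF w mn(1) x] in auto)
  also have "\<dots> = \<Lambda> * real n powr \<delta> * (real m powr (\<gamma> - \<delta>) * real m powr (q - \<gamma>)) * (rho m x powr \<gamma> * rho m x powr (q - \<gamma>)) * avg_weight w m x"
    using rm by (simp add: powr_mult mult_ac)
  also have "\<dots> = \<Lambda> * real n powr \<delta> * real m powr (q - \<delta>) * rho m x powr q * avg_weight w m x"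
    by (simp flip: powr_add)
  finally show ?thesis .
qed

text \<open>\<open>C\<close> is chosen before \<open>\<Lambda>\<close>, which occurs only as an
  explicit factor beside the power of h; a later restriction on h can therefore remove it.\<close>

lemma poly_sym_diff_bound:
  fixes p :: real
  assumes p: "0 < p" "p \<le> 1" and r: "1 \<le> r"
  shows "\<exists>C>0. \<forall>\<Lambda>>0. \<forall>\<delta> \<gamma> w m n P h.
    doubling_weight ((3 / 2) ^ A) w \<and> w \<in> weight_class \<delta> \<gamma> \<Lambda> \<and> 0 \<le> \<gamma> \<and> \<gamma> \<le> real r * p \<and>
    1 \<le> m \<and> m \<le> n \<and> degree P \<le> m - 1 \<and> 0 < h \<and> h \<le> 1 / (64 * exp 1 * real r * real n) \<longrightarrow>
    (\<exists>H. integrable lebesgue H \<and> (\<forall>x. 0 \<le> H x) \<and>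
      (\<forall>x\<in>{-1..1}. \<bar>sym_diff r (h * phi x) (poly P) x\<bar> powr p * avg_weight w n x \<le> H x) \<and>
      (LINT x|lebesgue. H x) \<le> C * (\<Lambda> * h powr (real r * p) * real n powr \<delta> * real m powr (real r * p - \<delta>))
          * wpow p (avg_weight w m) (poly P))"
proof -
  obtain C where C: "0 < C" and CZ: "\<forall>w m P. doubling_weight ((3 / 2) ^ A) w \<and> 1 \<le> m \<and> degree P \<le> m - 1 \<longrightarrow>
    (\<exists>Z. continuous_on {-1..1} Z \<and> (\<forall>x\<in>{-1..1}. 0 \<le> Z x) \<and>
      (\<forall>x\<in>{-1..1}. \<forall>\<xi>. \<bar>\<xi> - x\<bar> \<le> rho m x / (128 * exp 1) \<longrightarrow>
          (rho m x ^ r * \<bar>poly ((pderiv ^^ r) P) \<xi>\<bar>) powr p \<le> Z x) \<and>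
      integral {-1..1} (\<lambda>x. Z x * avg_weight w m x)
        \<le> C * integral {-1..1} (\<lambda>y. \<bar>poly P y\<bar> powr p * avg_weight w m y))"
    using pderiv_weighted_bound[OF p, of A r] by (elim exE conjE) (rule that)
  show ?thesis
  proof (intro exI[of _ C] conjI allI impI C; (elim conjE)?)
    fix \<Lambda> \<delta> \<gamma> h :: real and w m n and P :: "real poly"
    assume \<Lambda>: "0 < \<Lambda>" and w: "doubling_weight ((3 / 2) ^ A) w" and cl: "w \<in> weight_class \<delta> \<gamma> \<Lambda>"
      and \<gamma>: "0 \<le> \<gamma>" "\<gamma> \<le> real r * p" and m: "1 \<le> m" "m \<le> n" and deg: "degree P \<le> m - 1"
      and h: "0 < h" "h \<le> 1 / (64 * exp 1 * real r * real n)"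
    define K where "K = \<Lambda> * h powr (real r * p) * real n powr \<delta> * real m powr (real r * p - \<delta>)"
    have K: "0 \<le> K" using \<Lambda> by (simp add: K_def)
    have n: "1 \<le> n" using m by simp
    obtain Z where Z: "continuous_on {-1..1} Z" "\<And>x. x \<in> {-1..1} \<Longrightarrow> 0 \<le> Z x"
      "\<And>x \<xi>. x \<in> {-1..1} \<Longrightarrow> \<bar>\<xi> - x\<bar> \<le> rho m x / (128 * exp 1) \<Longrightarrow>
          (rho m x ^ r * \<bar>poly ((pderiv ^^ r) P) \<xi>\<bar>) powr p \<le> Z x"
      "integral {-1..1} (\<lambda>x. Z x * avg_weight w m x)
        \<le> C * integral {-1..1} (\<lambda>y. \<bar>poly P y\<bar> powr p * avg_weight w m y)"
      using CZ[rule_format, OF conjI[OF w conjI[OF m(1) deg]]] by (elim exE conjE) (rule that, simp_all)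
    have wm0: "0 \<le> avg_weight w m x" if "x \<in> {-1..1}" for x using avg_weight_nonneg[OF w m(1) that] .
    define H where "H = (\<lambda>x. K * (indicator {-1..1} x * (Z x * avg_weight w m x)))"
    have H0: "0 \<le> H x" for x
      using K Z(2)[of x] wm0[of x] by (auto simp: H_def indicator_def)
    have intZ: "set_integrable lebesgue {-1..1} (\<lambda>x. Z x * avg_weight w m x)"
      by (intro absolutely_integrable_continuous_real continuous_on_mult Z(1) continuous_on_avg_weight[OF w m(1)])
    show "\<exists>H. integrable lebesgue H \<and> (\<forall>x. 0 \<le> H x) \<and>
      (\<forall>x\<in>{-1..1}. \<bar>sym_diff r (h * phi x) (poly P) x\<bar> powr p * avg_weight w n x \<le> H x) \<and>
      (LINT x|lebesgue. H x) \<le> C * (\<Lambda> * h powr (real r * p) * real n powr \<delta> * real m powr (real r * p - \<delta>))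
          * wpow p (avg_weight w m) (poly P)"
    proof (intro exI[of _ H] conjI allI ballI)
      show "integrable lebesgue H"
        unfolding H_def using intZ by (intro integrable_mult_right) (simp add: set_integrable_def)
      show "0 \<le> H x" for x by (rule H0)
      have "(LINT x|lebesgue. H x) = K * (LINT x:{-1..1}|lebesgue. Z x * avg_weight w m x)"
        by (simp add: H_def set_lebesgue_integral_def)
      also have "(LINT x:{-1..1}|lebesgue. Z x * avg_weight w m x) = integral {-1..1} (\<lambda>x. Z x * avg_weight w m x)"
        by (rule set_lebesgue_integral_eq_integral(2)[OF intZ])
      also have "K * \<dots> \<le> K * (C * integral {-1..1} (\<lambda>y. \<bar>poly P y\<bar> powr p * avg_weight w m y))"
        by (intro mult_left_mono Z(4) K)
      also have "integral {-1..1} (\<lambda>y. \<bar>poly P y\<bar> powr p * avg_weight w m y) = wpow p (avg_weight w m) (poly P)"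
        unfolding wpow_def by (rule set_lebesgue_integral_eq_integral(2)[OF poly_weight_integrable[OF w m(1) p(1)], symmetric])
      finally show "(LINT x|lebesgue. H x) \<le> C * (\<Lambda> * h powr (real r * p) * real n powr \<delta> * real m powr (real r * p - \<delta>))
          * wpow p (avg_weight w m) (poly P)"
        by (simp only: K_def mult_ac)
    next
      fix x :: real assume x: "x \<in> {-1..1}"
      have ph: "0 \<le> phi x" by (rule phi_nonneg[OF x])
      have rm: "0 < rho m x" by (rule rho_pos[OF m(1) x])
      show "\<bar>sym_diff r (h * phi x) (poly P) x\<bar> powr p * avg_weight w n x \<le> H x"
      proof (cases "x - real r * (h * phi x) / 2 \<in> {-1..1} \<and> x + real r * (h * phi x) / 2 \<in> {-1..1}")
        case False
        then show ?thesis using H0[of x] by (auto simp: sym_diff_def)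
      next
        case True
        define a where "a = x - real r * (h * phi x) / 2"
        \<comment> \<open>The constant 64 in the restriction on h is half of 128, because the nodes
          reach only r h phi x / 2 from the centre.\<close>
        have small: "real r * (h * phi x) / 2 \<le> rho m x / (128 * exp 1)"
        proof -
          have "real r * (h * phi x) / 2 = h * (real r * phi x / 2)" by simp
          also have "\<dots> \<le> 1 / (64 * exp 1 * real r * real n) * (real r * phi x / 2)"
            using h ph by (intro mult_right_mono) auto
          also have "\<dots> = phi x / real n / (128 * exp 1)" using r by simp
          also have "\<dots> \<le> rho m x / (128 * exp 1)"
            using phi_div_le_rho[OF n, of x] rho_antimono[OF m x] by (intro divide_right_mono) auto
          finally show ?thesis .
        qed
        have "\<bar>forward_diff r (h * phi x) (poly P) a\<bar> \<le> (h * phi x) ^ r * (Z x powr (1 / p) / rho m x ^ r)"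
        proof (rule forward_diff_poly_bound)
          show "0 \<le> h * phi x" using h ph by simp
          fix \<xi> assume "\<xi> \<in> {a..a + real r * (h * phi x)}"
          then have "\<bar>\<xi> - x\<bar> \<le> real r * (h * phi x) / 2"
            unfolding a_def atLeastAtMost_iff by argo
          then have "\<bar>\<xi> - x\<bar> \<le> rho m x / (128 * exp 1)" using small by linarith
          then have "(rho m x ^ r * \<bar>poly ((pderiv ^^ r) P) \<xi>\<bar>) powr p \<le> Z x" by (rule Z(3)[OF x])
          then have "((rho m x ^ r * \<bar>poly ((pderiv ^^ r) P) \<xi>\<bar>) powr p) powr (1 / p) \<le> Z x powr (1 / p)"
            using p by (intro powr_mono2) auto
          then have "rho m x ^ r * \<bar>poly ((pderiv ^^ r) P) \<xi>\<bar> \<le> Z x powr (1 / p)"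
            using p rm by (simp add: powr_powr)
          then show "\<bar>poly ((pderiv ^^ r) P) \<xi>\<bar> \<le> Z x powr (1 / p) / rho m x ^ r"
            using rm by (simp add: pos_le_divide_eq mult.commute)
        qed
        then have "\<bar>sym_diff r (h * phi x) (poly P) x\<bar> powr p \<le> ((h * phi x) ^ r * (Z x powr (1 / p) / rho m x ^ r)) powr p"
          using True p by (intro powr_mono2) (auto simp: sym_diff_forward a_def)
        also have "\<dots> = h powr (real r * p) * phi x powr (real r * p) * (Z x / rho m x powr (real r * p))"
        proof -
          have "((h * phi x) ^ r) powr p = h powr (real r * p) * phi x powr (real r * p)"
            using h ph by (simp add: power_powr[OF _ r] powr_mult)
          moreover have "(Z x powr (1 / p) / rho m x ^ r) powr p = Z x / rho m x powr (real r * p)"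
            using p rm Z(2)[OF x] power_powr[OF _ r, of "rho m x" p] by (simp add: powr_divide powr_powr)
          ultimately show ?thesis by (simp only: powr_mult)
        qed
        finally have "\<bar>sym_diff r (h * phi x) (poly P) x\<bar> powr p * avg_weight w n x
          \<le> (h powr (real r * p) * phi x powr (real r * p) * (Z x / rho m x powr (real r * p))) * avg_weight w n x"
          by (intro mult_right_mono avg_weight_nonneg[OF w n x])
        also have "\<dots> = (h powr (real r * p) * (Z x / rho m x powr (real r * p))) * (avg_weight w n x * phi x powr (real r * p))"
          by (simp only: mult_ac)
        also have "\<dots> \<le> (h powr (real r * p) * (Z x / rho m x powr (real r * p))) *
            (\<Lambda> * real n powr \<delta> * real m powr (real r * p - \<delta>) * rho m x powr (real r * p) * avg_weight w m x)"
          using Z(2)[OF x] by (intro mult_left_mono weight_class_phi[OF w cl \<gamma> \<Lambda> m x]) auto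
        \<comment> \<open>The powers of \<open>rho m x\<close> from the derivative bound and from
          the class condition cancel.\<close>
        also have "\<dots> = H x" using rm x by (simp add: H_def K_def)
        finally show ?thesis .
      qed
    qed
  qed
qed

subsection \<open>Telescoping over dyadic degrees\<close>

lemma sym_diff_add: "sym_diff r h (\<lambda>x. f x + g x) x = sym_diff r h f x + sym_diff r h g x"
  by (simp add: sym_diff_def sum.distrib distrib_left)

lemma sym_diff_const:
  assumes "1 \<le> r"
  shows "sym_diff r h (\<lambda>_. a) x = 0"
proof -
  have "sym_diff r 0 (\<lambda>_. a) 0 = 0" by (rule sym_diff_0[OF assms])
  then show ?thesis by (simp add: sym_diff_def)
qed

text \<open>The starting polynomial is constant, so its difference is 0 and only the increments
  remain.\<close>

lemma sym_diff_telescope: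
  assumes p: "0 < p" "p \<le> 1" and r: "1 \<le> r" and deg: "degree (P 0) = 0"
  shows "\<bar>sym_diff r h (poly (P N)) x\<bar> powr p \<le> (\<Sum>j<N. \<bar>sym_diff r h (poly (P (Suc j) - P j)) x\<bar> powr p)"
proof (induction N)
  case 0
  obtain a where "P 0 = [:a:]" using deg by (metis degree_eq_zeroE)
  then have "poly (P 0) = (\<lambda>_. a)" by auto
  then show ?case using p sym_diff_const[OF r] by simp
next
  case (Suc N)
  have "poly (P (Suc N)) = (\<lambda>x. poly (P N) x + poly (P (Suc N) - P N) x)" by auto
  then have "sym_diff r h (poly (P (Suc N))) x = sym_diff r h (poly (P N)) x + sym_diff r h (poly (P (Suc N) - P N)) x"
    using sym_diff_add by metis
  then have "\<bar>sym_diff r h (poly (P (Suc N))) x\<bar> powr p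
    \<le> (\<bar>sym_diff r h (poly (P N)) x\<bar> + \<bar>sym_diff r h (poly (P (Suc N) - P N)) x\<bar>) powr p"
    using p by (intro powr_mono2) auto
  also have "\<dots> \<le> \<bar>sym_diff r h (poly (P N)) x\<bar> powr p + \<bar>sym_diff r h (poly (P (Suc N) - P N)) x\<bar> powr p"
    using p by (intro powr_add_le) auto
  finally show ?case unfolding sum.lessThan_Suc using Suc.IH by linarith
qed

text \<open>For j = 0 the quotient \<open>2 ^ j div 2\<close> is 0, so the block is {1} and the
  blocks partition the positive integers.\<close>

definition dyadic_block :: "nat \<Rightarrow> nat set" where
  "dyadic_block j = {2 ^ j div 2<..2 ^ j}"

lemma finite_dyadic_block: "finite (dyadic_block j)"
  by (simp add: dyadic_block_def)

lemma sum_dyadic_blocks: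
  fixes g :: "nat \<Rightarrow> real"
  shows "(\<Sum>j\<le>N. \<Sum>k\<in>dyadic_block j. g k) = (\<Sum>k=1..2 ^ N. g k)"
proof (induction N)
  case 0
  have "dyadic_block 0 = {1}" by (auto simp: dyadic_block_def)
  then show ?case by simp
next
  case (Suc N)
  have "{1..2 ^ Suc N} = {1..2 ^ N} \<union> dyadic_block (Suc N)"
    by (auto simp: dyadic_block_def)
  moreover have "{1..2 ^ N} \<inter> dyadic_block (Suc N) = {}" by (auto simp: dyadic_block_def)
  ultimately have "(\<Sum>k=1..2 ^ Suc N. g k) = (\<Sum>k=1..2 ^ N. g k) + (\<Sum>k\<in>dyadic_block (Suc N). g k)"
    by (simp add: sum.union_disjoint finite_dyadic_block)
  then show ?case using Suc by simp
qed

text \<open>Averaging over the block, which has at least 2^j / 2 elements, turns one term into a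
  sum. The exponent q - \<delta> may be negative; since a / k lies in [1, 4], its power q - \<delta>
  is at most \<open>4 powr q\<close>, so the constant is free of \<delta>.\<close>

lemma dyadic_block_bound:
  fixes a q \<delta> E :: real
  assumes a: "2 ^ j \<le> a" "a \<le> 2 ^ Suc j" and "0 \<le> \<delta>" "0 \<le> q"
    and e0: "\<And>k. 0 \<le> e k" and e: "\<And>k. 1 \<le> k \<Longrightarrow> k \<le> 2 ^ j \<Longrightarrow> 2 ^ j \<le> 2 * k \<Longrightarrow> E \<le> 4 * e k"
  shows "a powr (q - \<delta>) * E \<le> 8 * 4 powr q * (\<Sum>k\<in>dyadic_block j. real k powr (q - \<delta> - 1) * e k)"
proof -
  let ?S = "\<Sum>k\<in>dyadic_block j. real k powr (q - \<delta> - 1) * e k"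
  have each: "a powr (q - \<delta>) * E \<le> (4 * 4 powr q * 2 ^ j) * (real k powr (q - \<delta> - 1) * e k)"
    if k: "k \<in> dyadic_block j" for k
  proof -
    have k1: "1 \<le> k" "k \<le> 2 ^ j" "2 ^ j \<le> 2 * k" using k by (auto simp: dyadic_block_def)
    have kr: "real k \<le> 2 ^ j" "2 ^ j \<le> 2 * real k"
      using k1(2,3) of_nat_le_iff[of k "2 ^ j", where 'a = real] of_nat_le_iff[of "2 ^ j" "2 * k", where 'a = real]
      by simp_all
    have "real k \<le> a" using kr(1) a(1) by (rule order_trans)
    moreover have "a \<le> 4 * real k" using a(2) kr(2) by simp
    ultimately have ak: "1 \<le> a / k" "a / k \<le> 4" using k1(1) by (simp_all add: le_divide_eq divide_le_eq)
    have a0: "0 \<le> a" using a(1) by (rule order_trans[rotated]) simp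
    have "a powr (q - \<delta>) = (a / k) powr (q - \<delta>) * real k powr (q - \<delta>)"
      using k1(1) by (subst powr_mult[symmetric]) simp
    also have "\<dots> \<le> 4 powr q * real k powr (q - \<delta>)"
    proof (rule mult_right_mono)
      have "(a / k) powr (q - \<delta>) \<le> (a / k) powr q" using ak assms by (intro powr_mono) auto
      also have "\<dots> \<le> 4 powr q" using ak assms by (intro powr_mono2) auto
      finally show "(a / k) powr (q - \<delta>) \<le> 4 powr q" .
    qed simp
    also have "real k powr (q - \<delta>) = real k * real k powr (q - \<delta> - 1)"
      using k1(1) powr_add[of "real k" 1 "q - \<delta> - 1"] by simp
    also have "4 powr q * \<dots> \<le> 4 powr q * (2 ^ j * real k powr (q - \<delta> - 1))"
      using kr by (intro mult_left_mono mult_right_mono) auto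
    finally have 1: "a powr (q - \<delta>) \<le> 4 powr q * (2 ^ j * real k powr (q - \<delta> - 1))" .
    have "a powr (q - \<delta>) * E \<le> a powr (q - \<delta>) * (4 * e k)" by (intro mult_left_mono e k1) simp
    also have "\<dots> \<le> (4 powr q * (2 ^ j * real k powr (q - \<delta> - 1))) * (4 * e k)"
      using e0 by (intro mult_right_mono 1) auto
    finally show ?thesis by (simp only: mult_ac)
  qed
  have "real (card (dyadic_block j)) * (a powr (q - \<delta>) * E) = (\<Sum>k\<in>dyadic_block j. a powr (q - \<delta>) * E)"
    by simp
  also have "\<dots> \<le> (\<Sum>k\<in>dyadic_block j. (4 * 4 powr q * 2 ^ j) * (real k powr (q - \<delta> - 1) * e k))"
    by (intro sum_mono each)
  also have "\<dots> = (4 * 4 powr q * 2 ^ j) * ?S" by (simp only: sum_distrib_left)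
  finally have 1: "real (card (dyadic_block j)) * (a powr (q - \<delta>) * E) \<le> (4 * 4 powr q * 2 ^ j) * ?S" .
  have S0: "0 \<le> ?S" using e0 by (intro sum_nonneg) auto
  show ?thesis
  \<comment> \<open>\<open>E\<close> carries no sign, and the lower bound for the cardinality may be
    multiplied only by a nonnegative number.\<close>
  proof (cases "0 \<le> a powr (q - \<delta>) * E")
    case True
    have "2 ^ j \<le> 2 * card (dyadic_block j)" by (simp add: dyadic_block_def)
    then have "real (2 ^ j) \<le> real (2 * card (dyadic_block j))" by (simp only: of_nat_le_iff)
    then have "2 ^ j / 2 * (a powr (q - \<delta>) * E) \<le> real (card (dyadic_block j)) * (a powr (q - \<delta>) * E)"
      using True by (intro mult_right_mono) auto
    also note 1
    finally have "2 ^ j * (a powr (q - \<delta>) * E) \<le> 2 ^ j * (8 * 4 powr q * ?S)" by (simp add: mult_ac)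
    then show ?thesis by (simp only: mult_le_cancel_left_pos zero_less_power zero_less_numeral)
  next
    case False
    moreover have "0 \<le> 8 * 4 powr q * ?S" using S0 by simp
    ultimately show ?thesis by linarith
  qed
qed

text \<open>The polynomial bound enters as an assumption for the given n and class parameters, so
  only its explicit factor \<open>\<Lambda>\<close> remains, and the size of h cancels that.\<close>

lemma wpow_sym_diff_bound:
  fixes p \<Lambda> :: real
  assumes p: "0 < p" "p \<le> 1" and r: "1 \<le> r" and q: "q = real r * p" and \<Lambda>: "0 < \<Lambda>"
    and Cb: "0 < Cb" "\<And>m n P h. 1 \<le> m \<Longrightarrow> m \<le> n \<Longrightarrow> degree P \<le> m - 1 \<Longrightarrow> 0 < h \<Longrightarrow> h \<le> 1 / (64 * exp 1 * real r * real n) \<Longrightarrow>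
      \<exists>H. integrable lebesgue H \<and> (\<forall>x. 0 \<le> H x) \<and>
        (\<forall>x\<in>{-1..1}. \<bar>sym_diff r (h * phi x) (poly P) x\<bar> powr p * avg_weight w n x \<le> H x) \<and>
        (LINT x|lebesgue. H x) \<le> Cb * (\<Lambda> * h powr q * real n powr \<delta> * real m powr (q - \<delta>))
            * wpow p (avg_weight w m) (poly P)"
    and w: "doubling_weight ((3 / 2) ^ A) w" and \<delta>: "0 \<le> \<delta>"
    and f: "f \<in> Lp p" and n: "1 \<le> n"
    and h: "0 < h" "h \<le> min (1 / (64 * exp 1 * real r)) (\<Lambda> powr (- 1 / q)) / real n"
  shows "wpow p (avg_weight w n) (\<lambda>x. sym_diff r (h * phi x) f x)
    \<le> (4 * (real (r + 1) * 2 ^ r * (4 * 9 ^ A)) + 8 * Cb) * (8 * 4 powr q) * real n powr (\<delta> - q) *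
      (\<Sum>k=1..n. real k powr (q - \<delta> - 1) * best_approx k f p (avg_weight w k) powr p)"
proof -
  define Ca where "Ca = real (r + 1) * 2 ^ r * (4 * 9 ^ A)"
  define e where "e = (\<lambda>k. best_approx k f p (avg_weight w k) powr p)"
  define S where "S = (\<Sum>k=1..n. real k powr (q - \<delta> - 1) * e k)"
  have q0: "0 < q" using p r by (simp add: q)
  have e0: "0 \<le> e k" for k by (simp add: e_def)
  have v0: "0 \<le> avg_weight w k x" if "1 \<le> k" "x \<in> {-1..1}" for k x
    using avg_weight_nonneg[OF w that] .
  obtain N where N: "2 ^ N \<le> n" "n < 2 ^ Suc N"
    using ex_power_ivl1[of 2 n] n by auto
  have pow1: "1 \<le> (2::nat) ^ j" for j by simp
  have h1: "h \<le> 1 / (64 * exp 1 * real r * real n)"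
  proof -
    have "h \<le> 1 / (64 * exp 1 * real r) / real n" using h(2) by (rule order_trans) (intro divide_right_mono, auto)
    then show ?thesis by (simp add: mult.assoc)
  qed
  have h2: "real r * h \<le> 1 / (4 * real n)"
  proof -
    have "real r * h \<le> real r * (1 / (64 * exp 1 * real r * real n))" using h1 by (intro mult_left_mono) auto
    also have "\<dots> = 1 / (64 * exp 1 * real n)" using r by simp
    also have "\<dots> \<le> 1 / (4 * real n)"
      using n exp_ge_add_one_self[of "1::real"] by (intro divide_left_mono mult_right_mono) auto
    finally show ?thesis .
  qed
  \<comment> \<open>Here the second bound on h acts, and \<open>\<Lambda>\<close> disappears from
    the constant.\<close>
  have hL: "\<Lambda> * h powr q * real n powr \<delta> \<le> real n powr (\<delta> - q)"
  proof -
    have "h \<le> \<Lambda> powr (- 1 / q) / real n" using h(2) by (rule order_trans) (intro divide_right_mono, auto)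
    then have "h powr q \<le> (\<Lambda> powr (- 1 / q) / real n) powr q" using h(1) q0 by (intro powr_mono2) auto
    also have "\<dots> = (1 / \<Lambda>) / real n powr q"
    proof -
      have "(\<Lambda> powr (- 1 / q)) powr q = 1 / \<Lambda>"
      proof -
        have "(\<Lambda> powr (- 1 / q)) powr q = \<Lambda> powr (- 1 / q * q)" by (rule powr_powr)
        also have "- 1 / q * q = - 1" using q0 by simp
        also have "\<Lambda> powr (- 1) = 1 / \<Lambda>" using \<Lambda> by (simp add: powr_minus_divide)
        finally show ?thesis .
      qed
      then show ?thesis by (simp only: powr_divide)
    qed
    finally have "\<Lambda> * h powr q \<le> \<Lambda> * ((1 / \<Lambda>) / real n powr q)" using \<Lambda> by (intro mult_left_mono) auto
    also have "\<dots> = 1 / real n powr q" using \<Lambda> by simp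
    finally have "\<Lambda> * h powr q * real n powr \<delta> \<le> 1 / real n powr q * real n powr \<delta>"
      by (intro mult_right_mono) auto
    also have "\<dots> = real n powr (\<delta> - q)" by (simp add: powr_diff)
    finally show ?thesis .
  qed
  define X where "X = 4 * Ca * e (2 ^ N) + (\<Sum>j<N. 8 * Cb * real n powr (\<delta> - q) * (real (2 ^ Suc j) powr (q - \<delta>) * e (2 ^ j)))"
  \<comment> \<open>\<open>Y\<close> collects the coefficients of the slack \<epsilon> of the
    near-best polynomials; it does not depend on \<epsilon>, so the slack can tend to 0.\<close>
  define Y where "Y = 4 * Ca + (\<Sum>j<N. 5 * Cb * real n powr (\<delta> - q) * real (2 ^ Suc j) powr (q - \<delta>))"
  have Ca: "0 \<le> Ca" by (simp add: Ca_def)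
  have Y0: "0 \<le> Y" unfolding Y_def using Ca Cb(1) by (intro add_nonneg_nonneg sum_nonneg) auto
  have approx: "wpow p (avg_weight w n) (\<lambda>x. sym_diff r (h * phi x) f x) \<le> X + \<epsilon> * Y" if \<epsilon>: "0 < \<epsilon>" for \<epsilon>
  proof -
    have "\<exists>P :: real poly. degree P \<le> 2 ^ j - 1 \<and> wpow p (avg_weight w (2 ^ j)) (\<lambda>x. f x - poly P x) \<le> e (2 ^ j) + \<epsilon>" for j
      unfolding e_def by (rule near_best[OF v0[OF pow1] p(1) \<epsilon>])
    then obtain P :: "nat \<Rightarrow> real poly" where P: "\<And>j. degree (P j) \<le> 2 ^ j - 1"
      "\<And>j. wpow p (avg_weight w (2 ^ j)) (\<lambda>x. f x - poly (P j) x) \<le> e (2 ^ j) + \<epsilon>" by metis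
    define Q where "Q = (\<lambda>j. P (Suc j) - P j)"
    have degQ: "degree (Q j) \<le> 2 ^ Suc j - 1" for j
    proof -
      have "degree (P j) \<le> 2 ^ Suc j - 1" using P(1)[of j] by (rule order_trans) simp
      then show ?thesis unfolding Q_def using P(1)[of "Suc j"] by (intro degree_diff_le)
    qed
    have le_n: "2 ^ Suc j \<le> n" if "j < N" for j
      using N(1) power_increasing[of "Suc j" N "2::nat"] that by linarith
    \<comment> \<open>8 = 4 + 4 and 5 = 4 + 1: moving the error of \<open>P j\<close> to the next
      scale costs a factor 4, and so does bounding the next best error by the present one.\<close>
    have Qb: "wpow p (avg_weight w (2 ^ Suc j)) (poly (Q j)) \<le> 8 * e (2 ^ j) + 5 * \<epsilon>" for j
    proof -
      have "poly (Q j) = (\<lambda>x. (f x - poly (P j) x) - (f x - poly (P (Suc j)) x))" by (auto simp: Q_def)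
      then have "wpow p (avg_weight w (2 ^ Suc j)) (poly (Q j))
        \<le> wpow p (avg_weight w (2 ^ Suc j)) (\<lambda>x. f x - poly (P j) x) + wpow p (avg_weight w (2 ^ Suc j)) (\<lambda>x. f x - poly (P (Suc j)) x)"
        using wpow_diff_le[OF p v0[OF pow1] Lp_diff_poly_integrable[OF w pow1 p f] Lp_diff_poly_integrable[OF w pow1 p f],
          of "Suc j" "P j" "P (Suc j)"] by simp
      also have "wpow p (avg_weight w (2 ^ Suc j)) (\<lambda>x. f x - poly (P j) x) \<le> 4 * wpow p (avg_weight w (2 ^ j)) (\<lambda>x. f x - poly (P j) x)"
        by (intro wpow_mono_weight Lp_diff_poly_integrable[OF w _ p f] avg_weight_scale[OF w]) auto
      also have "wpow p (avg_weight w (2 ^ j)) (\<lambda>x. f x - poly (P j) x) \<le> e (2 ^ j) + \<epsilon>" by (rule P(2))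
      also have "wpow p (avg_weight w (2 ^ Suc j)) (\<lambda>x. f x - poly (P (Suc j)) x) \<le> e (2 ^ Suc j) + \<epsilon>" by (rule P(2))
      also have "e (2 ^ Suc j) \<le> 4 * e (2 ^ j)"
        unfolding e_def by (rule best_approx_scale[OF w _ _ _ p f]) auto
      finally show ?thesis by simp
    qed
    have "\<exists>H. integrable lebesgue H \<and> (\<forall>x. 0 \<le> H x) \<and>
        (\<forall>x\<in>{-1..1}. \<bar>sym_diff r (h * phi x) (poly (Q j)) x\<bar> powr p * avg_weight w n x \<le> H x) \<and>
        (LINT x|lebesgue. H x) \<le> Cb * (\<Lambda> * h powr q * real n powr \<delta> * real (2 ^ Suc j) powr (q - \<delta>))
            * wpow p (avg_weight w (2 ^ Suc j)) (poly (Q j))" if "j < N" for j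
      by (rule Cb(2)[OF pow1 le_n[OF that] degQ h(1) h1])
    then obtain H where H: "\<And>j. j < N \<Longrightarrow> integrable lebesgue (H j)" "\<And>j x. j < N \<Longrightarrow> 0 \<le> H j x"
      "\<And>j x. j < N \<Longrightarrow> x \<in> {-1..1} \<Longrightarrow> \<bar>sym_diff r (h * phi x) (poly (Q j)) x\<bar> powr p * avg_weight w n x \<le> H j x"
      "\<And>j. j < N \<Longrightarrow> (LINT x|lebesgue. H j x) \<le> Cb * (\<Lambda> * h powr q * real n powr \<delta> * real (2 ^ Suc j) powr (q - \<delta>))
            * wpow p (avg_weight w (2 ^ Suc j)) (poly (Q j))"
      by metis
    obtain H0 where H0: "integrable lebesgue H0" "\<And>x. 0 \<le> H0 x"
      "\<And>x. x \<in> {-1..1} \<Longrightarrow> \<bar>sym_diff r (h * phi x) (\<lambda>x. f x - poly (P N) x) x\<bar> powr p * avg_weight w n x \<le> H0 x"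
      "(LINT x|lebesgue. H0 x) \<le> Ca * (LINT x:{-1..1}|lebesgue. \<bar>f x - poly (P N) x\<bar> powr p * avg_weight w n x)"
      using sym_diff_weighted_bound[OF w n p r h(1) h2 Lp_diff_poly_integrable[OF w n p f, of "P N"]]
      unfolding Ca_def by blast
    have "wpow p (avg_weight w n) (\<lambda>x. sym_diff r (h * phi x) f x) \<le> (LINT x|lebesgue. H0 x + (\<Sum>j<N. H j x))"
      unfolding wpow_def set_lebesgue_integral_def
    proof (rule integral_mono')
      show "integrable lebesgue (\<lambda>x. H0 x + (\<Sum>j<N. H j x))"
        using H0(1) H(1) by (intro Bochner_Integration.integrable_add Bochner_Integration.integrable_sum) auto
      show HH: "0 \<le> H0 x + (\<Sum>j<N. H j x)" for x
        using H0(2) H(2) by (intro add_nonneg_nonneg sum_nonneg) auto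
      fix x :: real
      show "indicator {-1..1} x *\<^sub>R (\<bar>sym_diff r (h * phi x) f x\<bar> powr p * avg_weight w n x) \<le> H0 x + (\<Sum>j<N. H j x)"
      proof (cases "x \<in> {-1..1}")
        case True
        let ?D = "\<lambda>g. \<bar>sym_diff r (h * phi x) g x\<bar> powr p"
        have "f = (\<lambda>x. (f x - poly (P N) x) + poly (P N) x)" by auto
        then have "sym_diff r (h * phi x) f x
          = sym_diff r (h * phi x) (\<lambda>x. f x - poly (P N) x) x + sym_diff r (h * phi x) (poly (P N)) x"
          using sym_diff_add[of r "h * phi x" "\<lambda>x. f x - poly (P N) x" "poly (P N)" x] by simp
        then have "?D f \<le> (\<bar>sym_diff r (h * phi x) (\<lambda>x. f x - poly (P N) x) x\<bar> + \<bar>sym_diff r (h * phi x) (poly (P N)) x\<bar>) powr p"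
          using p by (intro powr_mono2) auto
        also have "\<dots> \<le> ?D (\<lambda>x. f x - poly (P N) x) + ?D (poly (P N))" using p by (intro powr_add_le) auto
        \<comment> \<open>\<open>P 0\<close> has degree at most 2^0 - 1 = 0, as the telescoping
          requires.\<close>
        also have "?D (poly (P N)) \<le> (\<Sum>j<N. ?D (poly (Q j)))"
          unfolding Q_def using P(1)[of 0] by (intro sym_diff_telescope p r) simp
        finally have "?D f * avg_weight w n x \<le> (?D (\<lambda>x. f x - poly (P N) x) + (\<Sum>j<N. ?D (poly (Q j)))) * avg_weight w n x"
          using v0[OF n True] by (intro mult_right_mono) auto
        also have "\<dots> = ?D (\<lambda>x. f x - poly (P N) x) * avg_weight w n x + (\<Sum>j<N. ?D (poly (Q j)) * avg_weight w n x)"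
          by (simp only: distrib_right sum_distrib_right)
        also have "\<dots> \<le> H0 x + (\<Sum>j<N. H j x)"
          by (intro add_mono sum_mono H0(3) H(3) True) auto
        finally show ?thesis using True by simp
      next
        case False
        then show ?thesis using HH[of x] by simp
      qed
    qed
    also have "\<dots> = (LINT x|lebesgue. H0 x) + (LINT x|lebesgue. (\<Sum>j<N. H j x))"
      using H0(1) H(1) by (intro Bochner_Integration.integral_add Bochner_Integration.integrable_sum) auto
    also have "(LINT x|lebesgue. (\<Sum>j<N. H j x)) = (\<Sum>j<N. LINT x|lebesgue. H j x)"
      using H(1) by (intro Bochner_Integration.integral_sum) auto
    also have "(LINT x|lebesgue. H0 x) \<le> 4 * Ca * e (2 ^ N) + \<epsilon> * (4 * Ca)"
    proof -
      have "(LINT x|lebesgue. H0 x) \<le> Ca * wpow p (avg_weight w n) (\<lambda>x. f x - poly (P N) x)"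
        using H0(4) by (simp only: wpow_def)
      also have "\<dots> \<le> Ca * (4 * (e (2 ^ N) + \<epsilon>))"
      proof (rule mult_left_mono[OF _ Ca])
        have "wpow p (avg_weight w n) (\<lambda>x. f x - poly (P N) x) \<le> 4 * wpow p (avg_weight w (2 ^ N)) (\<lambda>x. f x - poly (P N) x)"
          using N n by (intro wpow_mono_weight Lp_diff_poly_integrable[OF w _ p f] avg_weight_scale[OF w]) auto
        then show "wpow p (avg_weight w n) (\<lambda>x. f x - poly (P N) x) \<le> 4 * (e (2 ^ N) + \<epsilon>)"
          by (rule order_trans) (intro mult_left_mono P(2), simp)
      qed
      finally show ?thesis by (simp add: algebra_simps)
    qed
    also have "(\<Sum>j<N. LINT x|lebesgue. H j x)
      \<le> (\<Sum>j<N. 8 * Cb * real n powr (\<delta> - q) * (real (2 ^ Suc j) powr (q - \<delta>) * e (2 ^ j))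
          + \<epsilon> * (5 * Cb * real n powr (\<delta> - q) * real (2 ^ Suc j) powr (q - \<delta>)))"
    proof (rule sum_mono)
      fix j assume "j \<in> {..<N}"
      then have j: "j < N" by simp
      have "(LINT x|lebesgue. H j x) \<le> Cb * (\<Lambda> * h powr q * real n powr \<delta> * real (2 ^ Suc j) powr (q - \<delta>))
            * wpow p (avg_weight w (2 ^ Suc j)) (poly (Q j))" by (rule H(4)[OF j])
      also have "\<dots> \<le> Cb * (real n powr (\<delta> - q) * real (2 ^ Suc j) powr (q - \<delta>)) * (8 * e (2 ^ j) + 5 * \<epsilon>)"
        using Cb(1) \<Lambda> wpow_nonneg[OF v0[OF pow1[of "Suc j"]]]
        by (intro mult_mono mult_left_mono mult_right_mono hL Qb mult_nonneg_nonneg) auto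
      finally show "(LINT x|lebesgue. H j x) \<le> 8 * Cb * real n powr (\<delta> - q) * (real (2 ^ Suc j) powr (q - \<delta>) * e (2 ^ j))
          + \<epsilon> * (5 * Cb * real n powr (\<delta> - q) * real (2 ^ Suc j) powr (q - \<delta>))"
        by (simp only: distrib_left mult_ac)
    qed
    finally show ?thesis
      by (simp add: X_def Y_def sum.distrib sum_distrib_left distrib_left add_ac)
  qed
  have "wpow p (avg_weight w n) (\<lambda>x. sym_diff r (h * phi x) f x) \<le> X"
  proof (rule field_le_epsilon)
    fix \<epsilon> :: real assume \<epsilon>: "0 < \<epsilon>"
    have "wpow p (avg_weight w n) (\<lambda>x. sym_diff r (h * phi x) f x) \<le> X + \<epsilon> / (Y + 1) * Y"
      using \<epsilon> Y0 by (intro approx) simp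
    also have "\<epsilon> / (Y + 1) * Y \<le> \<epsilon>" using \<epsilon> Y0 by (simp add: field_simps)
    finally show "wpow p (avg_weight w n) (\<lambda>x. sym_diff r (h * phi x) f x) \<le> X + \<epsilon>" by simp
  qed
  also have "X \<le> (4 * Ca + 8 * Cb) * (8 * 4 powr q) * real n powr (\<delta> - q) * S"
  proof -
    let ?g = "\<lambda>k. real k powr (q - \<delta> - 1) * e k"
    let ?T = "\<lambda>j. \<Sum>k\<in>dyadic_block j. ?g k"
    \<comment> \<open>Applied with a = n for j = N, and with \<open>a = 2 ^ Suc j\<close>, the upper
      end of the range, for j < N.\<close>
    have blk: "a powr (q - \<delta>) * e (2 ^ j) \<le> 8 * 4 powr q * ?T j" if "2 ^ j \<le> a" "a \<le> 2 ^ Suc j" for a :: real and j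
    proof (rule dyadic_block_bound[OF that \<delta> _ e0])
      fix k :: nat assume "1 \<le> k" "k \<le> 2 ^ j" "2 ^ j \<le> 2 * k"
      then show "e (2 ^ j) \<le> 4 * e k" unfolding e_def by (intro best_approx_scale[OF w _ _ _ p f])
    qed (use q0 in simp)
    have T0: "0 \<le> ?T j" for j using e0 by (intro sum_nonneg) auto
    have all: "(\<Sum>j\<le>N. ?T j) \<le> S"
      unfolding S_def sum_dyadic_blocks using N(1) e0 by (intro sum_mono2) auto
    have TN: "?T N \<le> S" and Tl: "(\<Sum>j<N. ?T j) \<le> S"
    proof -
      have "(\<Sum>j\<le>N. ?T j) = (\<Sum>j<N. ?T j) + ?T N" by (simp add: lessThan_Suc_atMost[symmetric])
      moreover have "0 \<le> (\<Sum>j<N. ?T j)" by (rule sum_nonneg) (rule T0)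
      ultimately show "?T N \<le> S" "(\<Sum>j<N. ?T j) \<le> S" using all T0[of N] by argo+
    qed
    let ?K = "8 * 4 powr q * real n powr (\<delta> - q)"
    have nn: "real n powr (\<delta> - q) * real n powr (q - \<delta>) = 1" using n by (simp flip: powr_add)
    have "e (2 ^ N) = real n powr (\<delta> - q) * (real n powr (q - \<delta>) * e (2 ^ N))"
      using nn by (simp flip: mult.assoc)
    also have "\<dots> \<le> real n powr (\<delta> - q) * (8 * 4 powr q * ?T N)"
    proof (intro mult_left_mono blk)
      show "2 ^ N \<le> real n" using N(1) of_nat_le_iff[of "2 ^ N" n, where 'a = real] by simp
      show "real n \<le> 2 ^ Suc N" using N(2) of_nat_less_iff[of n "2 ^ Suc N", where 'a = real] by simp
    qed simp
    also have "\<dots> \<le> real n powr (\<delta> - q) * (8 * 4 powr q * S)" using TN by (intro mult_left_mono) auto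
    finally have "4 * Ca * e (2 ^ N) \<le> 4 * Ca * (real n powr (\<delta> - q) * (8 * 4 powr q * S))"
      using Ca by (intro mult_left_mono) auto
    moreover have "(\<Sum>j<N. 8 * Cb * real n powr (\<delta> - q) * (real (2 ^ Suc j) powr (q - \<delta>) * e (2 ^ j)))
      \<le> 8 * Cb * (real n powr (\<delta> - q) * (8 * 4 powr q * S))"
    proof -
      have "(\<Sum>j<N. 8 * Cb * real n powr (\<delta> - q) * (real (2 ^ Suc j) powr (q - \<delta>) * e (2 ^ j)))
        \<le> (\<Sum>j<N. 8 * Cb * real n powr (\<delta> - q) * (8 * 4 powr q * ?T j))"
        using Cb(1) by (intro sum_mono mult_left_mono blk) auto
      also have "\<dots> = 8 * Cb * real n powr (\<delta> - q) * (8 * 4 powr q * (\<Sum>j<N. ?T j))"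
        by (simp only: sum_distrib_left)
      also have "\<dots> \<le> 8 * Cb * real n powr (\<delta> - q) * (8 * 4 powr q * S)"
        using Cb(1) Tl by (intro mult_left_mono) auto
      finally show ?thesis by (simp only: mult.assoc)
    qed
    ultimately have "X \<le> 4 * Ca * (real n powr (\<delta> - q) * (8 * 4 powr q * S)) + 8 * Cb * (real n powr (\<delta> - q) * (8 * 4 powr q * S))"
      unfolding X_def by (rule add_mono)
    also have "\<dots> = (4 * Ca + 8 * Cb) * (8 * 4 powr q) * real n powr (\<delta> - q) * S"
      by (simp only: distrib_left distrib_right mult_ac)
    finally show ?thesis .
  qed
  finally show ?thesis by (simp only: Ca_def S_def e_def)
qed

theorem theorem7p9:
  fixes p L :: real and r :: nat
  assumes "0 < p" and "p < 1" and "1 \<le> r"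
  shows "\<exists>c>0. \<forall>\<Lambda>>0. \<exists>\<theta>>0. \<forall>\<delta>\<ge>0. \<forall>\<gamma>\<ge>0. \<forall>w.
           doubling_weight L w \<and> w \<in> weight_class \<delta> \<gamma> \<Lambda> \<and> \<gamma> \<le> real r * p \<longrightarrow>
           (\<forall>f\<in>Lp p. \<forall>n\<ge>1.
              modulus_phi r f (\<theta> / real n) p (avg_weight w n)
                \<le> c / real n powr (real r - \<delta> / p) *
                   (\<Sum>k=1..n. real k powr (real r * p - \<delta> - 1) *
                      best_approx k f p (avg_weight w k) powr p) powr (1 / p))"
proof -
  define q where "q = real r * p"
  have q0: "0 < q" and p1: "p \<le> 1" using assms by (simp_all add: q_def)
  \<comment> \<open>\<open>mass_growth\<close> works with a doubling constant of the form
    \<open>(3 / 2) ^ A\<close>; here A depends on \<open>L\<close> only.\<close>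
  obtain A :: nat where "L < (3 / 2) ^ A" using real_arch_pow[of "3 / 2" L] by auto
  then have A: "L \<le> (3 / 2) ^ A" by simp
  obtain Cb where Cb: "0 < Cb" and bound: "\<forall>\<Lambda>>0. \<forall>\<delta> \<gamma> w m n P h.
    doubling_weight ((3 / 2) ^ A) w \<and> w \<in> weight_class \<delta> \<gamma> \<Lambda> \<and> 0 \<le> \<gamma> \<and> \<gamma> \<le> real r * p \<and>
    1 \<le> m \<and> m \<le> n \<and> degree P \<le> m - 1 \<and> 0 < h \<and> h \<le> 1 / (64 * exp 1 * real r * real n) \<longrightarrow>
    (\<exists>H. integrable lebesgue H \<and> (\<forall>x. 0 \<le> H x) \<and>
      (\<forall>x\<in>{-1..1}. \<bar>sym_diff r (h * phi x) (poly P) x\<bar> powr p * avg_weight w n x \<le> H x) \<and>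
      (LINT x|lebesgue. H x) \<le> Cb * (\<Lambda> * h powr (real r * p) * real n powr \<delta> * real m powr (real r * p - \<delta>))
          * wpow p (avg_weight w m) (poly P))"
    using poly_sym_diff_bound[OF assms(1) p1 assms(3), of A] by (elim exE conjE) (rule that)
  define C where "C = (4 * (real (r + 1) * 2 ^ r * (4 * 9 ^ A)) + 8 * Cb) * (8 * 4 powr q)"
  have C: "0 < C" unfolding C_def using Cb by (intro mult_pos_pos add_nonneg_pos) auto
  show ?thesis
  proof (rule exI[of _ "C powr (1 / p)"], intro conjI allI impI)
    show "0 < C powr (1 / p)" using C by simp
    fix \<Lambda> :: real assume \<Lambda>: "0 < \<Lambda>"
    \<comment> \<open>The first entry keeps the nodes within the radius of
      \<open>pderiv_local_bound\<close>; the second makes \<open>\<Lambda> * \<theta> powr q\<close>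
      at most 1.\<close>
    define \<theta> where "\<theta> = min (1 / (64 * exp 1 * real r)) (\<Lambda> powr (- 1 / q))"
    have \<theta>: "0 < \<theta>" using assms(3) \<Lambda> by (simp add: \<theta>_def)
    show "\<exists>\<theta>>0. \<forall>\<delta>\<ge>0. \<forall>\<gamma>\<ge>0. \<forall>w.
           doubling_weight L w \<and> w \<in> weight_class \<delta> \<gamma> \<Lambda> \<and> \<gamma> \<le> real r * p \<longrightarrow>
           (\<forall>f\<in>Lp p. \<forall>n\<ge>1.
              modulus_phi r f (\<theta> / real n) p (avg_weight w n)
                \<le> C powr (1 / p) / real n powr (real r - \<delta> / p) *
                   (\<Sum>k=1..n. real k powr (real r * p - \<delta> - 1) *
                      best_approx k f p (avg_weight w k) powr p) powr (1 / p))"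
    proof (rule exI[of _ \<theta>], intro conjI allI impI ballI; (elim conjE)?)
      show "0 < \<theta>" by (rule \<theta>)
      fix \<delta> \<gamma> :: real and w f :: "real \<Rightarrow> real" and n :: nat
      assume \<delta>: "0 \<le> \<delta>" and \<gamma>: "0 \<le> \<gamma>" "\<gamma> \<le> real r * p" and wL: "doubling_weight L w"
        and cl: "w \<in> weight_class \<delta> \<gamma> \<Lambda>" and f: "f \<in> Lp p" and n: "1 \<le> n"
      have w: "doubling_weight ((3 / 2) ^ A) w" by (rule doubling_weight_mono[OF wL A])
      define S where "S = (\<Sum>k=1..n. real k powr (q - \<delta> - 1) * best_approx k f p (avg_weight w k) powr p)"
      have S0: "0 \<le> S" unfolding S_def by (intro sum_nonneg) simp
      have "modulus_phi r f (\<theta> / real n) p (avg_weight w n) \<le> (C * real n powr (\<delta> - q) * S) powr (1 / p)"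
        unfolding modulus_phi_def
      proof (rule cSUP_least)
        show "{0<..\<theta> / real n} \<noteq> {}" using \<theta> n by simp
        fix h assume "h \<in> {0<..\<theta> / real n}"
        then have h: "0 < h" "h \<le> min (1 / (64 * exp 1 * real r)) (\<Lambda> powr (- 1 / q)) / real n"
          by (simp_all add: \<theta>_def)
        have "wpow p (avg_weight w n) (\<lambda>x. sym_diff r (h * phi x) f x) \<le> C * real n powr (\<delta> - q) * S"
          unfolding C_def S_def
        proof (rule wpow_sym_diff_bound[OF assms(1) p1 assms(3) q_def \<Lambda> Cb _ w \<delta> f n h])
          fix m n h and P :: "real poly"
          assume "1 \<le> m" "m \<le> n" "degree P \<le> m - 1" "0 < h" "h \<le> 1 / (64 * exp 1 * real r * real n)"
          then show "\<exists>H. integrable lebesgue H \<and> (\<forall>x. 0 \<le> H x) \<and>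
            (\<forall>x\<in>{-1..1}. \<bar>sym_diff r (h * phi x) (poly P) x\<bar> powr p * avg_weight w n x \<le> H x) \<and>
            (LINT x|lebesgue. H x) \<le> Cb * (\<Lambda> * h powr q * real n powr \<delta> * real m powr (q - \<delta>))
                * wpow p (avg_weight w m) (poly P)"
            unfolding q_def using w cl \<gamma> \<Lambda> by (intro bound[rule_format]) auto
        qed
        then show "wnorm p (avg_weight w n) (\<lambda>x. sym_diff r (h * phi x) f x) \<le> (C * real n powr (\<delta> - q) * S) powr (1 / p)"
          unfolding wnorm_wpow using assms(1) wpow_nonneg[OF avg_weight_nonneg[OF w n]]
          by (intro powr_mono2) auto
      qed
      also have "\<dots> = C powr (1 / p) * (real n powr (\<delta> - q)) powr (1 / p) * S powr (1 / p)"
        by (simp only: powr_mult)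
      also have "(real n powr (\<delta> - q)) powr (1 / p) = 1 / real n powr (real r - \<delta> / p)"
      proof -
        have "(\<delta> - q) * (1 / p) = - (real r - \<delta> / p)" using assms(1) by (simp add: q_def field_simps)
        then show ?thesis by (simp only: powr_powr powr_minus_divide)
      qed
      finally show "modulus_phi r f (\<theta> / real n) p (avg_weight w n)
                \<le> C powr (1 / p) / real n powr (real r - \<delta> / p) *
                   (\<Sum>k=1..n. real k powr (real r * p - \<delta> - 1) *
                      best_approx k f p (avg_weight w k) powr p) powr (1 / p)"
        by (simp only: S_def q_def mult_1_right times_divide_eq_right)
    qed
  qed
qed

end
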